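(* Let $\mathcal{I}$ satisfy (A1)–(A7), (A10), (A11). If $A,B,C,D,E,F$ are rimpoints such that two of the three diagonal points of the hexagon $ABCDEF$, namely $P:=AB\cap DE$ and $Q:=BC\cap EF$, exist (as finite points), then either (i) $CD$ meets $FA$ in a finite point incident with $PQ$, or (ii) the lines $CD$, $FA$, $PQ$ have a common perpendicular.
   Context: $\mathcal{I}$ is an incidence structure of (finite) points and lines. Betweenness: for collinear $A,B,C$, $B$ is between $A$ and $C$ if every line through $B$ meets at least one line of each pair of intersecting lines through $A$ and $C$ respectively; segments and rays are defined as usual. Rays $r,s$ with endpoints $R,S$ are parallel if non-collinear and every line meeting one of them meets the other or the segment $\overline{RS}$; lines are parallel if they contain parallel rays. A rimpoint is a pair $(a,b)$ of parallel lines such that some line $\ell$ is parallel to both and some line meets $a,b,\ell$; $(a,b)=(c,d)$ if any two of $a,b,c,d$ are equal or parallel; $(a,b)$ is incident with $\ell$ if $\ell\in\{a,b\}$ or $\ell$ is parallel to both and some line meets $a,b,\ell$. "Point" means finite point or rimpoint; $AB$ is the line through distinct points $A,B$. For a rimpoint $X$ and finite point $A$, $X^A$ is the other rimpoint on $XA$, and $X^{AB}=(X^A)^B$; permutations act on the right and compose left to right. Axioms: (A1) two distinct points lie on a unique line; (A2) each line is on at least one point; (A3) there exist three non-collinear points and three collinear points; (A4) of three collinear points, at least one has the property that every line through it meets at least one of each pair of intersecting lines through the other two; (A5) if $P$ is not on $\ell$, there are two distinct lines on $P$ not meeting $\ell$ such that each line meeting $\ell$ meets at least one of them; (A6) any two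 non-collinear rays have a common parallel line; (A7) if $A,\dots,F$ are rimpoints such that $AB\cap DE$, $BC\cap EF$, $CD\cap FA$ exist as finite points, they are collinear; (A10) given distinct finite points $P,Q$ there exist lines $\ell$ on $P$ and $m$ on $Q$ such that two common parallels to $\ell$ and $m$ meet on $PQ$; (A11) if $X$ is a rimpoint not on a line $\ell$, there is a unique point $R$ on $\ell$ such that for every finite point $S$ on $\ell$, two common parallels to $\ell$ and $X^{SR}X^{RS}$ meet on $XR$. Every line carries exactly two rimpoints. Let $\mathcal{O}$ be the set of rimpoints; $AB//CD$ means lines $AB$, $CD$ meet in a finite point. A cyclic order $\mathcal{C}$ on $\mathcal{O}$ is compatible with $//$ if $AC//BD \iff (\mathcal{C}(A,B,C)\wedge\mathcal{C}(C,D,A))\vee(\mathcal{C}(A,D,C)\wedge\mathcal{C}(C,B,A))$. An order-preserving axial map is a non-identity permutation $\alpha$ of $\mathcal{O}$ preserving a cyclic order compatible with $//$, with a line $\ell$ (axis) such that for all rimpoints $X,Y$, if $XY^\alpha$ and $YX^\alpha$ meet, they meet in a finite point on $\ell$. For non-parallel lines $\ell,m$ with rimpoints $\{L_1,L_2\}$, $\{M_1,M_2\}$ labelled so that $L_1M_2//L_2M_1$, $\ell\bowtie m$ is the finite point $L_1M_2\cap L_2M_1$. Reflection: $\sigma_\ell$ fixes the rimpoints of $\ell$ and sends a rimpoint $A$ not on $\ell$ to $A^O$, $O=\ell\bowtie A^\alpha A^{\alpha^{-1}}$, for any order-preserving axial map $\alpha$ with axis $\ell$ (independent of $\alpha$ under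 the axioms). Lines $\ell,m$ are perpendicular if they meet in a finite point and $\sigma_\ell$ interchanges the rimpoints of $m$; a common perpendicular of several lines is a line perpendicular to each of them.
   Formalization: The six vertices are distinct; equal rimpoints must also be incident with each other's lines; A6 also allows a line containing one ray if the rays are not parallel; A11 takes S≠R; axial maps fix exactly the axis's rimpoints and some XY^α, YX^α meet in a finite point. *)

theory Defs
  imports "HOL-Combinatorics.Permutations"
begin

text \<open>
  An incidence structure is given by its incidence relation \<open>inc P l\<close> between a type of finite
  points and a type of lines.
\<close>

section \<open>Betweenness, rays, parallels\<close>

text \<open>
  Meeting lines are distinct. Otherwise a line would meet itself, and \<open>axiom_A5\<close>, applied to
  \<open>k = l\<close>, would be contradictory.
\<close>

definition meets :: "('p \<Rightarrow> 'l \<Rightarrow> bool) \<Rightarrow> 'l \<Rightarrow> 'l \<Rightarrow> bool" where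
  "meets inc l m \<longleftrightarrow> l \<noteq> m \<and> (\<exists>P. inc P l \<and> inc P m)"

definition collinear3 :: "('p \<Rightarrow> 'l \<Rightarrow> bool) \<Rightarrow> 'p \<Rightarrow> 'p \<Rightarrow> 'p \<Rightarrow> bool" where
  "collinear3 inc A B C \<longleftrightarrow> (\<exists>l. inc A l \<and> inc B l \<and> inc C l)"

text \<open>\<open>between inc A B C\<close>: the middle argument \<open>B\<close> is between \<open>A\<close> and \<open>C\<close>.\<close>

definition between :: "('p \<Rightarrow> 'l \<Rightarrow> bool) \<Rightarrow> 'p \<Rightarrow> 'p \<Rightarrow> 'p \<Rightarrow> bool" where
  "between inc A B C \<longleftrightarrow> distinct [A, B, C] \<and> collinear3 inc A B C \<and>
     (\<forall>l. inc B l \<longrightarrow> (\<forall>a c. inc A a \<and> inc C c \<and> meets inc a c \<longrightarrow> meets inc l a \<or> meets inc l c))"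

definition pts :: "('p \<Rightarrow> 'l \<Rightarrow> bool) \<Rightarrow> 'l \<Rightarrow> 'p set" where
  "pts inc l = {P. inc P l}"

text \<open>Segments and rays contain their endpoints; \<open>ray inc R A\<close> starts at \<open>R\<close> and passes through \<open>A\<close>.\<close>

definition segment :: "('p \<Rightarrow> 'l \<Rightarrow> bool) \<Rightarrow> 'p \<Rightarrow> 'p \<Rightarrow> 'p set" where
  "segment inc A B = {A, B} \<union> {X. between inc A X B}"

definition ray :: "('p \<Rightarrow> 'l \<Rightarrow> bool) \<Rightarrow> 'p \<Rightarrow> 'p \<Rightarrow> 'p set" where
  "ray inc R A = segment inc R A \<union> {X. between inc R A X}"

definition collinear_rays :: "('p \<Rightarrow> 'l \<Rightarrow> bool) \<Rightarrow> 'p \<Rightarrow> 'p \<Rightarrow> 'p \<Rightarrow> 'p \<Rightarrow> bool" where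
  "collinear_rays inc R A S B \<longleftrightarrow> (\<exists>l. ray inc R A \<union> ray inc S B \<subseteq> pts inc l)"

definition hits :: "('p \<Rightarrow> 'l \<Rightarrow> bool) \<Rightarrow> 'l \<Rightarrow> 'p set \<Rightarrow> bool" where
  "hits inc l T \<longleftrightarrow> pts inc l \<inter> T \<noteq> {}"

definition parallel_rays :: "('p \<Rightarrow> 'l \<Rightarrow> bool) \<Rightarrow> 'p \<Rightarrow> 'p \<Rightarrow> 'p \<Rightarrow> 'p \<Rightarrow> bool" where
  "parallel_rays inc R A S B \<longleftrightarrow> R \<noteq> A \<and> S \<noteq> B \<and> \<not> collinear_rays inc R A S B \<and>
     (\<forall>l. (hits inc l (ray inc R A) \<longrightarrow> hits inc l (ray inc S B) \<or> hits inc l (segment inc R S)) \<and>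
          (hits inc l (ray inc S B) \<longrightarrow> hits inc l (ray inc R A) \<or> hits inc l (segment inc R S)))"

definition parallel_to_ray :: "('p \<Rightarrow> 'l \<Rightarrow> bool) \<Rightarrow> 'l \<Rightarrow> 'p \<Rightarrow> 'p \<Rightarrow> bool" where
  "parallel_to_ray inc l R A \<longleftrightarrow> (\<exists>S B. ray inc S B \<subseteq> pts inc l \<and> parallel_rays inc S B R A)"

definition parallel :: "('p \<Rightarrow> 'l \<Rightarrow> bool) \<Rightarrow> 'l \<Rightarrow> 'l \<Rightarrow> bool" where
  "parallel inc l m \<longleftrightarrow>
     (\<exists>R A S B. ray inc R A \<subseteq> pts inc l \<and> ray inc S B \<subseteq> pts inc m \<and> parallel_rays inc R A S B)"


section \<open>Rimpoints\<close>

definition rimpair :: "('p \<Rightarrow> 'l \<Rightarrow> bool) \<Rightarrow> 'l \<times> 'l \<Rightarrow> bool" where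
  "rimpair inc = (\<lambda>(a, b). parallel inc a b \<and>
     (\<exists>l t. parallel inc l a \<and> parallel inc l b \<and> meets inc t a \<and> meets inc t b \<and> meets inc t l))"

definition rimpair_on :: "('p \<Rightarrow> 'l \<Rightarrow> bool) \<Rightarrow> 'l \<times> 'l \<Rightarrow> 'l \<Rightarrow> bool" where
  "rimpair_on inc = (\<lambda>(a, b) l. l \<in> {a, b} \<or> (parallel inc l a \<and> parallel inc l b \<and>
     (\<exists>t. meets inc t a \<and> meets inc t b \<and> meets inc t l)))"

text \<open>
  That \<open>a, b, c, d\<close> are pairwise equal or parallel does not suffice for \<open>(a, b)\<close> and \<open>(c, d)\<close> to be
  the same rimpoint: the three sides \<open>a, b, c\<close> of an ideal triangle are pairwise parallel, but
  \<open>(a, b)\<close> and \<open>(a, c)\<close> are different vertices. The last two conjuncts exclude this.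
\<close>

definition rim_rel :: "('p \<Rightarrow> 'l \<Rightarrow> bool) \<Rightarrow> (('l \<times> 'l) \<times> ('l \<times> 'l)) set" where
  "rim_rel inc = {((a, b), (c, d)). rimpair inc (a, b) \<and> rimpair inc (c, d) \<and>
     (\<forall>x \<in> {a, b, c, d}. \<forall>y \<in> {a, b, c, d}. x = y \<or> parallel inc x y) \<and>
     rimpair_on inc (a, b) c \<and> rimpair_on inc (a, b) d}"

type_synonym 'l rimpoint = "('l \<times> 'l) set"

definition rimpoints :: "('p \<Rightarrow> 'l \<Rightarrow> bool) \<Rightarrow> 'l rimpoint set" where
  "rimpoints inc = {p. rimpair inc p} // rim_rel inc"

datatype ('p, 'l) pt = Fin 'p | Rim "'l rimpoint"

fun on :: "('p \<Rightarrow> 'l \<Rightarrow> bool) \<Rightarrow> ('p, 'l) pt \<Rightarrow> 'l \<Rightarrow> bool" where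
  "on inc (Fin P) l = inc P l"
| "on inc (Rim X) l = (\<exists>p \<in> X. rimpair_on inc p l)"

definition join :: "('p \<Rightarrow> 'l \<Rightarrow> bool) \<Rightarrow> ('p, 'l) pt \<Rightarrow> ('p, 'l) pt \<Rightarrow> 'l" where
  "join inc X Y = (THE l. on inc X l \<and> on inc Y l)"

abbreviation rim_join :: "('p \<Rightarrow> 'l \<Rightarrow> bool) \<Rightarrow> 'l rimpoint \<Rightarrow> 'l rimpoint \<Rightarrow> 'l" where
  "rim_join inc X Y \<equiv> join inc (Rim X) (Rim Y)"

text \<open>\<open>other inc X A\<close> is $X^A$.\<close>

definition other :: "('p \<Rightarrow> 'l \<Rightarrow> bool) \<Rightarrow> 'l rimpoint \<Rightarrow> 'p \<Rightarrow> 'l rimpoint" where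
  "other inc X A =
     (THE Y. Y \<in> rimpoints inc \<and> Y \<noteq> X \<and> on inc (Rim Y) (join inc (Rim X) (Fin A)))"

text \<open>
  The lines \<open>AB\<close> and \<open>CD\<close> through rimpoints are defined and meet in the finite point \<open>P\<close>.
\<close>

definition rim_meet :: "('p \<Rightarrow> 'l \<Rightarrow> bool) \<Rightarrow>
    'l rimpoint \<Rightarrow> 'l rimpoint \<Rightarrow> 'l rimpoint \<Rightarrow> 'l rimpoint \<Rightarrow> 'p \<Rightarrow> bool" where
  "rim_meet inc A B C D P \<longleftrightarrow> A \<noteq> B \<and> C \<noteq> D \<and> rim_join inc A B \<noteq> rim_join inc C D \<and>
     inc P (rim_join inc A B) \<and> inc P (rim_join inc C D)"

text \<open>The relation $AB//CD$.\<close>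

definition rim_cross :: "('p \<Rightarrow> 'l \<Rightarrow> bool) \<Rightarrow>
    'l rimpoint \<Rightarrow> 'l rimpoint \<Rightarrow> 'l rimpoint \<Rightarrow> 'l rimpoint \<Rightarrow> bool" where
  "rim_cross inc A B C D \<longleftrightarrow> (\<exists>P. rim_meet inc A B C D P)"

definition common_parallels_meet_on :: "('p \<Rightarrow> 'l \<Rightarrow> bool) \<Rightarrow> 'l \<Rightarrow> 'l \<Rightarrow> 'l \<Rightarrow> bool" where
  "common_parallels_meet_on inc l m k \<longleftrightarrow>
     (\<exists>c d Z. c \<noteq> d \<and> parallel inc c l \<and> parallel inc c m \<and> parallel inc d l \<and> parallel inc d m \<and>
        inc Z c \<and> inc Z d \<and> inc Z k)"


section \<open>Axioms\<close>

definition axiom_A1 :: "('p \<Rightarrow> 'l \<Rightarrow> bool) \<Rightarrow> bool" where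
  "axiom_A1 inc \<longleftrightarrow> (\<forall>P Q. P \<noteq> Q \<longrightarrow> (\<exists>!l. inc P l \<and> inc Q l))"

definition axiom_A2 :: "('p \<Rightarrow> 'l \<Rightarrow> bool) \<Rightarrow> bool" where
  "axiom_A2 inc \<longleftrightarrow> (\<forall>l. \<exists>P. inc P l)"

definition axiom_A3 :: "('p \<Rightarrow> 'l \<Rightarrow> bool) \<Rightarrow> bool" where
  "axiom_A3 inc \<longleftrightarrow>
     (\<exists>A B C. distinct [A, B, C] \<and> \<not> collinear3 inc A B C) \<and>
     (\<exists>A B C. distinct [A, B, C] \<and> collinear3 inc A B C)"

definition axiom_A4 :: "('p \<Rightarrow> 'l \<Rightarrow> bool) \<Rightarrow> bool" where
  "axiom_A4 inc \<longleftrightarrow> (\<forall>A B C. distinct [A, B, C] \<and> collinear3 inc A B C \<longrightarrow>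
     between inc B A C \<or> between inc A B C \<or> between inc A C B)"

definition axiom_A5 :: "('p \<Rightarrow> 'l \<Rightarrow> bool) \<Rightarrow> bool" where
  "axiom_A5 inc \<longleftrightarrow> (\<forall>P l. \<not> inc P l \<longrightarrow>
     (\<exists>m n. m \<noteq> n \<and> inc P m \<and> inc P n \<and> \<not> meets inc m l \<and> \<not> meets inc n l \<and>
        (\<forall>k. meets inc k l \<longrightarrow> meets inc k m \<or> meets inc k n)))"

text \<open>
  Let the ray from \<open>R\<close> through \<open>A\<close> lie on the line joining the ideal ends of the two rays. This line
  is then the only candidate for a common parallel, but a line is not parallel to the rays it
  contains. In this case, which the last two disjuncts describe, the line counts as common parallel.
\<close>

definition axiom_A6 :: "('p \<Rightarrow> 'l \<Rightarrow> bool) \<Rightarrow> bool" where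
  "axiom_A6 inc \<longleftrightarrow> (\<forall>R A S B. R \<noteq> A \<and> S \<noteq> B \<and> \<not> collinear_rays inc R A S B \<longrightarrow>
     (\<exists>l. (parallel_to_ray inc l R A \<and> parallel_to_ray inc l S B) \<or>
          (\<not> parallel_rays inc R A S B \<and> ray inc R A \<subseteq> pts inc l \<and> parallel_to_ray inc l S B) \<or>
          (\<not> parallel_rays inc R A S B \<and> parallel_to_ray inc l R A \<and> ray inc S B \<subseteq> pts inc l)))"

definition axiom_A7 :: "('p \<Rightarrow> 'l \<Rightarrow> bool) \<Rightarrow> bool" where
  "axiom_A7 inc \<longleftrightarrow> (\<forall>A B C D E F P Q R.
     {A, B, C, D, E, F} \<subseteq> rimpoints inc \<and>
     rim_meet inc A B D E P \<and> rim_meet inc B C E F Q \<and> rim_meet inc C D F A R \<longrightarrow>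
     collinear3 inc P Q R)"

definition axiom_A10 :: "('p \<Rightarrow> 'l \<Rightarrow> bool) \<Rightarrow> bool" where
  "axiom_A10 inc \<longleftrightarrow> (\<forall>P Q. P \<noteq> Q \<longrightarrow>
     (\<exists>l m. inc P l \<and> inc Q m \<and> common_parallels_meet_on inc l m (join inc (Fin P) (Fin Q))))"

text \<open>
  \<open>S\<close> differs from \<open>R\<close>, since $X^{RR} = X$ and so $X^{SR}X^{RS}$ is undefined for \<open>S = R\<close>.
\<close>

definition axiom_A11 :: "('p \<Rightarrow> 'l \<Rightarrow> bool) \<Rightarrow> bool" where
  "axiom_A11 inc \<longleftrightarrow> (\<forall>X \<in> rimpoints inc. \<forall>l. \<not> on inc (Rim X) l \<longrightarrow>
     (\<exists>!R. inc R l \<and> (\<forall>S. inc S l \<and> S \<noteq> R \<longrightarrow>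
        common_parallels_meet_on inc l
          (rim_join inc (other inc (other inc X S) R) (other inc (other inc X R) S))
          (join inc (Rim X) (Fin R)))))"


section \<open>Axial maps, reflections and perpendicularity\<close>

definition cyclic_order_on :: "'a set \<Rightarrow> ('a \<Rightarrow> 'a \<Rightarrow> 'a \<Rightarrow> bool) \<Rightarrow> bool" where
  "cyclic_order_on S C \<longleftrightarrow>
     (\<forall>x \<in> S. \<forall>y \<in> S. \<forall>z \<in> S. C x y z \<longrightarrow> C y z x) \<and>
     (\<forall>x \<in> S. \<forall>y \<in> S. \<forall>z \<in> S. C x y z \<longrightarrow> \<not> C z y x) \<and>
     (\<forall>x \<in> S. \<forall>y \<in> S. \<forall>z \<in> S. \<forall>w \<in> S. C x y z \<and> C x z w \<longrightarrow> C x y w) \<and>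
     (\<forall>x \<in> S. \<forall>y \<in> S. \<forall>z \<in> S. distinct [x, y, z] \<longrightarrow> C x y z \<or> C z y x)"

definition compatible_order ::
    "('p \<Rightarrow> 'l \<Rightarrow> bool) \<Rightarrow> ('l rimpoint \<Rightarrow> 'l rimpoint \<Rightarrow> 'l rimpoint \<Rightarrow> bool) \<Rightarrow> bool" where
  "compatible_order inc \<C> \<longleftrightarrow>
     (\<forall>A \<in> rimpoints inc. \<forall>B \<in> rimpoints inc. \<forall>C \<in> rimpoints inc. \<forall>D \<in> rimpoints inc.
        rim_cross inc A C B D \<longleftrightarrow> (\<C> A B C \<and> \<C> C D A) \<or> (\<C> A D C \<and> \<C> C B A))"

definition order_preserving ::
    "('p \<Rightarrow> 'l \<Rightarrow> bool) \<Rightarrow> ('l rimpoint \<Rightarrow> 'l rimpoint) \<Rightarrow> bool" where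
  "order_preserving inc \<alpha> \<longleftrightarrow>
     (\<exists>\<C>. cyclic_order_on (rimpoints inc) \<C> \<and> compatible_order inc \<C> \<and>
        (\<forall>X \<in> rimpoints inc. \<forall>Y \<in> rimpoints inc. \<forall>Z \<in> rimpoints inc.
           \<C> X Y Z \<longleftrightarrow> \<C> (\<alpha> X) (\<alpha> Y) (\<alpha> Z)))"

text \<open>
  The condition that the finite points $XY^\alpha \cap YX^\alpha$ all lie on the axis \<open>l\<close> does not
  determine \<open>l\<close>: for limit rotations and rotations there are no such points, so it holds for every
  \<open>l\<close>, and the reflection below would depend on the map. The last two conjuncts, satisfied by the
  translations along \<open>l\<close>, exclude these degenerate cases: the fixed rimpoints are those of \<open>l\<close>, and
  some point $XY^\alpha \cap YX^\alpha$ exists.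
\<close>

definition order_preserving_axial_map ::
    "('p \<Rightarrow> 'l \<Rightarrow> bool) \<Rightarrow> ('l rimpoint \<Rightarrow> 'l rimpoint) \<Rightarrow> 'l \<Rightarrow> bool" where
  "order_preserving_axial_map inc \<alpha> l \<longleftrightarrow>
     \<alpha> permutes rimpoints inc \<and> \<alpha> \<noteq> id \<and> order_preserving inc \<alpha> \<and>
     (\<forall>X \<in> rimpoints inc. \<forall>Y \<in> rimpoints inc. \<forall>Z. rim_meet inc X (\<alpha> Y) Y (\<alpha> X) Z \<longrightarrow> inc Z l) \<and>
     (\<forall>X \<in> rimpoints inc. \<alpha> X = X \<longleftrightarrow> on inc (Rim X) l) \<and>
     (\<exists>X \<in> rimpoints inc. \<exists>Y \<in> rimpoints inc. \<exists>Z. rim_meet inc X (\<alpha> Y) Y (\<alpha> X) Z)"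

text \<open>\<open>bowtie inc l m\<close> is $l \bowtie m$.\<close>

definition bowtie :: "('p \<Rightarrow> 'l \<Rightarrow> bool) \<Rightarrow> 'l \<Rightarrow> 'l \<Rightarrow> 'p" where
  "bowtie inc l m = (THE Z. \<exists>L1 L2 M1 M2.
     {X \<in> rimpoints inc. on inc (Rim X) l} = {L1, L2} \<and> L1 \<noteq> L2 \<and>
     {X \<in> rimpoints inc. on inc (Rim X) m} = {M1, M2} \<and> M1 \<noteq> M2 \<and>
     rim_meet inc L1 M2 L2 M1 Z)"

text \<open>
  The definite description ranges over the images of \<open>A\<close> obtained from all axial maps with axis
  \<open>l\<close>; it denotes their common value.
\<close>

definition reflection :: "('p \<Rightarrow> 'l \<Rightarrow> bool) \<Rightarrow> 'l \<Rightarrow> 'l rimpoint \<Rightarrow> 'l rimpoint" where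
  "reflection inc l A =
     (if on inc (Rim A) l then A
      else (THE B. \<exists>\<alpha>. order_preserving_axial_map inc \<alpha> l \<and>
              B = other inc A (bowtie inc l (rim_join inc (\<alpha> A) (inv \<alpha> A)))))"

definition perpendicular :: "('p \<Rightarrow> 'l \<Rightarrow> bool) \<Rightarrow> 'l \<Rightarrow> 'l \<Rightarrow> bool" where
  "perpendicular inc l m \<longleftrightarrow> meets inc l m \<and>
     (\<exists>M1 M2. {X \<in> rimpoints inc. on inc (Rim X) m} = {M1, M2} \<and> M1 \<noteq> M2 \<and>
        reflection inc l M1 = M2 \<and> reflection inc l M2 = M1)"

end

theory Submission
  imports Defs
begin

text \<open>
  From (A1)--(A5) one gets plane separation and the linear order of the lines, the crux being the
  outer form of Pasch's axiom. Limiting rays then divide the lines into pencils, and with (A6) the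
  pencils become the rimpoints; crossing of the joining lines is a separation relation on them.

  Each finite point \<open>P\<close> acts on the rimpoints as the involution \<open>X \<mapsto> X\<^sup>P\<close>. By Pascal's theorem (A7) the
  product of three such involutions with centres on a line \<open>l\<close> is again one, so the products of two of
  them form an abelian group of translations along \<open>l\<close>. The point \<open>R\<close> of (A11) is the foot of \<open>X\<close> on
  \<open>l\<close>, the reflection in \<open>l\<close> is \<open>X \<mapsto> X\<^sup>R\<close>, and it commutes with all points of \<open>l\<close>.

  Let \<open>l = PQ\<close>, so that \<open>A = C\<^sup>Q\<^sup>P\<close> and \<open>F = D\<^sup>P\<^sup>Q\<close>. If \<open>CD\<close> meets \<open>l\<close> in \<open>R\<close>, then
  \<open>A\<^sup>R = C\<^sup>Q\<^sup>P\<^sup>R = C\<^sup>R\<^sup>P\<^sup>Q = F\<close>. Otherwise \<open>C\<close> and \<open>D\<close> are on the same side of \<open>l\<close>, and the line \<open>n\<close>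
  perpendicular to \<open>l\<close> in the point \<open>Z\<close> with \<open>(\<sigma>\<^sub>l C)\<^sup>Z = D\<close>, which exists since (A10) yields midpoints,
  interchanges \<open>C\<close> with \<open>D\<close> and \<open>A\<close> with \<open>F\<close>.
\<close>

section \<open>Order\<close>

text \<open>The axioms contain neither a Pasch axiom nor the extension of segments. Their place is
  taken by \<open>avoider_cut\<close>: among the lines through \<open>P\<close> that avoid
  \<open>l\<close>, one meets any prescribed line \<open>k\<close> that meets \<open>l\<close>.
  Feeding such a line into the definition of betweenness yields most contradictions in the first
  section, and the inner one of the two lines of \<open>axiom_A5\<close> later carries the limiting
  ray. (A7) is silent unless all three pairs of opposite sides meet. Hence the separation relation
  has to be available before the group of translations: it shows that the third pair crosses.
  Reflections are defined by arbitrary axial maps, whereas (A11) speaks of feet. The two are matched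
  one rimpoint \<open>A\<close> at a time: there an axial map and its inverse act like a translation
  along the axis and the inverse translation, and the line joining the two images of
  \<open>A\<close> is one of the lines that occur in (A11).\<close>

locale menger =
  fixes inc :: "'p \<Rightarrow> 'l \<Rightarrow> bool"
  assumes A1: "axiom_A1 inc" and A2: "axiom_A2 inc" and A3: "axiom_A3 inc"
    and A4: "axiom_A4 inc" and A5: "axiom_A5 inc"
begin

section \<open>Disjoint lines and betweenness\<close>

definition dj :: "'l \<Rightarrow> 'l \<Rightarrow> bool" where
  "dj l m \<longleftrightarrow> (\<forall>P. \<not> (inc P l \<and> inc P m))"

definition ln :: "'p \<Rightarrow> 'p \<Rightarrow> 'l" where
  "ln P Q = (THE l. inc P l \<and> inc Q l)"

abbreviation btw :: "'p \<Rightarrow> 'p \<Rightarrow> 'p \<Rightarrow> bool" where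
  "btw \<equiv> between inc"

lemma uniq: "\<lbrakk>inc P l; inc Q l; inc P m; inc Q m; P \<noteq> Q\<rbrakk> \<Longrightarrow> l = m"
  using A1 unfolding axiom_A1_def by metis

lemma ln_inc: assumes "P \<noteq> Q" shows "inc P (ln P Q)" "inc Q (ln P Q)"
proof -
  have "\<exists>!l. inc P l \<and> inc Q l" using A1 assms unfolding axiom_A1_def by blast
  from theI'[OF this] show "inc P (ln P Q)" "inc Q (ln P Q)" unfolding ln_def by auto
qed

lemma ln_eq: "\<lbrakk>P \<noteq> Q; inc P l; inc Q l\<rbrakk> \<Longrightarrow> ln P Q = l"
  using ln_inc uniq by metis

lemma dj_sym: "dj l m \<longleftrightarrow> dj m l"
  unfolding dj_def by blast

lemma djD: "\<lbrakk>dj l m; inc P l\<rbrakk> \<Longrightarrow> \<not> inc P m" "\<lbrakk>dj l m; inc P m\<rbrakk> \<Longrightarrow> \<not> inc P l"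
  unfolding dj_def by blast+

lemma not_dj: "\<not> dj l m \<longleftrightarrow> (\<exists>P. inc P l \<and> inc P m)"
  unfolding dj_def by blast

lemma ex_pt: "\<exists>P. inc P l"
  using A2 unfolding axiom_A2_def by blast

lemma dj_irrefl: "\<not> dj l l"
  using ex_pt unfolding dj_def by blast

lemma meets_dj: "meets inc l m \<longleftrightarrow> l \<noteq> m \<and> \<not> dj l m"
  unfolding meets_def dj_def by blast

lemma avoiders:
  assumes "\<not> inc P l"
  shows "\<exists>m n. m \<noteq> n \<and> inc P m \<and> inc P n \<and> dj m l \<and> dj n l \<and>
    (\<forall>k. k \<noteq> l \<longrightarrow> \<not> dj k l \<longrightarrow> \<not> dj k m \<or> \<not> dj k n)"
proof -
  obtain m n where "m \<noteq> n" "inc P m" "inc P n" "\<not> meets inc m l" "\<not> meets inc n l"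
    "\<forall>k. meets inc k l \<longrightarrow> meets inc k m \<or> meets inc k n"
    using A5 assms unfolding axiom_A5_def by metis
  moreover have "m \<noteq> l" "n \<noteq> l" using calculation assms by auto
  ultimately show ?thesis unfolding meets_dj by metis
qed

lemma avoider:
  assumes "\<not> inc P l" shows "\<exists>m. inc P m \<and> dj m l \<and> m \<noteq> d"
  using avoiders[OF assms] by metis

lemma avoider_cut:
  assumes "\<not> inc P l" "k \<noteq> l" "\<not> dj k l"
  shows "\<exists>m. inc P m \<and> dj m l \<and> \<not> dj k m"
  using avoiders[OF assms(1)] assms(2,3) by metis

lemma btw_sym: "btw A B C \<longleftrightarrow> btw C B A"
  unfolding between_def collinear3_def meets_def by (auto; blast)

lemma btw_distinct: "btw A B C \<Longrightarrow> A \<noteq> B \<and> B \<noteq> C \<and> A \<noteq> C"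
  unfolding between_def by auto

lemma btw_col: "btw A B C \<Longrightarrow> \<exists>l. inc A l \<and> inc B l \<and> inc C l"
  unfolding between_def collinear3_def by auto

lemma btw_on:
  "\<lbrakk>btw A B C; inc A l; inc C l\<rbrakk> \<Longrightarrow> inc B l"
  "\<lbrakk>btw A B C; inc A l; inc B l\<rbrakk> \<Longrightarrow> inc C l"
  "\<lbrakk>btw A B C; inc B l; inc C l\<rbrakk> \<Longrightarrow> inc A l"
  using btw_col btw_distinct uniq by metis+

text \<open>The form in which betweenness is used throughout. The definition says nothing for
  \<open>a = c\<close>; in that case \<open>B\<close> itself lies on \<open>a\<close>, so
  \<open>dj l a\<close> fails.\<close>

lemma btw_dj:
  assumes "btw A B C" "inc B l" "inc A a" "inc C c" "dj l a" "dj l c"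
  shows "dj a c"
proof (rule ccontr)
  assume "\<not> dj a c"
  moreover have "a \<noteq> c" using assms btw_on(1) djD by metis
  ultimately have "meets inc l a \<or> meets inc l c"
    using assms unfolding between_def meets_dj by metis
  thus False using assms(5,6) meets_dj by blast
qed

lemma btw_cases:
  assumes "inc A l" "inc B l" "inc C l" "A \<noteq> B" "B \<noteq> C" "A \<noteq> C"
  shows "btw B A C \<or> btw A B C \<or> btw A C B"
  using A4 assms unfolding axiom_A4_def collinear3_def by auto

lemma ex_off: "\<exists>P. \<not> inc P l"
  using A3 unfolding axiom_A3_def collinear3_def by metis

lemma ex_other_line: assumes "inc B l" shows "\<exists>b. inc B b \<and> b \<noteq> l"
  using ex_off[of l] ln_inc assms by metis

text \<open>The lines \<open>u\<close>, \<open>v\<close> through \<open>C\<close> avoid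
  \<open>b\<close>, and \<open>p\<close> through \<open>A\<close> avoids \<open>u\<close> but meets
  \<open>v\<close>. With \<open>B\<close> in the middle, \<open>b\<close> has to meet
  \<open>p\<close>; with \<open>C\<close> in the middle, \<open>u\<close> keeps \<open>p\<close> and
  \<open>b\<close> apart.\<close>

lemma btw_excl: assumes "btw A B C" shows "\<not> btw A C B"
proof
  assume acb: "btw A C B"
  obtain l where l: "inc A l" "inc B l" "inc C l" using btw_col assms by blast
  have dist: "A \<noteq> B" "B \<noteq> C" "A \<noteq> C" using btw_distinct assms by auto
  obtain b where b: "inc B b" "b \<noteq> l" using ex_other_line l by blast
  have "\<not> inc C b" using b l dist uniq by metis
  from avoiders[OF this] obtain u v where
    uv: "u \<noteq> v" "inc C u" "inc C v" "dj u b" "dj v b" by blast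
  have "\<not> inc A u" using uv l dist uniq b djD by metis
  moreover have "\<not> dj v u" using uv not_dj by blast
  ultimately obtain p where p: "inc A p" "dj p u" "\<not> dj v p"
    using avoider_cut[of A u v] uv by metis
  have "\<not> dj b p" using btw_dj[OF assms b(1) p(1) uv(3)] uv p dj_sym by metis
  moreover have "dj p b" using btw_dj[OF acb uv(2) p(1) b(1)] uv p dj_sym by metis
  ultimately show False using dj_sym by blast
qed

text \<open>Being on the same side of \<open>d\<close>. By \<open>btw_not_SS\<close> and \<open>not_SS_btw\<close>, betweenness, which is
  defined by all lines through the middle point, is already decided by any single one of them.\<close>

definition SS :: "'l \<Rightarrow> 'p \<Rightarrow> 'p \<Rightarrow> bool" where
  "SS d A B \<longleftrightarrow> (\<exists>x y T. inc A x \<and> inc T x \<and> inc T y \<and> inc B y \<and> dj x d \<and> dj y d)"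

lemma SS_sym: "SS d A B \<longleftrightarrow> SS d B A"
  unfolding SS_def by blast

lemma SS_off: "SS d A B \<Longrightarrow> \<not> inc A d \<and> \<not> inc B d"
  unfolding SS_def dj_def by blast

lemma SS_path: "\<lbrakk>inc A x; inc T x; inc T y; inc B y; dj x d; dj y d\<rbrakk> \<Longrightarrow> SS d A B"
  unfolding SS_def by blast

lemma SS_line: "\<lbrakk>inc A x; inc B x; dj x d\<rbrakk> \<Longrightarrow> SS d A B"
  unfolding SS_def by blast

lemma SS_refl: "\<not> inc A d \<Longrightarrow> SS d A A"
  using avoider SS_line by metis

lemma btw_not_SS: assumes "btw A D B" "inc D d" shows "\<not> SS d A B"
proof
  assume "SS d A B"
  then obtain x y T where "inc A x" "inc T x" "inc T y" "inc B y" "dj x d" "dj y d"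
    unfolding SS_def by blast
  thus False using btw_dj[OF assms, of x y] dj_sym djD by metis
qed

text \<open>Take \<open>y\<close> through \<open>B\<close> that avoids \<open>x1\<close> and meets
  \<open>x2\<close>. With \<open>A\<close> in the middle, \<open>x1\<close> keeps \<open>d\<close>
  and \<open>y\<close> apart, so \<open>x2\<close> and \<open>y\<close> form a path from
  \<open>A\<close> to \<open>B\<close> avoiding \<open>d\<close>, which \<open>av\<close>
  forbids.\<close>

lemma not_SS_btw_aux:
  assumes dab: "btw D A B" and "inc D d" "\<not> inc A d"
    and av: "\<And>x y. \<lbrakk>inc A x; inc B y; dj x d; dj y d\<rbrakk> \<Longrightarrow> dj x y"
  shows False
proof -
  obtain m where m: "inc D m" "inc A m" "inc B m" using btw_col dab by blast
  obtain x1 x2 where x: "x1 \<noteq> x2" "inc A x1" "inc A x2" "dj x1 d" "dj x2 d"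
    using avoiders assms by metis
  have "\<not> inc B x1" using x m uniq btw_distinct dab assms djD by metis
  moreover have "\<not> dj x2 x1" using x not_dj by blast
  ultimately obtain y where y: "inc B y" "dj y x1" "\<not> dj x2 y"
    using avoider_cut[of B x1 x2] x by metis
  have "dj d y" using btw_dj[OF dab x(2) assms(2) y(1)] x y dj_sym by metis
  thus False using av[OF x(3) y(1) x(5)] y dj_sym by metis
qed

lemma not_SS_btw:
  assumes "\<not> inc A d" "\<not> inc B d" "\<not> SS d A B"
  shows "\<exists>D. inc D d \<and> btw A D B"
proof -
  have ne: "A \<noteq> B" using assms SS_refl by metis
  have av: "dj x y" if "inc A x" "inc B y" "dj x d" "dj y d" for x y
    using that assms(3) SS_path not_dj by metis
  have "\<not> dj (ln A B) d" using assms(3) SS_line ln_inc ne by metis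
  then obtain D where D: "inc D (ln A B)" "inc D d" using not_dj by blast
  have "\<not> btw D A B" using not_SS_btw_aux[OF _ D(2) assms(1) av] by blast
  moreover have "\<not> btw D B A" using not_SS_btw_aux[OF _ D(2) assms(2), of A] av dj_sym by metis
  ultimately have "btw A D B"
    using btw_cases[of A "ln A B" D B] ln_inc[OF ne] D ne assms btw_sym by metis
  thus ?thesis using D by blast
qed

text \<open>Here \<open>f\<close> is a second line through \<open>E\<close> avoiding
  \<open>y\<close>, and \<open>x\<close> through \<open>A\<close> avoids \<open>d\<close> but meets
  \<open>f\<close>. If \<open>d\<close> avoided \<open>y\<close>, then \<open>d\<close> would keep
  \<open>x\<close> from \<open>y\<close>, and hence \<open>y\<close> would keep \<open>x\<close>
  from \<open>f\<close>.\<close>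

lemma inner_pasch:
  assumes adb: "btw A D B" and ace: "btw A C E"
    and "inc D d" "inc E d" "inc B y" "inc C y" "\<not> inc A d"
  shows "\<not> dj d y"
proof
  assume dy: "dj d y"
  obtain f where f: "inc E f" "dj f y" "f \<noteq> d" using avoider dy assms djD by metis
  have "\<not> dj f d" using f assms not_dj by blast
  then obtain x where x: "inc A x" "dj x d" "\<not> dj f x"
    using avoider_cut[of A d f] assms f by metis
  have "dj x y" using btw_dj[OF adb assms(3) x(1) assms(5)] x dy dj_sym by metis
  hence "dj x f" using btw_dj[OF ace assms(6) x(1) f(1)] f dj_sym by metis
  thus False using x dj_sym by blast
qed

text \<open>By \<open>not_SS_btw\<close> a single line \<open>k\<close> through \<open>B\<close> is
  enough. A path \<open>x\<close>, \<open>z\<close> from \<open>A\<close> to \<open>C\<close>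
  avoiding \<open>k\<close> is refuted by a line through \<open>D\<close> that avoids
  \<open>z\<close> and meets \<open>x\<close>.\<close>

lemma btw_shrink: assumes abd: "btw A B D" and bcd: "btw B C D" shows "btw A B C"
proof -
  obtain l where l: "inc A l" "inc B l" "inc D l" using btw_col abd by blast
  have lC: "inc C l" using btw_on(1) bcd l by metis
  obtain k where k: "inc B k" "k \<noteq> l" using ex_other_line l by blast
  have ne: "A \<noteq> B" "B \<noteq> C" "C \<noteq> D" "B \<noteq> D" using btw_distinct abd bcd by auto
  have off: "\<not> inc A k" "\<not> inc C k" "\<not> inc D k" using uniq k l lC ne by metis+
  have "\<not> SS k A C"
  proof
    assume "SS k A C"
    then obtain x z T where t: "inc A x" "inc T x" "inc T z" "inc C z" "dj x k" "dj z k"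
      unfolding SS_def by blast
    have "\<not> inc D z" using t l lC k ne uniq djD by metis
    moreover have "\<not> dj x z" using t not_dj by blast
    moreover have "x \<noteq> z"
    proof
      assume "x = z"
      hence "inc A z" "inc C z" using t by auto
      moreover have "A \<noteq> C" using abd bcd btw_excl btw_sym by metis
      ultimately have "z = l" using uniq l lC by metis
      thus False using t k l djD by metis
    qed
    ultimately obtain d where d: "inc D d" "dj d z" "\<not> dj x d"
      using avoider_cut[of D z x] by metis
    have "dj k d" using btw_dj[OF bcd t(4) k(1) d(1)] t d dj_sym by metis
    hence "dj x d" using btw_dj[OF abd k(1) t(1) d(1)] t dj_sym by metis
    thus False using d by blast
  qed
  then obtain E where "inc E k" "btw A E C" using not_SS_btw off by blast
  moreover have "E = B" using calculation btw_on(1) l lC k uniq by metis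
  ultimately show ?thesis by blast
qed

section \<open>Pseudolinear quadruples and the outer form of Pasch's axiom\<close>

definition pseudo :: "'p \<Rightarrow> 'p \<Rightarrow> 'p \<Rightarrow> 'p \<Rightarrow> bool" where
  "pseudo A B C D \<longleftrightarrow> btw A B C \<and> btw B C D \<and> btw C D A \<and> btw D A B"

text \<open>\<open>btw_cases\<close>, \<open>btw_excl\<close> and \<open>btw_shrink\<close> leave
  one exception to the linear order of four points, Menger's pseudolinear quadruple: the betweenness
  of the corners of a square, with distances measured along its perimeter.\<close>

lemma four_points:
  assumes l: "inc A l" "inc B l" "inc C l" "inc D l" and d: "distinct [A, B, C, D]" and b: "btw A B C"
  shows "btw A B D \<or> btw C B D \<or> pseudo A B C D"
proof (rule ccontr)
  assume "\<not> ?thesis"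
  hence n: "\<not> btw A B D" "\<not> btw C B D" "\<not> pseudo A B C D" by auto
  have "\<not> btw A D B" using btw_shrink[of C B A D] b n btw_sym by blast
  hence 1: "btw D A B" using btw_cases[of A l B D] l d n btw_sym by auto
  have "\<not> btw C D B" using btw_shrink[of A B C D] b n btw_sym by blast
  hence 2: "btw B C D" using btw_cases[of B l C D] l d n btw_sym by auto
  have "\<not> btw C A D" using btw_shrink[of B C D A] 2 b btw_excl btw_sym by blast
  moreover have "\<not> btw A C D" using btw_shrink[of B A D C] 1 b btw_excl btw_sym by blast
  ultimately have "btw C D A" using btw_cases[of A l C D] l d btw_sym by auto
  thus False using n b 1 2 unfolding pseudo_def by blast
qed

text \<open>By \<open>four_points\<close>, each of the four consecutive triples leaves three
  positions for \<open>V\<close>; all combinations clash with \<open>btw_excl\<close> or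
  \<open>btw_shrink\<close>.\<close>

lemma pseudo_no_fifth:
  assumes p: "pseudo A B C D" and l: "inc A l" "inc C l" "inc V l"
  shows "V \<in> {A, B, C, D}"
proof (rule ccontr)
  assume "V \<notin> {A, B, C, D}"
  hence ne: "V \<noteq> A" "V \<noteq> B" "V \<noteq> C" "V \<noteq> D" by auto
  have b: "btw A B C" "btw B C D" "btw C D A" "btw D A B" using p pseudo_def by auto
  have l2: "inc B l" "inc D l" using btw_on b l by blast+
  have x: "\<not> (btw P Q R \<and> btw P R Q)" for P Q R using btw_excl by blast
  have s: "btw P Q R \<longleftrightarrow> btw R Q P" for P Q R by (rule btw_sym)
  have r: "btw P Q S \<and> btw Q R S \<longrightarrow> btw P Q R" for P Q R S using btw_shrink by blast
  have d: "distinct [A,B,C,D,V]" using b btw_distinct ne by auto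
  note f = four_points[OF _ _ _ _ _ b(1), of l V] four_points[OF _ _ _ _ _ b(2), of l V]
     four_points[OF _ _ _ _ _ b(3), of l V] four_points[OF _ _ _ _ _ b(4), of l V]
  have f1: "btw A B V \<or> btw C B V \<or> pseudo A B C V" using f(1) l l2 d by auto
  have f2: "btw B C V \<or> btw D C V \<or> pseudo B C D V" using f(2) l l2 d by auto
  have f3: "btw C D V \<or> btw A D V \<or> pseudo C D A V" using f(3) l l2 d by auto
  have f4: "btw D A V \<or> btw B A V \<or> pseudo D A B V" using f(4) l l2 d by auto
  have f5: "btw C A V \<or> btw A C V \<or> btw A V C" using btw_cases[of A l C V] l d by auto
  have f6: "btw D B V \<or> btw B D V \<or> btw B V D" using btw_cases[of B l D V] l2 l d by auto
  show False using f1 f2 f3 f4 f5 f6 b s x r unfolding pseudo_def by (smt (verit))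
qed

definition good :: "'l \<Rightarrow> bool" where
  "good n \<longleftrightarrow> (\<forall>A B C D. inc A n \<and> inc B n \<and> inc C n \<and> inc D n \<longrightarrow> \<not> pseudo A B C D)"

lemma good_four:
  assumes "good n" "btw A D C" "inc A n" "inc C n" "inc N n" "N \<noteq> D"
  shows "btw A D N \<or> btw C D N"
proof (cases "N = A \<or> N = C")
  case True thus ?thesis using assms btw_sym by blast
next
  case False
  have "inc D n" using assms btw_on(1) by blast
  moreover have "distinct [A, D, C, N]" using assms False btw_distinct[OF assms(2)] by auto
  ultimately show ?thesis using four_points[of A n D C N] assms unfolding good_def by blast
qed

text \<open>The outer form of Pasch's axiom. Its proof first replaces \<open>y\<close> by one of the two lines that
  \<open>axiom_A5\<close> provides for \<open>U\<close> and \<open>d\<close>; the other one is \<open>v\<close>.\<close>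

lemma outer_pasch_aux:
  assumes adc: "btw A D C" and n: "inc A n" "inc C n" "good n" and eau: "btw E A U"
    and "inc D d" "inc E d" and "inc C y" "inc U y" and "inc U v"
    and dy: "dj y d" and dv: "dj v d"
    and H: "\<And>k. \<lbrakk>k \<noteq> d; \<not> dj k d\<rbrakk> \<Longrightarrow> \<not> dj k y \<or> \<not> dj k v"
    and "\<not> inc A d"
  shows False
proof -
  note S = dj_sym
  have Dn: "inc D n" using btw_on(1) adc n by blast
  have nAC: "\<not> SS d A C" using btw_not_SS[OF adc] assms by blast
  have offd: "\<not> inc C d" "\<not> inc U d" using assms djD by blast+
  obtain x where x: "inc A x" "dj x d" using avoider \<open>\<not> inc A d\<close> by metis
  have xy: "dj x y" using btw_dj[OF adc \<open>inc D d\<close> x(1) \<open>inc C y\<close>] x dy S by blast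
  have "\<not> inc E x" using x djD \<open>inc E d\<close> by blast
  then obtain e where e: "inc E e" "dj e x" "e \<noteq> d" using avoider by metis
  have "dj e y" using btw_dj[OF eau x(1) e(1) \<open>inc U y\<close>] e xy S by blast
  hence ev: "\<not> dj e v" using H[OF e(3)] not_dj e(1) \<open>inc E d\<close> by blast
  have "\<not> dj x v" using btw_dj[OF eau x(1) e(1) \<open>inc U v\<close>] e ev S by blast
  then obtain X where X: "inc X x" "inc X v" using not_dj by blast
  \<comment> \<open>A common point of \<open>v\<close> and \<open>n\<close> would be on the same
    side of \<open>d\<close> as \<open>A\<close> (via \<open>x\<close>, \<open>v\<close>) and as
    \<open>C\<close> (via \<open>v\<close>, \<open>y\<close>), but \<open>D\<close> separates it
    from one of them.\<close>
  have vn: "dj v n"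
  proof (rule ccontr)
    assume "\<not> dj v n"
    then obtain N where N: "inc N v" "inc N n" using not_dj by blast
    have 1: "SS d N C" using SS_path[OF N(1) _ \<open>inc U y\<close> \<open>inc C y\<close> dv dy] \<open>inc U v\<close> .
    have 2: "SS d A N" using SS_path[OF x(1) X N(1) x(2) dv] .
    have "N \<noteq> D" using N dv djD \<open>inc D d\<close> by blast
    hence "btw A D N \<or> btw C D N" using good_four[OF n(3) adc n(1,2) N(2)] by blast
    thus False using 1 2 btw_not_SS \<open>inc D d\<close> SS_sym by blast
  qed
  have Cv: "\<not> inc C v" using vn n djD by blast
  have XC: "X \<noteq> C" using Cv X by blast
  define m where "m = ln X C"
  have m: "inc X m" "inc C m" using ln_inc[OF XC] m_def by auto
  have "\<not> dj m d" using SS_path[OF x(1) X(1) m x(2)] nAC by blast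
  then obtain F where F: "inc F m" "inc F d" using not_dj by blast
  have Fne: "F \<noteq> X" "F \<noteq> C" using F offd X dv djD by blast+
  have "\<not> btw C F X" using btw_not_SS[OF _ F(2)] SS_path[OF \<open>inc C y\<close> \<open>inc U y\<close> \<open>inc U v\<close> X(2) dy dv] by blast
  moreover have "\<not> btw C X F"
    using inner_pasch[of C D A X F d x] adc btw_sym \<open>inc D d\<close> F x X offd S by blast
  ultimately have FCX: "btw F C X" using btw_cases[OF F(1) m(2,1)] Fne XC btw_sym by metis
  have "\<not> inc F y" using F dy djD by blast
  then obtain k where k: "inc F k" "dj k y" "k \<noteq> d" using avoider by metis
  have "\<not> dj k d" using k F not_dj by blast
  hence "\<not> dj k v" using H[OF k(3)] k by blast
  then obtain T where T: "inc T k" "inc T v" using not_dj by blast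
  have kx: "dj k x" using btw_dj[OF FCX \<open>inc C y\<close> k(1) X(1)] k xy S by blast
  have TC: "T \<noteq> C" using Cv T by blast
  define z where "z = ln T C"
  have z: "inc T z" "inc C z" using ln_inc[OF TC] z_def by auto
  have Td: "\<not> inc T d" using T dv djD by blast
  have kd: "\<not> dj d k" "\<not> dj k d" using k F not_dj by blast+
  \<comment> \<open>If \<open>TC\<close> meets \<open>d\<close>, no order of the three points on
    \<open>TC\<close> is possible. If it does not, then \<open>AT\<close> must meet
    \<open>d\<close>, since otherwise \<open>AT\<close> and \<open>TC\<close> would join
    \<open>A\<close> to \<open>C\<close>, and no order on \<open>AT\<close> is possible.\<close>
  show False
  proof (cases "dj z d")
    case False
    then obtain F' where F': "inc F' z" "inc F' d" using not_dj by blast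
    have ne: "F' \<noteq> T" "F' \<noteq> C" using F' Td offd by auto
    have "\<not> btw T F' C"
      using btw_not_SS[OF _ F'(2)] SS_path[OF T(2) \<open>inc U v\<close> \<open>inc U y\<close> \<open>inc C y\<close> dv dy] by blast
    moreover have "\<not> btw F' C T" using btw_dj[OF _ \<open>inc C y\<close> F'(2) T(1)] k dy kd S by blast
    moreover have "\<not> btw F' T C" using btw_dj[OF _ T(2) F'(2) n(2)] vn dv S not_dj Dn \<open>inc D d\<close> by blast
    ultimately show False using btw_cases[OF F'(1) z] ne TC btw_sym by metis
  next
    case True
    have "A \<noteq> T" using vn n T djD by blast
    define g where "g = ln A T"
    have g: "inc A g" "inc T g" using ln_inc[OF \<open>A \<noteq> T\<close>] g_def by auto
    have "\<not> dj g d" using SS_path[OF g z] True nAC by blast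
    then obtain G where G: "inc G g" "inc G d" using not_dj by blast
    have ne: "G \<noteq> A" "G \<noteq> T" using G Td \<open>\<not> inc A d\<close> by auto
    have "\<not> btw A G T" using btw_not_SS[OF _ G(2)] SS_path[OF x(1) X T(2) x(2) dv] by blast
    moreover have "\<not> btw G A T" using btw_dj[OF _ x(1) G(2) T(1)] x kx kd S by blast
    moreover have "\<not> btw A T G"
      using inner_pasch[OF adc, of T G d z] \<open>inc D d\<close> G z \<open>\<not> inc A d\<close> True S by blast
    ultimately show False using btw_cases[OF G(1) g] ne \<open>A \<noteq> T\<close> btw_sym by metis
  qed
qed

lemma outer_pasch_good:
  assumes adc: "btw A D C" and n: "inc A n" "inc C n" "good n" and eau: "btw E A U"
    and "inc D d" "inc E d" and "inc C y" "inc U y" and "\<not> inc A d"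
  shows "\<not> dj d y"
proof
  assume dy: "dj d y"
  have "\<not> inc U d" using dy djD assms by blast
  from avoiders[OF this] obtain y1 y2 where y: "inc U y1" "inc U y2" "dj y1 d" "dj y2 d"
    "\<And>k. \<lbrakk>k \<noteq> d; \<not> dj k d\<rbrakk> \<Longrightarrow> \<not> dj k y1 \<or> \<not> dj k y2" by metis
  have "inc D n" using btw_on(1) adc n by blast
  hence nd: "\<not> dj n d" "n \<noteq> d" using assms not_dj by blast+
  \<comment> \<open>The line \<open>n\<close> meets \<open>d\<close> and so one of the two avoiders
    of \<open>d\<close> through \<open>U\<close>. This one replaces \<open>y\<close>, and its common
    point \<open>C'\<close> with \<open>n\<close> replaces \<open>C\<close>.\<close>
  have *: False if u: "inc U u" "inc U v" "dj u d" "dj v d"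
      "\<And>k. \<lbrakk>k \<noteq> d; \<not> dj k d\<rbrakk> \<Longrightarrow> \<not> dj k u \<or> \<not> dj k v" and "\<not> dj n u" for u v
  proof -
    obtain C' where C': "inc C' n" "inc C' u" using not_dj \<open>\<not> dj n u\<close> by blast
    have "SS d C C'" using SS_path[OF \<open>inc C y\<close> \<open>inc U y\<close> u(1) C'(2) _ u(3)] dy dj_sym by blast
    hence "\<not> btw C D C'" using btw_not_SS \<open>inc D d\<close> by blast
    moreover have "C' \<noteq> D" using C' u djD \<open>inc D d\<close> by blast
    ultimately have "btw A D C'" using good_four[OF n(3) adc n(1,2) C'(1)] by blast
    thus False using outer_pasch_aux[of A D C' n E U d u v] n C' assms u by blast
  qed
  show False using y(5)[OF nd(2,1)] *[of y1 y2] *[of y2 y1] y by blast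
qed

text \<open>On a line with a pseudolinear quadruple \<open>A, D, C, N\<close>, consider any other line \<open>j\<close> through
  \<open>C\<close>. It has at least five points, hence no pseudolinear quadruple, but no point \<open>Z \<noteq> C\<close> of \<open>j\<close>
  is between two points of \<open>j\<close>.\<close>

lemma pseudo_other_line:
  assumes p: "pseudo A D C N" and n: "inc A n" "inc C n" and Z: "\<not> inc Z n" "inc Z j" "inc C j"
  obtains D1 D2 W where "inc D1 j" "inc D2 j" "inc W j" "distinct [C, Z, D1, D2, W]"
proof -
  note S = dj_sym
  have b: "btw A D C" "btw D C N" "btw C N A" "btw N A D" using p pseudo_def by auto
  have n2: "inc D n" "inc N n" using b btw_on n by blast+
  have ne: "A \<noteq> D" "A \<noteq> C" "D \<noteq> C" "D \<noteq> N" "C \<noteq> N" "A \<noteq> N" using b btw_distinct by blast+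
  have ZA: "Z \<noteq> A" using Z n by blast
  define a where "a = ln Z A"
  have a: "inc Z a" "inc A a" using ln_inc ZA a_def by auto
  have an: "a \<noteq> n" "j \<noteq> n" using a Z by auto
  have off: "\<not> inc D a" "\<not> inc N a" "\<not> inc C a" "\<not> inc D j" "\<not> inc N j" "\<not> inc A j"
    using uniq n n2 a an Z ne by metis+
  have aj: "\<not> dj a j" using a Z not_dj by blast
  \<comment> \<open>\<open>D\<close> and \<open>N\<close> are between \<open>A\<close> and
    \<open>C\<close>, and \<open>a\<close>, \<open>j\<close> meet in \<open>Z\<close>; so every line
    through \<open>D\<close> or \<open>N\<close> that avoids \<open>a\<close> has to meet
    \<open>j\<close>. Two such lines through \<open>D\<close> and one through \<open>N\<close> give
    three further points of \<open>j\<close>.\<close>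
  obtain d1 d2 where d: "d1 \<noteq> d2" "inc D d1" "inc D d2" "dj d1 a" "dj d2 a"
    using avoiders[OF off(1)] by blast
  obtain w where w: "inc N w" "dj w a" using avoider off by metis
  have "\<not> dj d1 j" "\<not> dj d2 j" "\<not> dj w j"
    using btw_dj[OF b(1) d(2) a(2) Z(3)] btw_dj[OF b(1) d(3) a(2) Z(3)] btw_dj[OF b(3) w(1) Z(3) a(2)]
      aj d w S by blast+
  then obtain D1 D2 W where P: "inc D1 d1" "inc D1 j" "inc D2 d2" "inc D2 j" "inc W w" "inc W j"
    using not_dj by metis
  have "dj d1 w" "dj d2 w" using btw_dj[OF b(4) a(2) w(1) d(2)] btw_dj[OF b(4) a(2) w(1) d(3)] d w S by blast+
  hence "W \<noteq> D1" "W \<noteq> D2" using P djD by blast+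
  moreover have "D1 \<noteq> D2" using uniq d P off by metis
  moreover have "D1 \<noteq> Z" "D2 \<noteq> Z" "W \<noteq> Z" using P d w a djD by blast+
  moreover have "D1 \<noteq> C" "D2 \<noteq> C" "W \<noteq> C" using uniq P d w n n2 ne a djD by metis+
  moreover have "C \<noteq> Z" using n Z by blast
  ultimately show ?thesis using that P by auto
qed

lemma no_pseudo: "\<not> pseudo A D C N"
proof
  assume p: "pseudo A D C N"
  note S = dj_sym
  have b: "btw A D C" "btw D C N" "btw C N A" "btw N A D" using p pseudo_def by auto
  obtain n where n: "inc A n" "inc C n" using btw_col b by blast
  have ne: "A \<noteq> D" "A \<noteq> C" "D \<noteq> C" "D \<noteq> N" "C \<noteq> N" "A \<noteq> N" using b btw_distinct by blast+
  obtain Z0 where Z0: "\<not> inc Z0 n" using ex_off by blast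
  define j where "j = ln C Z0"
  have "C \<noteq> Z0" using n Z0 by blast
  hence j: "inc C j" "inc Z0 j" using ln_inc j_def by auto
  have jn: "j \<noteq> n" using j Z0 by auto
  obtain D1 D2 W where J: "inc D1 j" "inc D2 j" "inc W j" "distinct [C, Z0, D1, D2, W]"
    using pseudo_other_line[OF p n Z0 j(2,1)] .
  have "good j"
    unfolding good_def
  proof (intro allI impI notI)
    fix A' B' C' D' assume h: "inc A' j \<and> inc B' j \<and> inc C' j \<and> inc D' j" "pseudo A' B' C' D'"
    have "{C, Z0, D1, D2, W} \<subseteq> {A', B', C', D'}" using pseudo_no_fifth[OF h(2)] h(1) J j by auto
    hence "card {C, Z0, D1, D2, W} \<le> card {A', B', C', D'}" by (intro card_mono) auto
    moreover have "card {A', B', C', D'} \<le> 4" using card_length[of "[A', B', C', D']"] by simp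
    moreover have "card {C, Z0, D1, D2, W} = 5" using distinct_card[OF J(4)] by simp
    ultimately show False by linarith
  qed
  \<comment> \<open>By \<open>pseudo_no_fifth\<close>, \<open>n\<close> has only four points. A line
    through \<open>P\<close> that avoids \<open>ZA\<close> and meets \<open>n\<close> therefore does
    so in \<open>D\<close> or \<open>N\<close>, which are between \<open>C\<close> and
    \<open>A\<close>, and inner Pasch makes it meet \<open>ZA\<close>.\<close>
  have no1: "\<not> btw C Z P" if Z: "inc Z j" for Z P
  proof
    assume cz: "btw C Z P"
    have P: "inc P j" using btw_on(2) cz Z j by blast
    have ZC: "Z \<noteq> C" "Z \<noteq> P" "P \<noteq> C" using cz btw_distinct by blast+
    have Zn: "\<not> inc Z n" using Z j n jn ZC uniq by metis
    hence "Z \<noteq> A" using n by blast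
    define a where "a = ln Z A"
    have a: "inc Z a" "inc A a" using ln_inc \<open>Z \<noteq> A\<close> a_def by auto
    have aj: "a \<noteq> n" "a \<noteq> j" "\<not> inc C a" using a n j jn Zn uniq ne by metis+
    have "\<not> inc P a" using uniq[OF a(1) _ Z P ZC(2)] aj by blast
    then obtain m where m: "inc P m" "dj m a" "\<not> dj n m"
      using avoider_cut[of P a n] aj a n not_dj by metis
    then obtain R where R: "inc R n" "inc R m" using not_dj by blast
    have "R \<noteq> A" using R m a djD by blast
    moreover have "R \<noteq> C" using R m P j ZC uniq Z a djD by metis
    moreover have "R \<in> {A, D, C, N}" using pseudo_no_fifth[OF p n R(1)] .
    ultimately have "btw C R A" using b btw_sym by blast
    thus False using inner_pasch[OF cz, of R A a m] a m R aj S by blast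
  qed
  have no2: "\<not> btw P Z Q" if h: "inc Z j" "inc P j" "Z \<noteq> C" for P Z Q
  proof
    assume pz: "btw P Z Q"
    have "inc Q j" using btw_on(2) pz h by blast
    hence "btw P Z C \<or> btw Q Z C" using good_four[OF \<open>good j\<close> pz h(2) _ j(1)] h by blast
    thus False using no1[OF h(1)] btw_sym by blast
  qed
  have "D1 \<noteq> D2 \<and> D2 \<noteq> W \<and> D1 \<noteq> W \<and> D1 \<noteq> C \<and> D2 \<noteq> C \<and> W \<noteq> C" using J by auto
  thus False using btw_cases[OF J(1-3)] no2 J by blast
qed

lemma good: "good n"
  unfolding good_def using no_pseudo by blast

lemma btw_on_line:
  assumes "btw A D C" "inc A n" "inc C n" "inc N n" "N \<noteq> D"
  shows "btw A D N \<or> btw C D N"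
  using good_four good assms by blast

lemma outer_pasch:
  assumes "btw A D C" "btw E A U" "inc D d" "inc E d" "inc C y" "inc U y" "\<not> inc A d"
  shows "\<not> dj d y"
proof -
  obtain n where "inc A n" "inc C n" using btw_col[OF assms(1)] by blast
  thus ?thesis using outer_pasch_good[OF assms(1) _ _ good assms(2-7)] by blast
qed

section \<open>Plane separation\<close>

lemma SS_step:
  assumes s: "SS d A U" and z: "inc U z" "inc C z" "dj z d"
  shows "SS d A C"
proof (rule ccontr)
  assume n: "\<not> SS d A C"
  have off: "\<not> inc A d" "\<not> inc U d" "\<not> inc C d" using s z SS_off djD by blast+
  obtain D where D: "inc D d" "btw A D C" using not_SS_btw[OF off(1,3) n] by blast
  \<comment> \<open>A path of three lines avoiding \<open>d\<close> is shortened to one of two. If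
    this failed, \<open>d\<close> would cross the segment \<open>AC\<close> and the line
    \<open>AU\<close>. As \<open>d\<close> avoids \<open>z\<close>, which joins \<open>U\<close> and
    \<open>C\<close>, the two forms of Pasch's axiom keep \<open>E\<close> from lying outside the
    segment \<open>AU\<close>.\<close>
  have AU: "A \<noteq> U" using n SS_line z by metis
  have "\<not> dj (ln A U) d" using SS_path[of A "ln A U" U z C d] z n ln_inc[OF AU] by blast
  then obtain E where E: "inc E (ln A U)" "inc E d" using not_dj by blast
  have ne: "E \<noteq> A" "E \<noteq> U" using E off by auto
  have "\<not> btw A E U" using btw_not_SS E s by blast
  moreover have "\<not> btw A U E" using inner_pasch[OF D(2), of U E d z] D E z off dj_sym by blast
  moreover have "\<not> btw E A U" using outer_pasch[OF D(2), of E U d z] D E z off dj_sym by blast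
  ultimately show False using btw_cases[OF E(1) ln_inc[OF AU]] ne AU btw_sym by blast
qed

lemma SS_trans: "SS d A B \<Longrightarrow> SS d B C \<Longrightarrow> SS d A C"
  unfolding SS_def[of d B C] using SS_step by metis

lemma SS_ray:
  assumes "inc R d" "\<not> inc A d" "\<not> inc B d" "inc R l" "inc A l" "inc B l" "\<not> btw A R B"
  shows "SS d A B"
proof (rule ccontr)
  assume "\<not> SS d A B"
  then obtain D where D: "inc D d" "btw A D B" using not_SS_btw assms by blast
  hence "inc D l" using btw_on(1) assms by blast
  hence "D = R" using D assms uniq by metis
  thus False using D assms by blast
qed

text \<open>Otherwise all three sides of the triangle \<open>ABC\<close> meet \<open>d\<close>. Let
  \<open>E\<close> be the middle one of the three intersections: both \<open>D\<close> and
  \<open>F\<close> are on the side of \<open>B\<close> with respect to the triangle side through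
  \<open>E\<close>, although \<open>E\<close> is between \<open>D\<close> and
  \<open>F\<close>.\<close>

lemma opp_trans:
  assumes "\<not> inc A d" "\<not> inc B d" "\<not> inc C d" "\<not> SS d A B" "\<not> SS d B C"
  shows "SS d A C"
proof (rule ccontr)
  assume n: "\<not> SS d A C"
  have *: False if off: "\<not> inc A d" "\<not> inc B d" "\<not> inc C d" and
     D: "inc D d" "btw A D B" and F: "inc F d" "btw B F C" and E: "inc E d" "btw A E C" and h: "btw D E F"
     for A B C D E F
  proof -
    obtain g where g: "inc A g" "inc C g" "inc E g" using btw_col E by blast
    have DEF: "D \<noteq> E" "F \<noteq> E" using h btw_distinct by blast+
    have gd: "g \<noteq> d" using g off by blast
    have offg: "\<not> inc D g" "\<not> inc F g" using g D F E gd DEF uniq by metis+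
    have Bg: "\<not> inc B g" using offg btw_on(1) D g by blast
    obtain s where s: "inc A s" "inc D s" "inc B s" using btw_col D by blast
    obtain t where t: "inc B t" "inc F t" "inc C t" using btw_col F by blast
    have "SS g D B" using SS_ray[OF g(1) offg(1) Bg s] D btw_excl btw_sym by blast
    moreover have "SS g B F" using SS_ray[OF g(2) Bg offg(2) t(3,1,2)] F btw_excl btw_sym by blast
    ultimately have "SS g D F" using SS_trans by blast
    thus False using h btw_not_SS g by blast
  qed
  obtain D where D: "inc D d" "btw A D B" using not_SS_btw assms by blast
  obtain F where F: "inc F d" "btw B F C" using not_SS_btw assms by blast
  obtain E where E: "inc E d" "btw A E C" using not_SS_btw assms n by blast
  have s: "btw B D A" "btw C F B" "btw C E A" using D F E btw_sym by blast+
  have col: "\<not> (inc A l \<and> inc B l \<and> inc C l)" for l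
  proof
    assume l: "inc A l \<and> inc B l \<and> inc C l"
    have "inc D l" "inc E l" "inc F l" using l D F E btw_on(1) by blast+
    hence "D = E" "D = F" using D E F l assms uniq by metis+
    hence b: "btw A D B" "btw B D C" "btw A D C" using D E F by auto
    have ne: "A \<noteq> B" "B \<noteq> C" "A \<noteq> C" using b btw_distinct by blast+
    have "\<not> btw A B C" using btw_shrink[of A B C D] b btw_excl btw_sym by blast
    moreover have "\<not> btw A C B" using btw_shrink[of A C B D] b btw_excl btw_sym by blast
    moreover have "\<not> btw B A C" using btw_shrink[of B A C D] b btw_excl btw_sym by blast
    ultimately show False using btw_cases[of A l B C] l ne by blast
  qed
  have DF: "D \<noteq> F" using D F col btw_col uniq assms by metis
  have DE: "D \<noteq> E" using D E col btw_col uniq assms by metis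
  have EF: "E \<noteq> F" using E F col btw_col uniq assms by metis
  show False using btw_cases[OF D(1) E(1) F(1) DE EF DF]
      *[OF assms(1-3) D F E] *[OF assms(2,1,3) D(1) s(1) E F] *[OF assms(1,3,2) E F(1) s(2) D] btw_sym by blast
qed

lemma third_line: "\<exists>f. inc B f \<and> f \<noteq> d \<and> f \<noteq> e"
proof -
  obtain P where "P \<noteq> B" using ex_off ex_pt by metis
  obtain Q where Q: "\<not> inc Q (ln P B)" using ex_off by blast
  have "P \<noteq> Q" using Q ln_inc \<open>P \<noteq> B\<close> by blast
  have "\<not> inc B (ln P Q)" using uniq ln_inc \<open>P \<noteq> B\<close> \<open>P \<noteq> Q\<close> Q by metis
  from avoiders[OF this] obtain m n where m: "m \<noteq> n" "inc B m" "inc B n" "dj m (ln P Q)" "dj n (ln P Q)"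
    by blast
  moreover have "ln P B \<noteq> m" "ln P B \<noteq> n" using m ln_inc[OF \<open>P \<noteq> B\<close>] ln_inc[OF \<open>P \<noteq> Q\<close>] djD by blast+
  ultimately show ?thesis using ln_inc[OF \<open>P \<noteq> B\<close>] by metis
qed

text \<open>A line through \<open>P\<close> and \<open>B\<close> is cut, beyond \<open>d\<close>, by
  an avoider of \<open>d\<close> through a point on the other side.\<close>

lemma extend_across:
  assumes "\<not> inc A d" "\<not> inc C d" "\<not> SS d A C" "inc B d" "\<not> inc P d"
  shows "\<exists>Y. btw P B Y"
proof -
  have *: "\<exists>Y. btw A B Y" if h: "\<not> inc A d" "\<not> inc C d" "\<not> SS d A C" "inc B d" for A C
  proof -
    have AB: "A \<noteq> B" using h by blast
    have "ln A B \<noteq> d" "\<not> dj (ln A B) d" using h ln_inc[OF AB] not_dj by blast+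
    from avoider_cut[OF h(2) this] obtain m Y where m: "inc C m" "dj m d" "inc Y m" "inc Y (ln A B)"
      using not_dj by blast
    have Yd: "\<not> inc Y d" using m djD by blast
    have "SS d Y C" using SS_line m by blast
    hence "\<not> SS d A Y" using h SS_trans by blast
    then obtain X where X: "inc X d" "btw A X Y" using not_SS_btw h Yd by blast
    have "inc X (ln A B)" using btw_on(1)[OF X(2)] ln_inc[OF AB] m by blast
    hence "X = B" using X h ln_inc[OF AB] uniq by metis
    thus ?thesis using X by blast
  qed
  show ?thesis
  proof (cases "SS d P A")
    case True
    hence "\<not> SS d P C" using assms(3) SS_trans SS_sym by blast
    thus ?thesis using * assms by blast
  next
    case False thus ?thesis using * assms by blast
  qed
qed

text \<open>\<open>axiom_A3\<close> and \<open>axiom_A4\<close> supply just one instance of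
  betweenness. Having two sides passes from \<open>d\<close> to a line \<open>e\<close> meeting it,
  since a point of a third line through the intersection can be extended across \<open>d\<close>,
  hence across \<open>e\<close>. Any two disjoint lines are linked by a line meeting both.\<close>

lemma two_sided: "\<exists>A C. \<not> inc A d \<and> \<not> inc C d \<and> \<not> SS d A C"
proof -
  define ts where "ts d \<longleftrightarrow> (\<exists>A C. \<not> inc A d \<and> \<not> inc C d \<and> \<not> SS d A C)" for d
  have b: "ts d" if "btw A B C" "inc B d" "\<not> inc A d" for A B C d
    using that btw_not_SS btw_on(3) unfolding ts_def by metis
  have step: "ts e" if td: "ts d" and tj: "\<not> dj d e" for d e
  proof -
    obtain B where B: "inc B d" "inc B e" using tj not_dj by blast
    obtain f where f: "inc B f" "f \<noteq> d" "f \<noteq> e" using third_line by blast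
    obtain A C where AC: "\<not> inc A d" "\<not> inc C d" "\<not> SS d A C" using td ts_def by blast
    have "f \<noteq> d" "\<not> dj f d" using f B not_dj by blast+
    from avoider_cut[OF AC(1) this] obtain m where m: "inc A m" "dj m d" "\<not> dj f m" by blast
    then obtain P where P: "inc P m" "inc P f" using not_dj by blast
    have "P \<noteq> B" using P m B djD by blast
    have "\<not> inc P d" "\<not> inc P e" using P \<open>P \<noteq> B\<close> f B uniq by metis+
    then obtain Y where "btw P B Y" using extend_across \<open>ts d\<close> B unfolding ts_def by metis
    thus ?thesis using b B \<open>\<not> inc P e\<close> by blast
  qed
  obtain A B C where "btw A B C" using A3 A4 unfolding axiom_A3_def axiom_A4_def by metis
  moreover obtain l where "inc A l" "inc B l" using btw_col calculation by blast
  moreover obtain d0 where "inc B d0" "d0 \<noteq> l" using ex_other_line calculation by blast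
  ultimately have d0: "ts d0" using b uniq btw_distinct by metis
  have "ts d"
  proof (cases "dj d0 d")
    case False thus ?thesis using step d0 by blast
  next
    case True
    obtain X Y where XY: "inc X d0" "inc Y d" using ex_pt by metis
    hence "X \<noteq> Y" using True djD by blast
    hence "\<not> dj d0 (ln X Y)" "\<not> dj (ln X Y) d" using ln_inc XY not_dj by blast+
    thus ?thesis using step d0 by blast
  qed
  thus ?thesis unfolding ts_def .
qed

lemma extend: assumes "A \<noteq> B" shows "\<exists>C. btw A B C"
proof -
  obtain d where d: "inc B d" "d \<noteq> ln A B" using ex_other_line ln_inc[OF assms] by blast
  have "\<not> inc A d" using uniq d ln_inc assms by metis
  thus ?thesis using two_sided[of d] extend_across d by metis
qed

text \<open>The ray \<open>RY\<close> is inside the angle \<open>XRM\<close>. Prolong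
  \<open>XR\<close> to \<open>X'\<close>. If \<open>y\<close> missed the segment \<open>XM\<close>,
  it would cross \<open>X'M\<close> in some \<open>K\<close>; comparing sides of \<open>m\<close>
  gives \<open>btw K R Y\<close>, comparing sides of \<open>a\<close> refutes it.\<close>

lemma crossbar:
  assumes o: "inc R a" "inc R m" "inc R y" and p: "inc X a" "inc M m" "inc Y y"
    and s: "SS m Y X" "SS a Y M"
  shows "\<not> SS y X M"
proof
  assume yXM: "SS y X M"
  have off: "\<not> inc X m" "\<not> inc Y m" "\<not> inc M a" "\<not> inc Y a" "\<not> inc X y" "\<not> inc M y"
    using s SS_off yXM by blast+
  have ne: "X \<noteq> R" "M \<noteq> R" "Y \<noteq> R" using off o by auto
  obtain X' where X': "btw X R X'" using extend ne by blast
  have X'a: "inc X' a" using btw_on(2) X' o p by blast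
  have X'R: "X' \<noteq> R" using X' btw_distinct by blast
  have X'off: "\<not> inc X' m" "\<not> inc X' y" using X'a X'R uniq o p off by metis+
  have XX': "\<not> SS y X X'" "\<not> SS m X X'" using btw_not_SS X' o by blast+
  hence "\<not> SS y X' M" using yXM SS_trans SS_sym by blast
  then obtain K where K: "inc K y" "btw X' K M" using not_SS_btw off X'off by blast
  have Kam: "\<not> inc K a" "\<not> inc K m" using K btw_on off X'a X'off p by blast+
  obtain g where g: "inc X' g" "inc K g" "inc M g" using btw_col K by blast
  have "SS m K X'" using SS_ray[OF p(2) Kam(2) X'off(1) g(3,2,1)] K btw_excl btw_sym by blast
  hence 1: "\<not> SS m K Y" using s XX' SS_sym SS_trans by blast
  have "SS a K M" using SS_ray[OF X'a Kam(1) off(3) g(1-3)] K btw_excl btw_sym by blast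
  hence 2: "SS a K Y" using s SS_sym SS_trans by blast
  have "btw K R Y" using SS_ray[OF o(2) Kam(2) off(2) o(3) K(1) p(3)] 1 by blast
  thus False using 2 btw_not_SS o by blast
qed

section \<open>Limiting rays and pencils\<close>

lemma ex_pt2: "\<exists>M. inc M m \<and> M \<noteq> S"
proof (cases "inc S m")
  case False thus ?thesis using ex_pt by metis
next
  case True
  obtain d where d: "inc S d" "d \<noteq> m" using ex_other_line True by blast
  obtain P where P: "\<not> inc P d" using ex_off by blast
  have "m \<noteq> d" "\<not> dj m d" using d True not_dj by blast+
  from avoider_cut[OF P this] obtain k M where "dj k d" "inc M m" "inc M k" using not_dj by metis
  thus ?thesis using d djD by metis
qed

lemma pt_side:
  assumes "inc S m" "inc S d" "m \<noteq> d" "\<not> inc A d"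
  shows "\<exists>M. inc M m \<and> SS d M A"
proof -
  obtain M where M: "inc M m" "M \<noteq> S" using ex_pt2 by blast
  have Md: "\<not> inc M d" using M assms uniq by metis
  obtain M' where M': "btw M S M'" using extend M by blast
  have "inc M' m" using btw_on(2) M' M assms by blast
  moreover have "\<not> inc M' d" using btw_on(3) M' assms Md by blast
  moreover have "\<not> SS d M M'" using btw_not_SS M' assms by blast
  ultimately show ?thesis using opp_trans[of M' d M A] M Md assms SS_sym by metis
qed

text \<open>Otherwise each of the two rays would lie in the angle between the other one and the ray
  opposite to \<open>SR\<close>, which \<open>crossbar\<close> excludes.\<close>

lemma ray_angle_cases:
  assumes "inc S d" "inc S m" "inc S m'" "inc R d" "R \<noteq> S" "inc M m" "inc M' m'"
    and s: "SS d M M'" and "m \<noteq> m'"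
  shows "SS m M' R \<or> SS m' M R"
proof (rule ccontr)
  assume n: "\<not> ?thesis"
  have off: "\<not> inc M d" "\<not> inc M' d" using s SS_off by blast+
  have ne: "M \<noteq> S" "M' \<noteq> S" using off assms by auto
  obtain R' where R': "btw R S R'" using extend assms by blast
  have R'd: "inc R' d" "R' \<noteq> S" using btw_on(2) R' assms btw_distinct by blast+
  have off2: "\<not> inc R m" "\<not> inc R m'" "\<not> inc R' m" "\<not> inc R' m'" "\<not> inc M' m" "\<not> inc M m'"
    using uniq off ne assms R'd by metis+
  have o: "\<not> SS m R R'" "\<not> SS m' R R'" using btw_not_SS R' assms by blast+
  have 1: "SS m M' R'" using opp_trans[OF off2(5,1,3)] n o by blast
  have 2: "SS m' M R'" using opp_trans[OF off2(6,2,4)] n o by blast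
  show False using crossbar[OF assms(2,1,3) assms(6) R'd(1) assms(7)] s 1 2 SS_sym by blast
qed

text \<open>Serves to slide the base point of a limiting ray along its line. The case
  \<open>btw R R1 A\<close> is \<open>crossbar\<close> for the angle \<open>RSM\<close>; the case
  \<open>btw R1 R A\<close> is reduced to it by a point of \<open>m\<close> beyond
  \<open>S\<close>.\<close>

lemma side_move:
  assumes ml: "dj m l" and m: "inc S m" "inc M m" "M \<noteq> S" and l: "inc R l" "inc R1 l" "inc A l"
    and d: "inc S d" "inc R d" "inc S d1" "inc R1 d1" and ne: "A \<noteq> R" "A \<noteq> R1"
    and b: "\<not> btw R A R1" and s: "SS d M A"
  shows "SS d1 M A"
proof -
  have fwd: "SS d1 M A" if b: "btw R R1 A" and s: "SS d M A" and m: "inc S m" "inc M m" "M \<noteq> S"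
    and l: "inc R l" "inc R1 l" "inc A l" and d: "inc S d" "inc R d" "inc S d1" "inc R1 d1"
    for R R1 A M d d1
  proof -
    have ne: "R \<noteq> R1" "R1 \<noteq> A" "R \<noteq> A" using b btw_distinct by blast+
    have Sl: "\<not> inc S l" using ml m djD by blast
    have Rm: "\<not> inc R m" "\<not> inc R1 m" using ml l djD by blast+
    have dd: "d \<noteq> l" "d1 \<noteq> l" using Sl d by auto
    have off: "\<not> inc R1 d" "\<not> inc A d" "\<not> inc A d1" "\<not> inc R d1" "\<not> inc M d1"
      using uniq l d dd ne m Rm by metis+
    have "SS m R1 R" using SS_line l ml dj_sym by blast
    moreover have "SS d R1 M"
      using SS_ray[OF d(2) off(1,2) l] b btw_excl[of R R1 A] btw_excl btw_sym s SS_trans SS_sym by metis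
    ultimately have "\<not> SS d1 R M" using crossbar[OF d(1) m(1) d(3) d(2) m(2) d(4)] by blast
    moreover have "\<not> SS d1 R A" using btw_not_SS b d by blast
    ultimately show ?thesis using opp_trans[OF off(5,4,3)] SS_sym by blast
  qed
  consider "R = R1" | "btw R R1 A" | "btw R1 R A" using btw_cases[OF l] ne b btw_sym by metis
  thus ?thesis
  proof cases
    case 1
    have "S \<noteq> R" using ml m l djD by blast
    thus ?thesis using 1 s d uniq by metis
  next
    case 2 thus ?thesis using fwd s m l d by blast
  next
    case 3
    obtain M' where M': "btw M S M'" using extend m by blast
    have M'm: "inc M' m" "M' \<noteq> S" using btw_on(2) M' m btw_distinct by blast+
    have opp: "\<not> SS d M M'" "\<not> SS d1 M M'" using btw_not_SS M' d by blast+
    have R1m: "\<not> inc R1 m" using ml l djD by blast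
    have "d1 \<noteq> m" "d1 \<noteq> l" using R1m d m ml djD by blast+
    hence off: "\<not> inc M d1" "\<not> inc M' d1" "\<not> inc A d1" using uniq d m M'm l ne by metis+
    show ?thesis
    proof (rule ccontr)
      assume "\<not> SS d1 M A"
      hence "SS d1 M' A" using opp_trans[OF off(2,1,3)] opp SS_sym by blast
      hence "SS d M' A" using fwd[OF 3 _ m(1) M'm l(2,1,3)] d by blast
      thus False using opp s SS_trans SS_sym by blast
    qed
  qed
qed

text \<open>\<open>asy R A S M\<close>: the ray from \<open>S\<close> through \<open>M\<close> is the limiting ray for the ray from \<open>R\<close>
  through \<open>A\<close>.\<close>

definition asy :: "'p \<Rightarrow> 'p \<Rightarrow> 'p \<Rightarrow> 'p \<Rightarrow> bool" where
  "asy R A S M \<longleftrightarrow> R \<noteq> A \<and> S \<noteq> M \<and> dj (ln S M) (ln R A) \<and> SS (ln S R) M A \<and>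
     (\<forall>Y. SS (ln S R) Y A \<and> SS (ln S M) Y R \<longrightarrow> \<not> dj (ln S Y) (ln R A))"

lemma asyI:
  assumes "R \<noteq> A" "inc R l" "inc A l" "inc S m" "inc M m" "inc S d" "inc R d" "dj m l" "SS d M A"
    and H: "\<And>Y k. \<lbrakk>SS d Y A; SS m Y R; inc S k; inc Y k\<rbrakk> \<Longrightarrow> \<not> dj k l"
  shows "asy R A S M"
proof -
  have "M \<noteq> S" "S \<noteq> R" using assms SS_off djD by metis+
  hence e: "ln R A = l" "ln S M = m" "ln S R = d" using ln_eq assms by metis+
  have "\<not> dj (ln S Y) l" if "SS d Y A" "SS m Y R" for Y
    using H[OF that] ln_inc[of S Y] that SS_off assms by metis
  thus ?thesis unfolding asy_def e using assms \<open>M \<noteq> S\<close> by auto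
qed

lemma asyE:
  assumes "asy R A S M" "inc R l" "inc A l" "inc S m" "inc M m" "inc S d" "inc R d"
  shows "R \<noteq> A" "S \<noteq> M" "S \<noteq> R" "dj m l" "SS d M A" "\<not> inc S l" "\<not> inc R m" "m \<noteq> d" "l \<noteq> d"
    "\<And>Y k. \<lbrakk>SS d Y A; SS m Y R; inc S k; inc Y k\<rbrakk> \<Longrightarrow> \<not> dj k l"
proof -
  have 1: "R \<noteq> A" "S \<noteq> M" using assms(1) asy_def by auto
  hence e: "ln R A = l" "ln S M = m" using ln_eq assms by metis+
  have ml: "dj m l" using assms(1) e asy_def by auto
  hence ne: "S \<noteq> R" using assms djD by metis
  hence d: "ln S R = d" using ln_eq assms by metis
  show "R \<noteq> A" "S \<noteq> M" "S \<noteq> R" "dj m l" "SS d M A" "\<not> inc S l" "\<not> inc R m"  "m \<noteq> d" "l \<noteq> d"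
    using 1 ml ne assms(1) e d asy_def djD assms by auto
  show "\<not> dj k l" if "SS d Y A" "SS m Y R" "inc S k" "inc Y k" for Y k
  proof -
    have "S \<noteq> Y" using that assms SS_off by metis
    hence "ln S Y = k" using ln_eq that by metis
    thus ?thesis using assms(1) that unfolding asy_def e d by blast
  qed
qed

lemma asy_distinct: "asy R A S M \<Longrightarrow> R \<noteq> A \<and> S \<noteq> M"
  unfolding asy_def by blast

lemma asy_lines:
  assumes "asy R A S M"
  obtains l m d where "inc R l" "inc A l" "inc S m" "inc M m" "inc S d" "inc R d"
proof -
  have "R \<noteq> A" "S \<noteq> M" using assms asy_def by auto
  hence i: "inc R (ln R A)" "inc A (ln R A)" "inc S (ln S M)" "inc M (ln S M)" using ln_inc by blast+
  have "S \<noteq> R" using assms i djD unfolding asy_def by metis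
  thus ?thesis using that i ln_inc by blast
qed

text \<open>The inner one of the two lines of \<open>axiom_A5\<close> carries the limiting ray. If
  \<open>k\<close> inside the angle avoided \<open>l\<close>, a line \<open>q\<close> through
  \<open>R\<close> avoiding \<open>m\<close> would meet \<open>k\<close> and, since it meets
  \<open>l\<close>, also \<open>n\<close>. These two points of \<open>q\<close> are on opposite
  sides of \<open>l\<close>, but \<open>k\<close> and \<open>n\<close> join them without meeting
  \<open>l\<close>.\<close>

lemma inner_asy:
  assumes m: "inc S m" "dj m l" and n: "inc S n" "dj n l"
    and H: "\<And>k. \<lbrakk>k \<noteq> l; \<not> dj k l\<rbrakk> \<Longrightarrow> \<not> dj k m \<or> \<not> dj k n"
    and l: "inc R l" "inc A l" "R \<noteq> A" and M: "inc M m" and d: "inc S d" "inc R d"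
    and s: "SS d M A" "SS n M R"
  shows "asy R A S M"
proof (rule asyI[OF l(3,1,2) m(1) M d m(2) s(1)])
  fix Y k assume Y: "SS d Y A" "SS m Y R" "inc S k" "inc Y k"
  show "\<not> dj k l"
  proof
    assume kl: "dj k l"
    have Rm: "\<not> inc R m" using m l djD by blast
    have "k \<noteq> m" using Y SS_off by blast
    moreover have "\<not> dj k m" using Y m not_dj by blast
    ultimately obtain q where q: "inc R q" "dj q m" "\<not> dj k q" using avoider_cut[OF Rm] by metis
    then obtain K where K: "inc K k" "inc K q" using not_dj by blast
    have "q \<noteq> l" using K kl djD by blast
    hence "\<not> dj q n" using H[of q] q l not_dj by blast
    then obtain W where W: "inc W q" "inc W n" using not_dj by blast
    have Sq: "\<not> inc S q" using q m djD by blast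
    have KS: "K \<noteq> S" "W \<noteq> S" using K W Sq by auto
    have kd: "k \<noteq> d" using kl d l djD by blast
    have nd: "n \<noteq> d" using n d l djD by blast
    have Kd: "\<not> inc K d" "\<not> inc W d" using K Y d KS kd W n nd uniq by metis+
    have Yd: "\<not> inc Y d" using Y SS_off by blast
    have "SS m K R" using SS_line K q by blast
    hence "SS m K Y" using Y SS_sym SS_trans by blast
    hence "\<not> btw K S Y" using btw_not_SS m by blast
    hence "SS d K Y" using SS_ray[OF d(1) Kd(1) Yd Y(3) K(1) Y(4)] by blast
    hence KA: "SS d K A" using Y SS_trans by blast
    have "SS m R W" using SS_line W q by blast
    hence "\<not> SS d W M" using crossbar[OF n(1) m(1) d(1) W(2) M d(2)] s SS_sym by blast
    hence "\<not> SS d K W" using KA s SS_trans SS_sym by blast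
    hence "btw K R W" using SS_ray[OF d(2) Kd q(1) K(2) W(1)] by blast
    hence "\<not> SS l K W" using btw_not_SS l by blast
    thus False using SS_path[OF K(1) Y(3) n(1) W(2) kl n(2)] by blast
  qed
qed

text \<open>Which of the two lines of \<open>axiom_A5\<close> is the inner one is decided by
  \<open>ray_angle_cases\<close>. The outer one is handed on together with its property
  \<open>H\<close>, for use in \<open>asy_avoiders\<close>.\<close>

lemma asy_ex:
  assumes "\<not> inc S l" "inc R l" "inc A l" "R \<noteq> A"
  obtains m M n N d where "inc S m" "inc M m" "inc S n" "inc N n" "m \<noteq> n" "dj m l" "dj n l"
    "\<And>k. \<lbrakk>k \<noteq> l; \<not> dj k l\<rbrakk> \<Longrightarrow> \<not> dj k m \<or> \<not> dj k n"
    "inc S d" "inc R d" "SS d N A" "asy R A S M" "SS n M R"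
proof -
  obtain m n where mn: "m \<noteq> n" "inc S m" "inc S n" "dj m l" "dj n l"
    and H: "\<And>k. \<lbrakk>k \<noteq> l; \<not> dj k l\<rbrakk> \<Longrightarrow> \<not> dj k m \<or> \<not> dj k n" using avoiders[OF assms(1)] by metis
  have SR: "S \<noteq> R" using assms by blast
  then obtain d where d: "inc S d" "inc R d" using ln_inc by blast
  have "d \<noteq> l" using d assms by blast
  hence Ad: "\<not> inc A d" using uniq d assms by metis
  have nd: "m \<noteq> d" "n \<noteq> d" using mn d assms djD by metis+
  obtain M where M: "inc M m" "SS d M A" using pt_side[OF mn(2) d(1) nd(1) Ad] by blast
  obtain N where N: "inc N n" "SS d N A" using pt_side[OF mn(3) d(1) nd(2) Ad] by blast
  have MN: "SS d M N" using M N SS_sym SS_trans by blast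
  from ray_angle_cases[OF d(1) mn(2,3) d(2) SR[symmetric] M(1) N(1) MN mn(1)] show ?thesis
  proof
    assume h: "SS n M R"
    show ?thesis using that[OF mn(2) M(1) mn(3) N(1) mn(1,4,5) H d N(2) _ h]
      inner_asy[OF mn(2,4,3,5) H assms(2-4) M(1) d M(2) h] by blast
  next
    assume h: "SS m N R"
    have H': "\<not> dj k n \<or> \<not> dj k m" if "k \<noteq> l" "\<not> dj k l" for k using H[OF that] by blast
    show ?thesis using that[OF mn(3) N(1) mn(2) M(1) mn(1)[symmetric] mn(5,4) H' d M(2) _ h]
      inner_asy[OF mn(3,5,2,4) H' assms(2-4) N(1) d N(2) h] by blast
  qed
qed

lemma asy_unique:
  assumes a: "asy R A S M" "asy R A S M'" and m: "inc S m" "inc M m" "inc S m'" "inc M' m'"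
  shows "m = m'"
proof (rule ccontr)
  assume ne: "m \<noteq> m'"
  obtain l d where l: "inc R l" "inc A l" "inc S d" "inc R d" using asy_lines a by metis
  note E = asyE[OF a(1) l(1,2) m(1,2) l(3,4)] and E' = asyE[OF a(2) l(1,2) m(3,4) l(3,4)]
  have "SS d M M'" using E E' SS_sym SS_trans by blast
  hence "SS m M' R \<or> SS m' M R" using ray_angle_cases[OF l(3) m(1,3) l(4) E(3)[symmetric] m(2,4)] ne by blast
  thus False using E(10)[OF E'(5) _ m(3,4)] E'(10)[OF E(5) _ m(1,2)] E(4) E'(4) by blast
qed

lemma asy_side:
  assumes a: "asy R A S M" and "inc S d" "inc R d" "SS d A A'" "SS d M M'" "inc R l" "inc A l" "inc A' l"
    "inc S m" "inc M m" "inc M' m"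
  shows "asy R A' S M'"
proof -
  note E = asyE[OF a assms(6,7) assms(9,10) assms(2,3)]
  have RA': "R \<noteq> A'" using assms(4,3) SS_off by blast
  show ?thesis
  proof (rule asyI[OF RA' assms(6,8,9,11,2,3) E(4)])
    show "SS d M' A'" using E(5) assms SS_sym SS_trans by blast
    show "\<not> dj k l" if "SS d Y A'" "SS m Y R" "inc S k" "inc Y k" for Y k
      using E(10) that assms SS_sym SS_trans by blast
  qed
qed

lemma asy_move_R:
  assumes a: "asy R A S M" and l: "inc R l" "inc A l" "inc R1 l" "R1 \<noteq> A" "\<not> btw R A R1"
  shows "asy R1 A S M"
proof -
  obtain m d where m: "inc S m" "inc M m" "inc S d" "inc R d" using asy_lines[OF a] by metis
  note E = asyE[OF a l(1,2) m]
  have "S \<noteq> R1" using E(6) l by blast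
  then obtain d1 where d1: "inc S d1" "inc R1 d1" using ln_inc by blast
  show ?thesis
  proof (rule asyI[OF l(4,3,2) m(1,2) d1 E(4)])
    show "SS d1 M A" using side_move[OF E(4) m(1,2) E(2)[symmetric] l(1,3,2) m(3,4) d1 E(1)[symmetric] l(4)[symmetric] l(5) E(5)] .
    fix Y k assume Y: "SS d1 Y A" "SS m Y R1" "inc S k" "inc Y k"
    show "\<not> dj k l"
    proof
      assume kl: "dj k l"
      have "SS m R R1" using SS_line l E(4) dj_sym by blast
      hence YR: "SS m Y R" using Y SS_sym SS_trans by blast
      have YS: "Y \<noteq> S" using YR m SS_off by blast
      have b: "\<not> btw R1 A R" using l btw_sym by blast
      have "SS d Y A"
        using side_move[OF kl Y(3,4) YS l(3,1,2) d1 m(3,4) l(4)[symmetric] E(1)[symmetric] b Y(1)] .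
      thus False using E(10)[OF _ YR Y(3,4)] kl by blast
    qed
  qed
qed

text \<open>Let \<open>k\<close> through \<open>X\<close> lie inside the angle and avoid
  \<open>l\<close>. It crosses the segment \<open>RM\<close> in some \<open>K\<close>, and
  \<open>SK\<close> meets \<open>l\<close> beyond \<open>K\<close> by the limiting property at
  \<open>S\<close>. Comparing sides of \<open>k\<close> puts \<open>S\<close> and \<open>M\<close>
  on one side, although \<open>X\<close> is between them.\<close>

lemma asy_fwd_S:
  assumes a: "asy R A S M" and b: "btw S X M"
  shows "asy R A X M"
proof -
  obtain l m d where l: "inc R l" "inc A l" and m: "inc S m" "inc M m" and d: "inc S d" "inc R d"
    using asy_lines[OF a] by metis
  note E = asyE[OF a l m d]
  have X: "inc X m" using btw_on(1) b m by blast
  have ne: "S \<noteq> X" "X \<noteq> M" using b btw_distinct by blast+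
  have "X \<noteq> R" using X E(7) by blast
  then obtain d' where d': "inc X d'" "inc R d'" using ln_inc by blast
  have lm: "dj l m" using E(4) dj_sym by blast
  have MA: "SS d' M A"
    using side_move[of l m R A S X M d d'] lm l E m X d d' ne btw_excl[OF b] btw_excl b SS_sym btw_sym
    by metis
  show ?thesis
  proof (rule asyI[OF E(1) l X m(2) d' E(4) MA])
    fix Y k assume Y: "SS d' Y A" "SS m Y R" "inc X k" "inc Y k"
    show "\<not> dj k l"
    proof
      assume kl: "dj k l"
      have YM: "SS d' Y M" using Y MA SS_sym SS_trans by blast
      have RYm: "SS m Y R" using Y by blast
      have "\<not> SS k R M" using crossbar[OF d'(1) X Y(3) d'(2) m(2) Y(4) RYm YM] .
      moreover have Rk: "\<not> inc R k" using kl l djD by blast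
      moreover have "k \<noteq> m" using Y SS_off by blast
      moreover have Mk: "\<not> inc M k" using uniq Y m X ne \<open>k \<noteq> m\<close> by metis
      ultimately obtain K where K: "inc K k" "btw R K M" using not_SS_btw by blast
      obtain g where g: "inc R g" "inc K g" "inc M g" using btw_col K by blast
      have Md: "\<not> inc M d" using E(5) SS_off by blast
      have Kd: "\<not> inc K d" using btw_on K d Md by blast
      have Km: "\<not> inc K m" using btw_on K m E(7) by blast
      have nb: "\<not> btw K R M" "\<not> btw R M K" using btw_excl K btw_sym by blast+
      have KA: "SS d K A" using SS_ray[OF d(2) Kd Md g] nb E(5) SS_trans by blast
      have KR: "SS m K R" using SS_ray[OF m(2) Km E(7) g(3,2,1)] nb btw_sym by blast
      have "S \<noteq> K" using Kd d by blast
      then obtain h where h: "inc S h" "inc K h" using ln_inc by blast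
      obtain B where B: "inc B h" "inc B l" using E(10)[OF KA KR h] not_dj by blast
      have "SS l S K" using SS_path[OF m(1) X Y(3) K(1) E(4) kl] .
      hence "\<not> btw S B K" using btw_not_SS B by blast
      moreover have "SS m B K" using SS_line[of B l R m] B l lm KR SS_sym SS_trans by blast
      hence "\<not> btw K S B" using btw_not_SS m SS_sym by blast
      moreover have "B \<noteq> K" "B \<noteq> S" using B K kl djD E(6) by blast+
      ultimately have "btw S K B" using btw_cases[OF h B(1)] \<open>S \<noteq> K\<close> btw_sym by blast
      hence "\<not> SS k S B" using btw_not_SS K by blast
      moreover have "SS k R B" using SS_line l B kl dj_sym by blast
      ultimately have "\<not> SS k S R" using SS_trans by blast
      moreover have "\<not> SS k R M" using btw_not_SS K by blast
      moreover have "\<not> inc S k" using uniq Y m X ne \<open>k \<noteq> m\<close> by metis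
      ultimately have "SS k S M" using opp_trans Rk Mk by blast
      thus False using btw_not_SS b Y by blast
    qed
  qed
qed

section \<open>Limiting rays as parallel rays\<close>

lemma ray_iff:
  assumes "R \<noteq> A" "inc R l" "inc A l"
  shows "X \<in> ray inc R A \<longleftrightarrow> inc X l \<and> \<not> btw X R A"
proof
  assume "X \<in> ray inc R A"
  hence "X = R \<or> X = A \<or> btw R X A \<or> btw R A X" unfolding ray_def segment_def by auto
  thus "inc X l \<and> \<not> btw X R A"
  proof (elim disjE)
    assume b: "btw R X A"
    thus ?thesis using btw_on(1)[OF b assms(2,3)] btw_excl[of A X R] btw_sym by blast
  next
    assume b: "btw R A X"
    thus ?thesis using btw_on(2)[OF b assms(2,3)] btw_excl[of X A R] btw_sym by blast
  qed (use assms btw_distinct in blast)+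
next
  assume h: "inc X l \<and> \<not> btw X R A"
  hence "X = R \<or> X = A \<or> btw R X A \<or> btw R A X" using btw_cases[of X l R A] assms btw_sym by blast
  thus "X \<in> ray inc R A" unfolding ray_def segment_def by auto
qed

lemma segment_iff: "X \<in> segment inc R S \<longleftrightarrow> X = R \<or> X = S \<or> btw R X S"
  unfolding segment_def by auto

lemma asy_avoiders:
  assumes a: "asy R A S M" and l: "inc R l" "inc A l" and m: "inc S m" "inc M m"
  obtains n N d where "inc S n" "inc N n" "m \<noteq> n" "dj n l"
    "\<And>k. \<lbrakk>k \<noteq> l; \<not> dj k l\<rbrakk> \<Longrightarrow> \<not> dj k m \<or> \<not> dj k n"
    "inc S d" "inc R d" "SS d N A" "SS n M R"
proof -
  obtain d0 where d0: "inc S d0" "inc R d0" using asy_lines[OF a] by metis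
  note E = asyE[OF a l m d0]
  obtain m' M' n N d where h: "inc S m'" "inc M' m'" "inc S n" "inc N n" "m' \<noteq> n" "dj m' l" "dj n l"
    "\<And>k. \<lbrakk>k \<noteq> l; \<not> dj k l\<rbrakk> \<Longrightarrow> \<not> dj k m' \<or> \<not> dj k n"
    "inc S d" "inc R d" "SS d N A" "asy R A S M'" "SS n M' R"
    by (rule asy_ex[OF E(6) l E(1)]) (rule that)
  have e: "m' = m" using asy_unique[OF a h(12) m h(1,2)] by blast
  have "d = d0" using h d0 E(3) uniq by metis
  have "SS d0 M' A" using asyE(5)[OF h(12) l h(1,2,9,10)] \<open>d = d0\<close> by blast
  hence "SS d M M'" using E(5) \<open>d = d0\<close> SS_sym SS_trans by blast
  moreover have nM: "\<not> inc M n" "\<not> inc M' n"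
    using uniq h e m E(2) asyE(2)[OF h(12) l h(1,2,9,10)] by metis+
  ultimately have "SS n M M'" using SS_ray[OF h(3) nM m(1,2)] h(2) e btw_not_SS h(9) by blast
  hence "SS n M R" using h(13) SS_trans by blast
  thus ?thesis using that h e by metis
qed

text \<open>In both directions the base point of the limiting ray is first moved to the point where
  \<open>g\<close> meets the given ray; then \<open>g\<close> either runs into the other ray or
  leaves through the segment \<open>SR\<close>, by \<open>crossbar\<close>.\<close>

lemma asy_parallel_rays:
  assumes a: "asy R A S M"
  shows "parallel_rays inc S M R A"
proof -
  obtain l m d where l: "inc R l" "inc A l" and m: "inc S m" "inc M m" and d: "inc S d" "inc R d"
    using asy_lines[OF a] by metis
  note E = asyE[OF a l m d]
  have lm: "dj l m" using E(4) dj_sym by blast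
  have Md: "\<not> inc M d" using E(5) SS_off by blast
  have Ad: "\<not> inc A d" using E(5) SS_off by blast
  note rR = ray_iff[OF E(1) l] and rS = ray_iff[OF E(2) m]
  have ncol: "\<not> collinear_rays inc S M R A"
    unfolding collinear_rays_def pts_def using rR rS l m E uniq btw_distinct by (metis UnCI mem_Collect_eq subsetD)
  have 1: "hits inc g (ray inc R A) \<or> hits inc g (segment inc S R)" if g0: "hits inc g (ray inc S M)" for g
  proof (rule ccontr)
    assume n: "\<not> ?thesis"
    obtain X where X: "inc X g" "inc X m" "\<not> btw X S M" using g0 rS unfolding hits_def pts_def by auto
    have nseg: "\<not> inc S g" "\<not> inc R g" "\<And>Y. inc Y g \<Longrightarrow> \<not> btw S Y R"
      using n unfolding hits_def pts_def using segment_iff by auto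
    have nray: "\<And>Y. \<lbrakk>inc Y g; inc Y l\<rbrakk> \<Longrightarrow> btw Y R A"
      using n rR unfolding hits_def pts_def by auto
    have XS: "X \<noteq> S" using X nseg by blast
    obtain M' where M': "btw S X M'" using extend XS by metis
    have M'm: "inc M' m" using btw_on(2) M' m X by blast
    have neM: "M' \<noteq> S" "M' \<noteq> X" using M' btw_distinct by blast+
    have off: "\<not> inc X d" "\<not> inc M' d" using uniq X m M'm XS neM d E by metis+
    have "SS d X M" using SS_ray[OF d(1) off(1) Md m(1) X(2) m(2)] X by blast
    moreover have "SS d X M'" using SS_ray[OF d(1) off m(1) X(2) M'm] M' btw_excl btw_sym by blast
    ultimately have "SS d M M'" using SS_sym SS_trans by blast
    moreover have "SS d A A" using SS_refl Ad by blast
    ultimately have "asy R A S M'" using asy_side[OF a d _ _ l l(2) m M'm] by blast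
    from asy_fwd_S[OF this M'] have a': "asy R A X M'" .
    have "X \<noteq> R" using X E(7) by blast
    then obtain d' where d': "inc X d'" "inc R d'" using ln_inc by blast
    note E' = asyE[OF a' l X(2) M'm d']
    have gm: "g \<noteq> m" "g \<noteq> d'" using nseg m d' by auto
    obtain W where W: "inc W g" "SS m W R" using pt_side[OF X(1,2) gm(1) E'(7)] by blast
    have Wm: "\<not> inc W m" using W SS_off by blast
    have Wd': "\<not> inc W d'" using uniq W X d' gm Wm by metis
    have Sd': "\<not> inc S d'" using uniq X m d' XS E'(8) by metis
    show False
    proof (cases "SS d' W A")
      case True
      from E'(10)[OF True W(2) X(1) W(1)] obtain B where B: "inc B g" "inc B l" using not_dj by blast
      have "SS m B W" using SS_line[of B l R m] B l lm W SS_sym SS_trans by blast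
      hence "\<not> btw B X W" using btw_not_SS X by blast
      moreover have Bd': "\<not> inc B d'"
      proof
        assume "inc B d'"
        hence "B = R" using B d' l uniq E' by metis
        thus False using B nseg by blast
      qed
      ultimately have "SS d' B W" using SS_ray[OF d'(1) Bd' Wd' X(1) B(1) W(1)] by blast
      hence "SS d' B A" using True SS_trans by blast
      moreover have "btw B R A" using nray B by blast
      ultimately show False using btw_not_SS d' by blast
    next
      case False
      have "\<not> SS d' S M'" using btw_not_SS M' d' by blast
      hence "\<not> SS d' A S" using E'(5) SS_sym SS_trans by metis
      hence "SS d' W S" using opp_trans[OF Wd' _ Sd' False] E'(5) SS_off by blast
      hence "\<not> SS g S R" using crossbar[OF X(2) d'(1) X(1) m(1) d'(2) W(1)] W by blast
      thus False using not_SS_btw nseg by blast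
    qed
  qed
  have 2: "hits inc g (ray inc S M) \<or> hits inc g (segment inc S R)" if g0: "hits inc g (ray inc R A)" for g
  proof (rule ccontr)
    assume n: "\<not> ?thesis"
    obtain T where T: "inc T g" "inc T l" "\<not> btw T R A" using g0 rR unfolding hits_def pts_def by auto
    have nseg: "\<not> inc S g" "\<not> inc R g" "\<And>Y. inc Y g \<Longrightarrow> \<not> btw S Y R"
      using n unfolding hits_def pts_def using segment_iff by auto
    have nray: "\<And>Y. \<lbrakk>inc Y g; inc Y m\<rbrakk> \<Longrightarrow> btw Y S M"
      using n rS unfolding hits_def pts_def by auto
    have TR: "T \<noteq> R" using T nseg by blast
    obtain A' where A': "btw R T A'" using extend TR by metis
    have A'l: "inc A' l" using btw_on(2) A' T l by blast
    have neA: "A' \<noteq> R" "A' \<noteq> T" using A' btw_distinct by blast+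
    have off: "\<not> inc T d" "\<not> inc A' d" using uniq T l A'l TR neA d E by metis+
    have "SS d T A" using SS_ray[OF d(2) off(1) Ad l(1) T(2) l(2)] T by blast
    moreover have "SS d T A'" using SS_ray[OF d(2) off l(1) T(2) A'l] A' btw_excl btw_sym by blast
    ultimately have "SS d A A'" using SS_sym SS_trans by blast
    moreover have "SS d M M" using SS_refl Md by blast
    ultimately have "asy R A' S M" using asy_side[OF a d _ _ l A'l m m(2)] by blast
    hence a': "asy T A' S M" using asy_move_R[OF _ l(1) A'l T(2)] neA A' btw_excl by blast
    have "S \<noteq> T" using T E(6) by blast
    then obtain d' where d': "inc S d'" "inc T d'" using ln_inc by blast
    note E' = asyE[OF a' T(2) A'l m d']
    have gl: "g \<noteq> l" "g \<noteq> d'" using nseg l d' by auto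
    obtain W where W: "inc W g" "SS l W S" using pt_side[OF T(1,2) gl(1) E'(6)] by blast
    have Wl: "\<not> inc W l" using W SS_off by blast
    have Wd': "\<not> inc W d'" using uniq W T d' gl Wl by metis
    have Rd': "\<not> inc R d'" using uniq T l d' TR E'(9) by metis
    have WA: "SS d' W A'"
    proof (rule ccontr)
      assume "\<not> SS d' W A'"
      moreover have "\<not> SS d' A' R" using btw_not_SS A' d' SS_sym by metis
      moreover have "\<not> inc A' d'" using E'(5) SS_off by blast
      ultimately have "SS d' W R" using opp_trans[OF Wd' _ Rd'] by blast
      hence "\<not> SS g R S" using crossbar[OF T(2) d'(2) T(1) l(1) d'(1) W(1)] W by blast
      thus False using not_SS_btw nseg btw_sym by metis
    qed
    have up: "SS d' Z A'" if Z: "inc Z g" "inc Z k" "inc S k" "dj k l" for Z k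
    proof -
      have "SS l Z W" using SS_line[of Z k S l] Z W SS_sym SS_trans by blast
      hence "\<not> btw Z T W" using btw_not_SS T by blast
      moreover have "\<not> inc Z d'" using uniq Z T d' gl djD by metis
      ultimately have "SS d' Z W" using SS_ray[OF d'(2) _ Wd' T(1) Z(1) W(1)] by blast
      thus ?thesis using WA SS_trans by blast
    qed
    \<comment> \<open>The limiting property does not yet make \<open>g\<close> meet
      \<open>m\<close>. By \<open>axiom_A5\<close> it meets \<open>m\<close> or the outer line
      \<open>n\<close>, and meeting \<open>n\<close> while avoiding \<open>m\<close> would put a
      point of \<open>n\<close> inside the angle, so that \<open>n\<close> would meet
      \<open>l\<close>.\<close>
    obtain n where n: "inc S n" "dj n l" "\<And>k. \<lbrakk>k \<noteq> l; \<not> dj k l\<rbrakk> \<Longrightarrow> \<not> dj k m \<or> \<not> dj k n"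
      using asy_avoiders[OF a l m] by metis
    have gl2: "\<not> dj g l" using T not_dj by blast
    have "\<not> dj g m"
    proof
      assume gm: "dj g m"
      then obtain Y where Y: "inc Y g" "inc Y n" using n(3)[OF gl(1) gl2] not_dj by blast
      have "SS m Y T" using SS_line Y T gm by blast
      thus False using E'(10)[OF up[OF Y n(1,2)] _ n(1) Y(2)] n by blast
    qed
    then obtain Z where Z: "inc Z g" "inc Z m" using not_dj by blast
    have "SS d' Z M" using up[OF Z m(1) E(4)] E'(5) SS_sym SS_trans by blast
    hence "\<not> btw Z S M" using btw_not_SS d' by blast
    thus False using nray Z by blast
  qed
  show ?thesis unfolding parallel_rays_def using E(1,2) ncol 1 2 by blast
qed

lemma parallel_rays_sym: "parallel_rays inc S B R A \<Longrightarrow> parallel_rays inc R A S B"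
proof -
  assume h: "parallel_rays inc S B R A"
  have "segment inc R S = segment inc S R" using segment_iff btw_sym by blast
  moreover have "collinear_rays inc R A S B = collinear_rays inc S B R A"
    unfolding collinear_rays_def by (simp add: Un_commute)
  ultimately show ?thesis using h unfolding parallel_rays_def by metis
qed

lemma parallel_rays_hits:
  assumes "parallel_rays inc S B R A" "inc R l" "inc A l" "inc S b" "inc B b" "inc X g" "inc X l" "\<not> btw X R A"
  shows "(\<exists>Y. inc Y g \<and> inc Y b \<and> \<not> btw Y S B) \<or> (\<exists>Y. inc Y g \<and> (Y = S \<or> Y = R \<or> btw S Y R))"
proof -
  have ne: "R \<noteq> A" "S \<noteq> B" using assms(1) unfolding parallel_rays_def by auto
  have "X \<in> ray inc R A" using ray_iff[OF ne(1) assms(2,3)] assms by blast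
  hence "hits inc g (ray inc R A)" unfolding hits_def pts_def using assms by auto
  hence "hits inc g (ray inc S B) \<or> hits inc g (segment inc S R)"
    using assms(1) unfolding parallel_rays_def by blast
  thus ?thesis unfolding hits_def pts_def using ray_iff[OF ne(2) assms(4,5)] segment_iff by auto
qed

text \<open>If \<open>S\<close> were on \<open>l\<close>, the ray from \<open>R\<close> would have a
  point \<open>T\<close> outside the segment \<open>RS\<close>. A line through \<open>T\<close>
  other than \<open>l\<close> that avoids \<open>b\<close> hits the ray from \<open>R\<close>, but
  neither the other ray nor the segment.\<close>

lemma parallel_rays_off:
  assumes pr: "parallel_rays inc S B R A" and l: "inc R l" "inc A l" and b: "inc S b" "inc B b"
  shows "\<not> inc S l"
proof
  assume Sl: "inc S l"
  have ne: "R \<noteq> A" "S \<noteq> B" using pr unfolding parallel_rays_def by auto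
  have "b \<noteq> l"
  proof
    assume "b = l"
    hence "ray inc S B \<union> ray inc R A \<subseteq> pts inc l"
      using ray_iff[OF ne(1) l] ray_iff[OF ne(2) b] unfolding pts_def by auto
    thus False using pr unfolding parallel_rays_def collinear_rays_def by blast
  qed
  have "\<exists>T. inc T l \<and> T \<noteq> S \<and> \<not> btw T R A \<and> \<not> (T = S \<or> T = R \<or> btw S T R)"
  proof (cases "S = R \<or> btw S R A")
    case True
    have "\<not> btw S A R" using True btw_excl btw_distinct by blast
    moreover have "A \<noteq> S" using True ne btw_distinct by blast
    moreover have "\<not> btw A R A" using btw_distinct by blast
    ultimately show ?thesis using l ne by blast
  next
    case False
    then obtain T where T: "btw R S T" using extend by metis
    have Tl: "inc T l" using btw_on(2) T Sl l by blast
    have "\<not> btw T R A"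
    proof
      assume h: "btw T R A"
      have "btw T R S \<or> btw A R S" using btw_on_line[OF h Tl l(2) Sl] False by blast
      thus False using T False btw_excl btw_sym by blast
    qed
    moreover have "\<not> btw S T R" using T btw_excl btw_sym by blast
    ultimately show ?thesis using T Tl btw_distinct by blast
  qed
  then obtain T where T: "inc T l" "T \<noteq> S" "\<not> btw T R A" "\<not> (T = S \<or> T = R \<or> btw S T R)" by blast
  have "\<not> inc T b" using uniq T b Sl \<open>b \<noteq> l\<close> by metis
  then obtain g where g: "inc T g" "dj g b" "g \<noteq> l" using avoider by metis
  obtain Y where Y: "inc Y g" "Y = S \<or> Y = R \<or> btw S Y R"
    using parallel_rays_hits[OF pr l b g(1) T(1,3)] g djD by blast
  have "inc Y l" using Y btw_on(1) Sl l by blast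
  hence "Y = T" using uniq g T Y by metis
  thus False using T Y by blast
qed

text \<open>Compare \<open>SB\<close> with the limiting ray \<open>SM\<close>. A ray inside the
  angle meets \<open>l\<close> in \<open>T\<close>, and is refuted by an avoider of \<open>b\<close>
  through a point of \<open>l\<close> beyond \<open>T\<close>; a ray outside is refuted by an
  avoider of \<open>m\<close> through \<open>B\<close>.\<close>

lemma parallel_rays_asy:
  assumes pr: "parallel_rays inc S B R A"
  shows "asy R A S B"
proof -
  have ne: "R \<noteq> A" "S \<noteq> B" using pr unfolding parallel_rays_def by auto
  obtain l b where l: "inc R l" "inc A l" and b: "inc S b" "inc B b" using ln_inc ne by metis
  note rp = parallel_rays_sym[OF pr]
  have Sl: "\<not> inc S l" using parallel_rays_off[OF pr l b] .
  have Rb: "\<not> inc R b" using parallel_rays_off[OF rp b l] .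
  have "S \<noteq> R" using Sl l by blast
  then obtain d where d: "inc S d" "inc R d" using ln_inc by blast
  have Ad: "\<not> inc A d" using uniq l d Sl ne by metis
  have Bd: "\<not> inc B d" using uniq b d Rb ne by metis
  have seg: "inc Y d" if "Y = S \<or> Y = R \<or> btw S Y R" for Y using that d btw_on(1) by blast
  have BA: "SS d B A"
  proof (rule ccontr)
    assume n: "\<not> SS d B A"
    obtain g where g: "inc A g" "dj g d" using avoider Ad by metis
    have "\<not> btw A R A" using btw_distinct by blast
    then obtain Y where Y: "inc Y g" "inc Y b" "\<not> btw Y S B"
      using parallel_rays_hits[OF pr l b g(1) l(2)] seg g djD by blast
    have Yd: "\<not> inc Y d" using Y g djD by blast
    have "SS d Y B" using SS_ray[OF d(1) Yd Bd b(1) Y(2) b(2) Y(3)] .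
    moreover have "SS d Y A" using SS_line Y g by blast
    ultimately show False using n SS_sym SS_trans by blast
  qed
  obtain m M where m: "inc S m" "inc M m" and a: "asy R A S M"
    by (rule asy_ex[OF Sl l ne(1)]) (rule that)
  note E = asyE[OF a l m d]
  have lm: "dj l m" using E(4) dj_sym by blast
  have "b = m"
  proof (rule ccontr)
    assume bm: "b \<noteq> m"
    show False
    proof (cases "SS m B R")
      case True
      obtain T where T: "inc T b" "inc T l" using E(10)[OF BA True b] not_dj by blast
      have TR: "T \<noteq> R" using T Rb by blast
      have TS: "T \<noteq> S" using T Sl by blast
      have "SS m T B" using SS_line[of T l R m] T l lm True SS_sym SS_trans by blast
      hence "\<not> btw T S B" using btw_not_SS m by blast
      moreover have Td: "\<not> inc T d" using uniq T b d TS Bd by metis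
      ultimately have TA: "SS d T A" using SS_ray[OF d(1) Td Bd b(1) T(1) b(2)] BA SS_trans by blast
      obtain T' where T': "btw R T T'" using extend TR by metis
      have T'l: "inc T' l" using btw_on(2) T' T l by blast
      have T'd: "\<not> inc T' d" using btw_on(1) T' d Td by blast
      have "\<not> btw T R T'" using T' btw_excl btw_sym by blast
      hence "SS d T T'" using SS_ray[OF d(2) Td T'd l(1) T(2) T'l] by blast
      hence "SS d T' A" using TA SS_sym SS_trans by blast
      hence T'A: "\<not> btw T' R A" using btw_not_SS d by blast
      have "T' \<noteq> T" using T' btw_distinct by blast
      hence T'b: "\<not> inc T' b" using uniq T T'l b Sl by metis
      then obtain g where g: "inc T' g" "dj g b" using avoider by metis
      obtain Y where Y: "inc Y g" "Y = S \<or> Y = R \<or> btw S Y R"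
        using parallel_rays_hits[OF pr l b g(1) T'l T'A] g djD by blast
      have Yb: "\<not> inc Y b" using Y g djD by blast
      have "\<not> btw Y S R" using Y Yb b btw_excl btw_sym btw_distinct by metis
      hence "SS b Y R" using SS_ray[OF b(1) Yb Rb d(1) seg[OF Y(2)] d(2)] by blast
      moreover have "SS b Y T'" using SS_line Y g by blast
      ultimately show False using T' T btw_not_SS SS_sym SS_trans by blast
    next
      case False
      have "\<not> inc B m" using uniq b m ne bm by metis
      then obtain g where g: "inc B g" "dj g m" using avoider by metis
      have nb: "\<not> btw B S B" using btw_distinct by blast
      have Sg: "\<not> inc S g" using g m djD by blast
      have *: "\<not> SS m Y R" if "inc Y g" for Y using SS_line[of Y g B m] g False that SS_sym SS_trans by blast
      obtain Y where Y: "inc Y g" "inc Y l \<or> Y = R \<or> btw R Y S"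
        using parallel_rays_hits[OF rp b l g(1) b(2) nb] Sg by blast
      have Ym: "\<not> inc Y m" using Y g djD by blast
      show False
      proof (cases "inc Y l")
        case True
        thus False using * Y SS_line[of Y l R m] l lm by blast
      next
        case nl: False
        hence r: "btw R Y S" using Y l by blast
        have "\<not> btw Y S R" using r btw_excl btw_sym by blast
        hence "SS m Y R" using SS_ray[OF m(1) Ym E(7) d(1) _ d(2)] seg r btw_sym by blast
        thus False using * Y by blast
      qed
    qed
  qed
  have "SS d M B" using E(5) BA SS_sym SS_trans by blast
  moreover have "SS d A A" using SS_refl Ad by blast
  ultimately show ?thesis using asy_side[OF a d _ _ l l(2) m] b \<open>b = m\<close> by blast
qed

lemma asy_iff: "asy R A S B \<longleftrightarrow> parallel_rays inc S B R A"
  using asy_parallel_rays parallel_rays_asy by blast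

text \<open>The definition of \<open>asy\<close> treats its two rays differently; the symmetry is
  inherited from \<open>parallel_rays\<close>.\<close>

lemma asy_sym: "asy R A S B \<Longrightarrow> asy S B R A"
  using asy_iff parallel_rays_sym by blast

lemma asy_move_A:
  assumes a: "asy R A S M" and l: "inc R l" "inc A l" "inc A' l" "A' \<noteq> R" "\<not> btw A R A'"
  shows "asy R A' S M"
proof -
  obtain m d where m: "inc S m" "inc M m" "inc S d" "inc R d" using asy_lines[OF a] by metis
  note E = asyE[OF a l(1,2) m]
  have off: "\<not> inc A d" "\<not> inc A' d" "\<not> inc M d" using uniq l m E by metis+
  have "SS d A A'" using SS_ray[OF m(4) off(1,2) l(1-3,5)] .
  moreover have "SS d M M" using SS_refl off by blast
  ultimately show ?thesis using asy_side[OF a m(3,4) _ _ l(1-3) m(1,2,2)] by blast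
qed

lemma asy_move_M:
  assumes a: "asy R A S M" and m: "inc S m" "inc M m" "inc M' m" "M' \<noteq> S" "\<not> btw M S M'"
  shows "asy R A S M'"
  using asy_sym[OF asy_move_A[OF asy_sym[OF a] m]] .

text \<open>\<open>M1\<close> represents the direction of \<open>SM\<close> from \<open>S\<close>
  and from \<open>S1\<close> at once.\<close>

lemma far_point:
  assumes m: "inc S m" "inc M m" "inc S1 m" "S \<noteq> M"
  obtains M1 where "inc M1 m" "M1 \<noteq> S1" "M1 \<noteq> S" "\<not> btw M S M1" "\<not> btw S M1 S1"
proof (cases "M = S1 \<or> btw S M S1")
  case False
  thus ?thesis using that[of M] m btw_distinct by blast
next
  case True
  hence ne: "S \<noteq> S1" using m btw_distinct by blast
  obtain d where d: "inc S d" "d \<noteq> m" using ex_other_line m by blast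
  obtain M1 where M1: "btw S S1 M1" using extend ne by blast
  have M1m: "inc M1 m" using btw_on(2) M1 m by blast
  have ne1: "M1 \<noteq> S" "M1 \<noteq> S1" using M1 btw_distinct by blast+
  have off: "\<not> inc M d" "\<not> inc S1 d" "\<not> inc M1 d" using uniq d m M1m ne ne1 by metis+
  have "\<not> btw M S S1" using True btw_excl btw_sym btw_distinct by metis
  hence "SS d M S1" using SS_ray[OF d(1) off(1,2) m(1-3)] by blast
  moreover have "\<not> btw S1 S M1" using M1 btw_excl btw_sym by blast
  hence "SS d S1 M1" using SS_ray[OF d(1) off(2,3) m(1,3) M1m] by blast
  ultimately have "\<not> btw M S M1" using SS_trans btw_not_SS d by blast
  moreover have "\<not> btw S M1 S1" using M1 btw_excl by blast
  ultimately show ?thesis using that M1m ne1 by blast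
qed

section \<open>Pencils of lines with a common end\<close>

definition pen :: "'p \<Rightarrow> 'p \<Rightarrow> 'l set" where
  "pen R A = {ln R A} \<union> {k. \<exists>S M. inc S k \<and> inc M k \<and> asy R A S M}"

lemma pen_move_A:
  assumes l: "inc R l" "inc A l" "inc A' l" "A \<noteq> R" "A' \<noteq> R" "\<not> btw A R A'"
  shows "pen R A' = pen R A"
proof -
  have "asy R A S M \<longleftrightarrow> asy R A' S M" for S M
    using asy_move_A[OF _ l(1-3,5,6)] asy_move_A[OF _ l(1,3,2,4)] l(6) btw_sym by blast
  moreover have "ln R A = l" "ln R A' = l" using ln_eq l by metis+
  ultimately show ?thesis unfolding pen_def by auto
qed

lemma rebase:
  assumes m: "inc R l" "inc A l" "inc R1 l" "R \<noteq> A"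
  obtains A1 where "inc A1 l" "A1 \<noteq> R1" "pen R1 A1 = pen R A" "\<And>S M. asy R A S M \<longleftrightarrow> asy R1 A1 S M"
proof -
  obtain A1 where A1: "inc A1 l" "A1 \<noteq> R1" "A1 \<noteq> R" "\<not> btw A R A1" "\<not> btw R A1 R1"
    using far_point[OF m] .
  have i: "asy R A S M \<longleftrightarrow> asy R1 A1 S M" for S M
  proof -
    have "asy R A S M \<longleftrightarrow> asy R A1 S M"
      using asy_move_A[OF _ m(1,2) A1(1,3,4)] asy_move_A[OF _ m(1) A1(1) m(2) m(4)[symmetric]] A1 btw_sym by blast
    also have "\<dots> \<longleftrightarrow> asy R1 A1 S M"
      using asy_move_R[OF _ m(1) A1(1) m(3)] asy_move_R[OF _ m(3) A1(1) m(1)] A1 btw_sym by blast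
    finally show ?thesis .
  qed
  moreover have "ln R A = l" "ln R1 A1 = l" using ln_eq m A1 by metis+
  ultimately have "pen R1 A1 = pen R A" unfolding pen_def by auto
  thus ?thesis using that A1 i by blast
qed

lemma asy_rebase_S:
  assumes "asy R A S M" "inc S m" "inc M m" "inc S1 m"
  obtains M1 where "inc M1 m" "M1 \<noteq> S1" "asy R A S1 M1" "pen S1 M1 = pen S M" "\<And>R A. asy S M R A \<longleftrightarrow> asy S1 M1 R A"
proof -
  have "S \<noteq> M" using asy_distinct assms by blast
  obtain M1 where 1: "inc M1 m" "M1 \<noteq> S1" "pen S1 M1 = pen S M" "\<And>R A. asy S M R A \<longleftrightarrow> asy S1 M1 R A"
    by (rule rebase[OF assms(2-4) \<open>S \<noteq> M\<close>]) (rule that)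
  thus ?thesis using that asy_sym assms(1) by metis
qed

lemma asy_same_line:
  assumes "asy R A S M" "asy R A T C" "inc S m" "inc M m" "inc T n" "inc C n" "inc X m" "inc X n"
  shows "m = n"
proof -
  obtain M1 where M1: "inc M1 m" "asy R A X M1" using asy_rebase_S[OF assms(1,3,4,7)] .
  obtain C1 where C1: "inc C1 n" "asy R A X C1" using asy_rebase_S[OF assms(2,5,6,8)] .
  show ?thesis using asy_unique[OF M1(2) C1(2) assms(7) M1(1) assms(8) C1(1)] .
qed

lemma btw_weaken: "btw R X S \<Longrightarrow> btw R S T \<Longrightarrow> btw R X T"
proof -
  assume h: "btw R X S" "btw R S T"
  obtain n where n: "inc R n" "inc S n" "inc T n" using btw_col h by blast
  have "T \<noteq> X" using h btw_excl by blast
  hence "btw R X T \<or> btw S X T" using btw_on_line[OF h(1) n] by blast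
  moreover have "btw T S R" "btw S X R" using h btw_sym by blast+
  hence "btw T S X" using btw_shrink by blast
  hence "\<not> btw S X T" using btw_excl[of T X S] btw_excl btw_sym by metis
  ultimately show ?thesis by blast
qed

text \<open>Parallel rays compose when the middle one starts on the segment \<open>RT\<close>: a
  line hitting an outer ray hits the middle ray or a part of the segment. The middle ray is
  therefore rebased at \<open>S'\<close>.\<close>

lemma asy_trans_mid:
  assumes a: "asy S B R A" "asy S B T C" and m: "inc S m" "inc B m" "inc S' m" and b: "btw R S' T"
    and l: "inc R l" "inc A l" "\<not> inc T l"
  shows "asy R A T C"
proof -
  obtain B' where a': "asy S' B' R A" "asy S' B' T C" using rebase[OF m] asy_distinct a by metis
  have p1: "parallel_rays inc R A S' B'" using asy_parallel_rays[OF a'(1)] .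
  have p2: "parallel_rays inc S' B' T C" using asy_parallel_rays[OF a'(2)] parallel_rays_sym by blast
  have s1: "segment inc R S' \<subseteq> segment inc R T"
    using b btw_weaken by (auto simp: segment_iff)
  have s2: "segment inc S' T \<subseteq> segment inc R T"
  proof
    fix X assume "X \<in> segment inc S' T"
    hence "X = S' \<or> X = T \<or> btw T X S'" using segment_iff btw_sym by blast
    moreover have "btw T S' R" using b btw_sym by blast
    ultimately show "X \<in> segment inc R T" using b btw_weaken btw_sym segment_iff by blast
  qed
  have ne: "R \<noteq> A" "T \<noteq> C" using p1 p2 unfolding parallel_rays_def by auto
  have nc: "\<not> collinear_rays inc R A T C"
  proof
    assume "collinear_rays inc R A T C"
    then obtain k where k: "ray inc R A \<subseteq> pts inc k" "ray inc T C \<subseteq> pts inc k" unfolding collinear_rays_def by auto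
    have "R \<in> ray inc R A" "A \<in> ray inc R A" "T \<in> ray inc T C" unfolding ray_def segment_def by auto
    hence "inc R k" "inc A k" "inc T k" using k unfolding pts_def by auto
    thus False using uniq l ne by metis
  qed
  have mono: "hits inc g Y" if "hits inc g X" "X \<subseteq> Y" for g X Y
    using that unfolding hits_def by blast
  have h1: "hits inc g (ray inc R A) \<Longrightarrow> hits inc g (ray inc S' B') \<or> hits inc g (segment inc R T)"
    "hits inc g (ray inc S' B') \<Longrightarrow> hits inc g (ray inc R A) \<or> hits inc g (segment inc R T)" for g
    using p1 mono[OF _ s1] unfolding parallel_rays_def by blast+
  have h2: "hits inc g (ray inc T C) \<Longrightarrow> hits inc g (ray inc S' B') \<or> hits inc g (segment inc R T)"
    "hits inc g (ray inc S' B') \<Longrightarrow> hits inc g (ray inc T C) \<or> hits inc g (segment inc R T)" for g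
    using p2 mono[OF _ s2] unfolding parallel_rays_def by blast+
  have "parallel_rays inc R A T C"
    unfolding parallel_rays_def using ne nc h1 h2 by blast
  thus ?thesis using asy_iff asy_sym by blast
qed

text \<open>Now \<open>l\<close> is the middle line. The limiting ray from \<open>T\<close> for
  \<open>RA\<close> is, by \<open>asy_trans_mid\<close>, also limiting for \<open>SB\<close>, and
  uniqueness identifies it with \<open>TC\<close>.\<close>

lemma asy_trans_out:
  assumes a: "asy S B R A" "asy S B T C" and l: "inc R l" "inc A l" "\<not> inc T l" and o: "\<not> SS l T S"
  shows "asy R A T C"
proof -
  obtain m d0 where m: "inc S m" "inc B m" and d0: "inc R d0" "inc S d0" using asy_lines[OF a(1)] by metis
  obtain n d where n: "inc T n" "inc C n" and d: "inc T d" "inc S d" using asy_lines[OF a(2)] by metis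
  note El = asyE[OF a(1) m l(1,2) d0]
  note En = asyE[OF a(2) m n d]
  obtain n' C' where n': "inc T n'" "inc C' n'" and a': "asy R A T C'"
    by (rule asy_ex[OF l(3,1,2) El(2)]) (rule that)
  have "\<not> inc S l" using El(4) m djD by blast
  then obtain R' where R': "inc R' l" "btw T R' S" using not_SS_btw l(3) o by blast
  have a2: "asy S B T C'"
    using asy_trans_mid[OF asy_sym[OF a(1)] a' l(1,2) R'(1) _ m] R'(2) btw_sym En(4,6) n djD by blast
  have "n = n'" using asy_unique[OF a(2) a2 n n'] .
  have "SS d C' C" using asyE(5)[OF a2 m n' d] En(5) SS_sym SS_trans by blast
  hence "\<not> btw C' T C" using btw_not_SS d by blast
  thus ?thesis using asy_move_M[OF a' n'] n \<open>n = n'\<close> En(2) by blast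
qed

text \<open>By \<open>s\<close>, no line meets all three lines in distinct points, since one of
  these would be in the middle (\<open>col\<close>). But one of the rays \<open>SR\<close> and
  \<open>ST\<close> lies between the other and \<open>SB\<close>, and the limiting property makes it
  meet the third line.\<close>

lemma asy_separated:
  assumes a: "asy S B R A" "asy S B T C" and m: "inc S m" "inc B m" and l: "inc R l" "inc A l"
    and n: "inc T n" "inc C n" and ln: "dj l n" and s: "SS m R T" "SS l T S" "SS n R S"
  shows False
proof -
  obtain d where d: "inc R d" "inc S d" using asy_lines[OF a(1)] by metis
  obtain d' where d': "inc T d'" "inc S d'" using asy_lines[OF a(2)] by metis
  note El = asyE[OF a(1) m l d]
  note En = asyE[OF a(2) m n d']
  have col: False if b: "btw X Y Z \<or> btw Y X Z \<or> btw X Z Y" "inc X m" "inc Y l" "inc Z n" for X Y Z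
  proof -
    have "SS m Y R" "SS m Z T" using SS_line that El(4) En(4) l n dj_sym by blast+
    hence "SS m Y Z" using s SS_sym SS_trans by blast
    moreover have "SS l X S" "SS l Z T" using SS_line that El(4) ln m n dj_sym by blast+
    hence "SS l X Z" using s SS_sym SS_trans by blast
    moreover have "SS n Y R" "SS n X S" using SS_line that En(4) ln m l dj_sym by blast+
    hence "SS n X Y" using s SS_sym SS_trans by blast
    ultimately show False using b btw_not_SS that by blast
  qed
  have SRT: "S \<noteq> R" "S \<noteq> T" "R \<noteq> T" using El(3) En(3) l n ln djD by blast+
  have step: False if h: "SS e Y A'" "SS m Y X" "inc X k" "inc A' k" "asy S B X A'" "inc X e" "inc S e" "k = l \<and> Y = T \<or> k = n \<and> Y = R"
    for e k X Y A'
  proof -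
    have SY: "S \<noteq> Y" using h(1,7) SS_off by blast
    then obtain g where g: "inc S g" "inc Y g" using ln_inc by blast
    note E = asyE[OF asy_sym[OF h(5)] h(3,4) m h(7,6)]
    obtain Z where Z: "inc Z g" "inc Z k" using E(10)[OF h(1,2) g] not_dj by blast
    have "Z \<noteq> S" using E(6) Z by blast
    moreover have "Z \<noteq> Y" using Z h(8) ln l n djD by blast
    ultimately have "btw S Z Y \<or> btw Z S Y \<or> btw S Y Z" using btw_cases[OF g(1) Z(1) g(2)] SY btw_sym by blast
    thus False using h(8) col[of S Z T] col[of S R Z] Z m n l btw_sym by blast
  qed
  have "SS d T B \<or> SS d' R B \<or> d = d'"
    using ray_angle_cases[OF m(1) d(2) d'(2) m(2) El(1)[symmetric] d(1) d'(1) s(1)] by blast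
  moreover have "d \<noteq> d'"
    using col[of S R T] btw_cases[OF d(2,1), of T] d' SRT m l n btw_sym by blast
  moreover have False if "SS d T B"
    using step[of d T A R l] that El(5) s(1) l a(1) d SS_sym SS_trans by blast
  moreover have False if "SS d' R B"
    using step[of d' R C T n] that En(5) s(1) n a(2) d' SS_sym SS_trans by blast
  ultimately show False by blast
qed

lemma asy_trans:
  assumes a: "asy S B R A" "asy S B T C" and l: "inc R l" "inc A l" "\<not> inc T l"
  shows "asy R A T C"
proof -
  obtain m d where m: "inc S m" "inc B m" and d: "inc R d" "inc S d" using asy_lines[OF a(1)] by metis
  obtain n d' where n: "inc T n" "inc C n" and d': "inc T d'" "inc S d'" using asy_lines[OF a(2)] by metis
  note El = asyE[OF a(1) m l(1,2) d]
  note En = asyE[OF a(2) m n d']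
  have ln: "dj l n" using asy_same_line[OF a l(1,2) n] l(3) n not_dj by metis
  have Rn: "\<not> inc R n" using ln l djD by blast
  consider "\<not> SS m R T" | "\<not> SS l T S" | "\<not> SS n R S" | "SS m R T" "SS l T S" "SS n R S" by blast
  thus ?thesis
  proof cases
    case 1
    then obtain S' where "inc S' m" "btw R S' T" using not_SS_btw El(4) En(4) l n djD by metis
    thus ?thesis using asy_trans_mid[OF a m _ _ l] by blast
  next
    case 2 thus ?thesis using asy_trans_out[OF a l] by blast
  next
    case 3 thus ?thesis using asy_trans_out[OF a(2,1) n Rn] asy_sym by blast
  next
    case 4
    thus ?thesis using asy_separated[OF a m l(1,2) n ln] by blast
  qed
qed

lemma pen_self: "inc R l \<Longrightarrow> inc A l \<Longrightarrow> R \<noteq> A \<Longrightarrow> l \<in> pen R A"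
  using ln_eq unfolding pen_def by auto

lemma pen_asy: "asy R A S M \<Longrightarrow> inc S k \<Longrightarrow> inc M k \<Longrightarrow> k \<in> pen R A"
  unfolding pen_def by blast

lemma pen_eq:
  assumes a: "asy R A S M"
  shows "pen R A = pen S M"
proof -
  have *: "pen R A \<subseteq> pen S M" if a: "asy R A S M" for R A S M
  proof
    fix x assume "x \<in> pen R A"
    obtain l m where l: "inc R l" "inc A l" and m: "inc S m" "inc M m" using asy_lines[OF a] by metis
    have ne: "R \<noteq> A" "S \<noteq> M" using asy_distinct a by blast+
    consider "x = l" | T C where "inc T x" "inc C x" "asy R A T C"
      using \<open>x \<in> pen R A\<close> ln_eq[OF ne(1) l] unfolding pen_def by blast
    thus "x \<in> pen S M"
    proof cases
      case 1 thus ?thesis using pen_asy[OF asy_sym[OF a] l] by blast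
    next
      case 2
      show ?thesis
      proof (cases "inc T m")
        case True
        have "m = x" using asy_same_line[OF a 2(3) m 2(1,2) True 2(1)] .
        thus ?thesis using pen_self[OF m ne(2)] by blast
      next
        case False
        thus ?thesis using pen_asy[OF asy_trans[OF a 2(3) m]] 2 by blast
      qed
    qed
  qed
  show ?thesis using *[OF a] *[OF asy_sym[OF a]] by blast
qed

definition Pen :: "'l set set" where
  "Pen = {pen R A | R A. R \<noteq> A}"

lemma Pen_I: "R \<noteq> A \<Longrightarrow> pen R A \<in> Pen"
  unfolding Pen_def by blast

lemma Pen_on:
  assumes "Z \<in> Pen" "k \<in> Z" "inc P k"
  obtains Q where "inc Q k" "Q \<noteq> P" "Z = pen P Q"
proof -
  obtain R A where RA: "Z = pen R A" "R \<noteq> A" using assms Pen_def by auto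
  consider "k = ln R A" | S M where "inc S k" "inc M k" "asy R A S M" using RA assms unfolding pen_def by blast
  thus ?thesis
  proof cases
    case 1
    have k: "inc R k" "inc A k" using ln_inc RA 1 by blast+
    from rebase[OF k assms(3) RA(2)] obtain Q where "inc Q k" "Q \<noteq> P" "pen P Q = pen R A" by metis
    thus ?thesis using that RA by auto
  next
    case 2
    from asy_rebase_S[OF 2(3,1,2) assms(3)] obtain Q where "inc Q k" "Q \<noteq> P" "pen P Q = pen S M" by metis
    thus ?thesis using that RA pen_eq[OF 2(3)] by auto
  qed
qed

lemma Pen_through:
  assumes "Z \<in> Pen" shows "\<exists>k \<in> Z. inc P k"
proof -
  obtain R A where RA: "Z = pen R A" "R \<noteq> A" using assms Pen_def by auto
  obtain l where l: "inc R l" "inc A l" using ln_inc RA by blast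
  show ?thesis
  proof (cases "inc P l")
    case True thus ?thesis using pen_self[OF l RA(2)] RA by blast
  next
    case False
    obtain m M where "inc P m" "inc M m" "asy R A P M"
      by (rule asy_ex[OF False l RA(2)]) (rule that)
    thus ?thesis using pen_asy RA by blast
  qed
qed

lemma Pen_asy:
  assumes "Z \<in> Pen" "k \<in> Z" "inc R l" "inc A l" "R \<noteq> A" "Z = pen R A" "k \<noteq> l" "inc S k"
  obtains M where "inc M k" "asy R A S M" "Z = pen S M"
proof -
  obtain S' M where "inc S' k" "inc M k" "asy R A S' M" using assms ln_eq unfolding pen_def by blast
  thus ?thesis using that asy_rebase_S[of R A S' M k S] assms pen_eq by metis
qed

lemma Pen_dj:
  assumes "Z \<in> Pen" "a \<in> Z" "b \<in> Z" "a \<noteq> b" shows "dj a b"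
proof (rule ccontr)
  assume "\<not> dj a b"
  then obtain P where P: "inc P a" "inc P b" using not_dj by blast
  obtain Q where Q: "inc Q a" "Q \<noteq> P" "Z = pen P Q" using Pen_on[OF assms(1,2) P(1)] .
  obtain M where M: "asy P Q P M"
    using Pen_asy[OF assms(1,3) P(1) Q(1) Q(2)[symmetric] Q(3) assms(4)[symmetric] P(2)] .
  have "\<not> inc P a" using asyE(6)[OF M P(1) Q(1)] asy_lines[OF M] by metis
  thus False using P by blast
qed

text \<open>Otherwise the limiting rays \<open>SM\<close> and \<open>SM'\<close> for the two
  opposite rays would be opposite rays of \<open>k\<close>. The outer line \<open>n\<close> of
  \<open>axiom_A5\<close> avoids \<open>l\<close>, so it enters neither of the angles
  \<open>MSR\<close> and \<open>M'SR\<close>. Hence \<open>M\<close> and \<open>M'\<close> are both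
  on the side of \<open>R\<close> with respect to \<open>n\<close>, but \<open>S\<close> is on
  \<open>n\<close> and between them.\<close>

lemma pen_opp:
  assumes l: "inc R l" "inc A l" "inc A' l" and b: "btw A R A'" and k: "k \<in> pen R A" "k \<in> pen R A'"
  shows "k = l"
proof (rule ccontr)
  assume kl: "k \<noteq> l"
  have ne: "R \<noteq> A" "R \<noteq> A'" using b btw_distinct by blast+
  obtain S where S: "inc S k" using ex_pt by blast
  obtain M where M: "inc M k" "asy R A S M" using Pen_asy[OF Pen_I[OF ne(1)] k(1) l(1,2) ne(1) _ kl S] by blast
  obtain M' where M': "inc M' k" "asy R A' S M'" using Pen_asy[OF Pen_I[OF ne(2)] k(2) l(1,3) ne(2) _ kl S] by blast
  obtain n N d where n: "inc S n" "inc N n" "k \<noteq> n" "dj n l" and d: "inc S d" "inc R d" "SS d N A" "SS n M R"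
    by (rule asy_avoiders[OF M(2) l(1,2) S M(1)]) (rule that)
  note E = asyE[OF M(2) l(1,2) S M(1) d(1,2)] and E' = asyE[OF M'(2) l(1,3) S M'(1) d(1,2)]
  have nd: "n \<noteq> d" using n d l djD by blast
  have A'd: "\<not> inc A' d" using E'(5) SS_off by blast
  obtain N2 where N2: "inc N2 n" "SS d N2 A'" using pt_side[OF n(1) d(1) nd A'd] by blast
  have "SS d M' N2" using E'(5) N2 SS_sym SS_trans by blast
  moreover have "\<not> SS k N2 R" using E'(10)[OF N2(2) _ n(1) N2(1)] n(4) by blast
  ultimately have "SS n M' R" using ray_angle_cases[OF d(1) S n(1) d(2) E(3)[symmetric] M'(1) N2(1) _ n(3)] by blast
  hence nMM: "SS n M M'" using d(4) SS_sym SS_trans by blast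
  have "\<not> SS d A A'" using b btw_not_SS d by blast
  hence "\<not> SS d M M'" using E(5) E'(5) SS_sym SS_trans by blast
  moreover have "\<not> inc M d" "\<not> inc M' d" using E(5) E'(5) SS_off by blast+
  ultimately obtain X where X: "inc X d" "btw M X M'" using not_SS_btw by blast
  have "inc X k" using btw_on(1) X M M' by blast
  hence "X = S" using X d S E(8) uniq by metis
  thus False using X nMM btw_not_SS n by blast
qed

lemma Pen_two:
  assumes Z: "Z \<in> Pen" "l \<in> Z" and l: "inc R l" "inc A l" "inc A' l" and b: "btw A R A'"
  shows "Z = pen R A \<or> Z = pen R A'"
proof -
  obtain Q where Q: "inc Q l" "Q \<noteq> R" "Z = pen R Q" using Pen_on[OF Z l(1)] .
  have ne: "R \<noteq> A" "R \<noteq> A'" using b btw_distinct by blast+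
  have "\<not> btw A R Q \<or> \<not> btw A' R Q"
  proof (rule ccontr)
    assume h: "\<not> ?thesis"
    obtain d where d: "inc R d" "d \<noteq> l" using ex_other_line l by blast
    have "\<not> inc A d" "\<not> inc Q d" "\<not> inc A' d" using uniq d l Q ne by metis+
    note off = this
    have "\<not> SS d A Q" "\<not> SS d Q A'" using h btw_not_SS[OF _ d(1)] SS_sym by blast+
    hence "SS d A A'" using opp_trans[OF off] by blast
    thus False using b btw_not_SS d by blast
  qed
  thus ?thesis using pen_move_A[OF l(1,2) Q(1)] pen_move_A[OF l(1,3) Q(1)] Q ne by blast
qed

lemma Pen_ends:
  obtains R A A' where "inc R l" "inc A l" "inc A' l" "btw A R A'"
proof -
  obtain R where R: "inc R l" using ex_pt by blast
  obtain A where A: "inc A l" "A \<noteq> R" using ex_pt2 by blast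
  obtain A' where A': "btw A R A'" using extend A by blast
  show ?thesis using that R A A' btw_on(2) by blast
qed

lemma Pen_unique:
  assumes "Z1 \<in> Pen" "Z2 \<in> Pen" "a \<in> Z1" "b \<in> Z1" "a \<in> Z2" "b \<in> Z2" "a \<noteq> b"
  shows "Z1 = Z2"
proof -
  obtain R A A' where l: "inc R a" "inc A a" "inc A' a" "btw A R A'" using Pen_ends .
  show ?thesis
    using Pen_two[OF assms(1,3) l] Pen_two[OF assms(2,5) l] pen_opp[OF l] assms(4,6,7) by blast
qed

text \<open>Let \<open>k'\<close> be the line of the pencil through the point \<open>Q\<close> where
  \<open>k\<close> crosses \<open>PW\<close>. If \<open>k\<close> were another line, its ray towards
  the common end would lie in an angle at \<open>Q\<close> towards \<open>P\<close> or
  \<open>W\<close>, and the limiting property would make \<open>k\<close> meet \<open>l1\<close> or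
  \<open>l2\<close>.\<close>

lemma Pen_between:
  assumes Z: "Z \<in> Pen" "l1 \<in> Z" "l2 \<in> Z" and k: "dj k l1" "dj k l2" and P: "inc P l1" "inc W l2" "\<not> SS k P W"
  shows "k \<in> Z"
proof -
  have off: "\<not> inc P k" "\<not> inc W k" using k P djD by blast+
  then obtain Q where Q: "inc Q k" "btw P Q W" using not_SS_btw P by blast
  obtain k' where k': "k' \<in> Z" "inc Q k'" using Pen_through Z by blast
  have ne: "l1 \<noteq> k'" "l2 \<noteq> k'" using k k' Q djD by blast+
  obtain B where B: "inc B k'" "B \<noteq> Q" "Z = pen Q B" using Pen_on[OF Z(1) k'] .
  obtain A where A: "inc A l1" "asy Q B P A" using Pen_asy[OF Z(1,2) k'(2) B(1) B(2)[symmetric] B(3) ne(1) P(1)] .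
  obtain C where C: "inc C l2" "asy Q B W C" using Pen_asy[OF Z(1,3) k'(2) B(1) B(2)[symmetric] B(3) ne(2) P(2)] .
  obtain t where t: "inc P t" "inc Q t" "inc W t" using btw_col Q by blast
  note EA = asyE[OF asy_sym[OF A(2)] P(1) A(1) k'(2) B(1) t(2,1)]
  note EC = asyE[OF asy_sym[OF C(2)] P(2) C(1) k'(2) B(1) t(2,3)]
  show ?thesis
  proof (rule ccontr)
    assume "k \<notin> Z"
    hence "k \<noteq> k'" using k' by blast
    have "k \<noteq> t" using off t by blast
    have "\<not> inc B t" using EA(5) SS_off by blast
    then obtain K where K: "inc K k" "SS t K B" using pt_side[OF Q(1) t(2) \<open>k \<noteq> t\<close>] by blast
    have "K \<noteq> Q" using K t SS_off by blast
    hence Kk': "\<not> inc K k'" using uniq K Q k' \<open>k \<noteq> k'\<close> by metis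
    have "SS t K A" "SS t K C" using K EA(5) EC(5) SS_trans by blast+
    hence "\<not> SS k' K P" "\<not> SS k' K W" using EA(10)[OF _ _ Q(1) K(1)] EC(10)[OF _ _ Q(1) K(1)] k by blast+
    moreover have "\<not> SS k' P W" using btw_not_SS Q k' by blast
    ultimately show False using opp_trans[OF Kk' EA(7) EC(7)] by blast
  qed
qed

lemma Pen_three:
  assumes "Z \<in> Pen" "a \<in> Z" "b \<in> Z" "c \<in> Z" "a \<noteq> b" "b \<noteq> c" "a \<noteq> c" and P: "inc P a" "inc Q b" "inc R c"
  shows "\<not> SS a Q R \<or> \<not> SS b P R \<or> \<not> SS c P Q"
proof -
  obtain A where A: "inc A a" "A \<noteq> P" "Z = pen P A" using Pen_on[OF assms(1,2) P(1)] .
  obtain B where B: "inc B b" "asy P A Q B"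
    using Pen_asy[OF assms(1,3) P(1) A(1) A(2)[symmetric] A(3) assms(5)[symmetric] P(2)] .
  obtain C where C: "inc C c" "asy P A R C"
    using Pen_asy[OF assms(1,4) P(1) A(1) A(2)[symmetric] A(3) assms(7)[symmetric] P(3)] .
  show ?thesis
    using asy_separated[OF B(2) C(2) P(1) A(1) P(2) B(1) P(3) C(1) Pen_dj[OF assms(1,3,4,6)]] SS_sym by blast
qed

lemma parallel_Pen: "parallel inc a b \<longleftrightarrow> a \<noteq> b \<and> (\<exists>Z \<in> Pen. a \<in> Z \<and> b \<in> Z)"
proof
  assume "parallel inc a b"
  then obtain R A S B where h: "ray inc R A \<subseteq> pts inc a" "ray inc S B \<subseteq> pts inc b" "parallel_rays inc R A S B"
    unfolding parallel_def by blast
  have i: "inc R a" "inc A a" "inc S b" "inc B b" using h(1,2) unfolding ray_def segment_def pts_def by auto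
  have a: "asy S B R A" using h(3) asy_iff by blast
  hence ne: "S \<noteq> B" using asy_distinct by blast
  have "b \<in> pen S B" "a \<in> pen S B" using pen_self[OF i(3,4) ne] pen_asy[OF a i(1,2)] by blast+
  moreover have "dj a b" using asyE(4)[OF a i(3,4,1,2)] asy_lines[OF a] by metis
  ultimately show "a \<noteq> b \<and> (\<exists>Z \<in> Pen. a \<in> Z \<and> b \<in> Z)" using dj_irrefl Pen_I[OF ne] by blast
next
  assume "a \<noteq> b \<and> (\<exists>Z \<in> Pen. a \<in> Z \<and> b \<in> Z)"
  then obtain Z where Z: "a \<noteq> b" "Z \<in> Pen" "a \<in> Z" "b \<in> Z" by blast
  obtain R S where R: "inc R a" "inc S b" using ex_pt by metis
  obtain A where A: "inc A a" "A \<noteq> R" "Z = pen R A" using Pen_on[OF Z(2,3) R(1)] .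
  obtain B where B: "inc B b" "asy R A S B" using Pen_asy[OF Z(2,4) R(1) A(1) A(2)[symmetric] A(3) Z(1)[symmetric] R(2)] .
  have pr: "parallel_rays inc R A S B" using asy_iff asy_sym B by blast
  have "ray inc R A \<subseteq> pts inc a" "ray inc S B \<subseteq> pts inc b"
    using ray_iff[OF A(2)[symmetric] R(1) A(1)] ray_iff[OF _ R(2) B(1)] asy_distinct[OF B(2)] unfolding pts_def by auto
  thus "parallel inc a b" unfolding parallel_def using pr by blast
qed

lemma parallel_to_ray_pen:
  assumes "R \<noteq> A" "parallel_to_ray inc k R A" shows "k \<in> pen R A"
proof -
  obtain S B where h: "ray inc S B \<subseteq> pts inc k" "parallel_rays inc S B R A"
    using assms unfolding parallel_to_ray_def by blast
  have "inc S k" "inc B k" using h(1) unfolding ray_def segment_def pts_def by auto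
  thus ?thesis using h(2) asy_iff pen_asy by blast
qed

end

section \<open>Rimpoints\<close>

locale menger_ends = menger inc for inc :: "'p \<Rightarrow> 'l \<Rightarrow> bool" +
  assumes A6: "axiom_A6 inc"
begin

text \<open>A pencil contains the line of its defining ray, so the last two disjuncts of
  \<open>axiom_A6\<close> supply a common line just as the first one does.\<close>

lemma Pen_meet:
  assumes "Z1 \<in> Pen" "Z2 \<in> Pen"
  shows "\<exists>l. l \<in> Z1 \<and> l \<in> Z2"
proof -
  obtain R A S B where RA: "Z1 = pen R A" "R \<noteq> A" and SB: "Z2 = pen S B" "S \<noteq> B"
    using assms Pen_def by auto
  have r: "l \<in> pen R A" if "R \<noteq> A" "ray inc R A \<subseteq> pts inc l" for R A l
  proof -
    have "inc R l" "inc A l" using that unfolding ray_def segment_def pts_def by auto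
    thus ?thesis using pen_self that by blast
  qed
  show ?thesis
  proof (cases "collinear_rays inc R A S B")
    case True
    then obtain k where k: "ray inc R A \<subseteq> pts inc k" "ray inc S B \<subseteq> pts inc k"
      unfolding collinear_rays_def by auto
    thus ?thesis using r RA SB by blast
  next
    case False
    have "\<exists>l. (parallel_to_ray inc l R A \<and> parallel_to_ray inc l S B) \<or>
          (\<not> parallel_rays inc R A S B \<and> ray inc R A \<subseteq> pts inc l \<and> parallel_to_ray inc l S B) \<or>
          (\<not> parallel_rays inc R A S B \<and> parallel_to_ray inc l R A \<and> ray inc S B \<subseteq> pts inc l)"
      using A6 RA(2) SB(2) False unfolding axiom_A6_def by blast
    thus ?thesis using r RA SB parallel_to_ray_pen by blast
  qed
qed

text \<open>An ideal triangle has no transversal: of the three points, the middle one would lie on a side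
  separating the two others, and so would put that side into the pencil of their common end.\<close>

lemma Pen_transversal:
  assumes Z: "Z \<in> Pen" "a \<in> Z" "b \<in> Z" "a \<noteq> b" and p: "parallel inc l a" "parallel inc l b"
    and t: "meets inc t a" "meets inc t b" "meets inc t l"
  shows "l \<in> Z"
proof -
  obtain Y where Y: "Y \<in> Pen" "l \<in> Y" "a \<in> Y" "l \<noteq> a" using p(1) parallel_Pen by blast
  obtain X where X: "X \<in> Pen" "l \<in> X" "b \<in> X" "l \<noteq> b" using p(2) parallel_Pen by blast
  obtain P Q R where P: "inc P a" "inc P t" "inc Q b" "inc Q t" "inc R l" "inc R t"
    using t unfolding meets_def by blast
  have d: "dj a b" "dj l a" "dj l b" using Pen_dj Z X Y by blast+
  have ne: "P \<noteq> Q" "Q \<noteq> R" "P \<noteq> R" using d P djD by blast+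
  show ?thesis
  proof -
    consider "btw Q P R" | "btw P Q R" | "btw P R Q" using btw_cases[OF P(2,4,6)] ne by blast
    thus ?thesis
    proof cases
      case 1
      have "a \<in> X" using Pen_between[OF X(1,3,2) d(1) _ P(3,5)] 1 btw_not_SS P(1) d dj_sym by blast
      hence "X = Z" using Pen_unique[OF X(1) Z(1)] Z X by blast
      thus ?thesis using X by blast
    next
      case 2
      have "b \<in> Y" using Pen_between[OF Y(1,3,2) _ _ P(1,5)] 2 btw_not_SS P(3) d dj_sym by blast
      hence "Y = Z" using Pen_unique[OF Y(1) Z(1)] Z Y by blast
      thus ?thesis using Y by blast
    next
      case 3
      show ?thesis using Pen_between[OF Z(1-3) _ _ P(1,3)] 3 btw_not_SS P(5) d dj_sym by blast
    qed
  qed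
qed

lemma Pen_crossing:
  assumes Z: "Z \<in> Pen" "a \<in> Z" "b \<in> Z" "c \<in> Z" "a \<noteq> b" "b \<noteq> c" "a \<noteq> c"
  shows "\<exists>t. meets inc t a \<and> meets inc t b \<and> meets inc t c"
proof -
  obtain P Q R where P: "inc P a" "inc Q b" "inc R c" using ex_pt by metis
  have d: "dj a b" "dj b c" "dj a c" using Pen_dj Z by blast+
  have *: "\<exists>t. meets inc t a \<and> meets inc t b \<and> meets inc t c"
    if d: "dj a b" "dj b c" "dj a c" and P: "inc P a" "inc R c" "\<not> SS b P R" for a b c P R
  proof -
    obtain X where X: "inc X b" "btw P X R" using not_SS_btw P d djD by metis
    obtain t where "inc P t" "inc X t" "inc R t" using btw_col X by blast
    moreover have "t \<noteq> a" "t \<noteq> b" "t \<noteq> c" using calculation P d djD by blast+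
    ultimately show ?thesis unfolding meets_def using P X by blast
  qed
  show ?thesis using Pen_three[OF Z P] *[OF _ d(2)] *[of b a c Q R] *[of a b c P R] *[of a c b P Q] d P dj_sym by blast
qed

text \<open>By \<open>rim_rel_iff\<close> this is the equivalence class of each of its
  pairs.\<close>

definition rim :: "'l set \<Rightarrow> 'l rimpoint" where
  "rim Z = {(a, b). a \<in> Z \<and> b \<in> Z \<and> a \<noteq> b}"

lemma rimpair_iff: "rimpair inc (a, b) \<longleftrightarrow> a \<noteq> b \<and> (\<exists>Z \<in> Pen. a \<in> Z \<and> b \<in> Z)"
proof
  assume "rimpair inc (a, b)"
  thus "a \<noteq> b \<and> (\<exists>Z \<in> Pen. a \<in> Z \<and> b \<in> Z)" unfolding rimpair_def parallel_Pen by auto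
next
  assume h: "a \<noteq> b \<and> (\<exists>Z \<in> Pen. a \<in> Z \<and> b \<in> Z)"
  then obtain Z where Z: "Z \<in> Pen" "a \<in> Z" "b \<in> Z" "a \<noteq> b" by blast
  obtain P Q where P: "inc P a" "inc Q b" using ex_pt by metis
  have ab: "dj a b" using Pen_dj Z by blast
  hence "P \<noteq> Q" using P djD by blast
  \<comment> \<open>A rimpoint requires a third line of the pencil and a transversal. The
    transversal is \<open>PQ\<close>, the third line passes through its point \<open>W\<close>
    beyond \<open>Q\<close>.\<close>
  then obtain W where W: "btw P Q W" using extend by blast
  obtain t where t: "inc P t" "inc Q t" "inc W t" using btw_col W by blast
  have ta: "t \<noteq> a" "t \<noteq> b" using ab t P djD by blast+
  have Wne: "W \<noteq> P" "W \<noteq> Q" using W btw_distinct by blast+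
  obtain l where l: "l \<in> Z" "inc W l" using Pen_through Z by blast
  have "\<not> inc W a" "\<not> inc W b" using uniq P t ta Wne by metis+
  hence la: "l \<noteq> a" "l \<noteq> b" using l by auto
  have "t \<noteq> l" using Pen_dj[OF Z(1) l(1) Z(2) la(1)] t P djD by blast
  hence "meets inc t a" "meets inc t b" "meets inc t l" unfolding meets_def using ta t P l by blast+
  thus "rimpair inc (a, b)" unfolding rimpair_def parallel_Pen using h la Z l by auto
qed

lemma rimpair_on_iff:
  assumes Z: "Z \<in> Pen" "a \<in> Z" "b \<in> Z" "a \<noteq> b"
  shows "rimpair_on inc (a, b) l \<longleftrightarrow> l \<in> Z"
proof
  assume "rimpair_on inc (a, b) l"
  thus "l \<in> Z" using Pen_transversal[OF Z] Z unfolding rimpair_on_def by auto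
next
  assume l: "l \<in> Z"
  show "rimpair_on inc (a, b) l"
  proof (cases "l \<in> {a, b}")
    case False
    hence "parallel inc l a" "parallel inc l b" using parallel_Pen Z l by blast+
    thus ?thesis unfolding rimpair_on_def using Pen_crossing[OF Z(1-3) l Z(4)] False by auto
  qed (auto simp add: rimpair_on_def)
qed

lemma rim_rel_iff:
  assumes Z: "Z \<in> Pen" "a \<in> Z" "b \<in> Z" "a \<noteq> b"
  shows "((a, b), q) \<in> rim_rel inc \<longleftrightarrow> q \<in> rim Z"
proof -
  obtain c d where q: "q = (c, d)" by (cases q)
  show ?thesis unfolding q
  proof
    assume "((a, b), (c, d)) \<in> rim_rel inc"
    hence "rimpair inc (c, d)" "rimpair_on inc (a, b) c" "rimpair_on inc (a, b) d" unfolding rim_rel_def by auto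
    thus "(c, d) \<in> rim Z" unfolding rim_def using rimpair_iff rimpair_on_iff[OF Z] by auto
  next
    assume "(c, d) \<in> rim Z"
    hence c: "c \<in> Z" "d \<in> Z" "c \<noteq> d" unfolding rim_def by auto
    have "x = y \<or> parallel inc x y" if "x \<in> {a, b, c, d}" "y \<in> {a, b, c, d}" for x y
      using that parallel_Pen Z c by blast
    thus "((a, b), (c, d)) \<in> rim_rel inc" unfolding rim_rel_def using rimpair_iff rimpair_on_iff[OF Z] Z c by auto
  qed
qed

lemma Pen_pair: assumes "Z \<in> Pen" shows "\<exists>a b. a \<in> Z \<and> b \<in> Z \<and> a \<noteq> b"
proof -
  obtain a where a: "a \<in> Z" using Pen_through assms by blast
  obtain P where "\<not> inc P a" using ex_off by blast
  thus ?thesis using Pen_through assms a by metis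
qed

lemma rimpoints_eq: "rimpoints inc = rim ` Pen"
proof
  show "rimpoints inc \<subseteq> rim ` Pen"
  proof
    fix X assume "X \<in> rimpoints inc"
    then obtain p where p: "rimpair inc p" "X = rim_rel inc `` {p}" unfolding rimpoints_def quotient_def by auto
    obtain a b where ab: "p = (a, b)" by (cases p)
    then obtain Z where Z: "Z \<in> Pen" "a \<in> Z" "b \<in> Z" "a \<noteq> b" using p rimpair_iff by blast
    have "X = rim Z" using p ab rim_rel_iff[OF Z] by auto
    thus "X \<in> rim ` Pen" using Z by blast
  qed
  show "rim ` Pen \<subseteq> rimpoints inc"
  proof
    fix X assume "X \<in> rim ` Pen"
    then obtain Z where Z: "Z \<in> Pen" "X = rim Z" by blast
    obtain a b where ab: "a \<in> Z" "b \<in> Z" "a \<noteq> b" using Pen_pair Z by blast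
    have "X = rim_rel inc `` {(a, b)}" using Z rim_rel_iff[OF Z(1) ab] by auto
    moreover have "rimpair inc (a, b)" using rimpair_iff ab Z by blast
    ultimately show "X \<in> rimpoints inc" unfolding rimpoints_def quotient_def by blast
  qed
qed

lemma on_rim: assumes "Z \<in> Pen" shows "on inc (Rim (rim Z)) l \<longleftrightarrow> l \<in> Z"
proof -
  have "on inc (Rim (rim Z)) l \<longleftrightarrow> (\<exists>a b. a \<in> Z \<and> b \<in> Z \<and> a \<noteq> b \<and> rimpair_on inc (a, b) l)"
    unfolding rim_def by auto
  thus ?thesis using Pen_pair[OF assms] rimpair_on_iff[OF assms] by blast
qed

section \<open>Joins of rimpoints and the action of the finite points\<close>

abbreviation rims :: "'l rimpoint set" ("\<Omega>") where "\<Omega> \<equiv> rimpoints inc"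

abbreviation onr :: "'l rimpoint \<Rightarrow> 'l \<Rightarrow> bool" where "onr X l \<equiv> on inc (Rim X) l"

abbreviation jp :: "'l rimpoint \<Rightarrow> 'p \<Rightarrow> 'l" where "jp X P \<equiv> join inc (Rim X) (Fin P)"

abbreviation jr :: "'l rimpoint \<Rightarrow> 'l rimpoint \<Rightarrow> 'l" where "jr X Y \<equiv> rim_join inc X Y"

lemma rim_cases:
  assumes "X \<in> \<Omega>" obtains Z where "Z \<in> Pen" "X = rim Z" "\<And>l. onr X l \<longleftrightarrow> l \<in> Z"
  using assms on_rim unfolding rimpoints_eq by auto

lemma onr_dj: "\<lbrakk>X \<in> \<Omega>; onr X a; onr X b; a \<noteq> b\<rbrakk> \<Longrightarrow> dj a b"
  by (metis rim_cases Pen_dj)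

lemma onr_unique: "\<lbrakk>X \<in> \<Omega>; Y \<in> \<Omega>; X \<noteq> Y; onr X a; onr Y a; onr X b; onr Y b\<rbrakk> \<Longrightarrow> a = b"
  by (metis rim_cases Pen_unique)

lemma jp: assumes "X \<in> \<Omega>" shows "onr X (jp X P)" "inc P (jp X P)"
proof -
  have "\<exists>l. onr X l \<and> inc P l" using rim_cases assms Pen_through by metis
  hence "\<exists>!l. on inc (Rim X) l \<and> on inc (Fin P) l" using onr_dj assms djD on.simps(1) by metis
  from theI'[OF this] show "onr X (jp X P)" "inc P (jp X P)" unfolding join_def by auto
qed

lemma jp_eq: "\<lbrakk>X \<in> \<Omega>; onr X l; inc P l\<rbrakk> \<Longrightarrow> jp X P = l"
  using jp onr_dj djD by metis

lemma jr: assumes "X \<in> \<Omega>" "Y \<in> \<Omega>" "X \<noteq> Y" shows "onr X (jr X Y)" "onr Y (jr X Y)"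
proof -
  obtain Z W where "Z \<in> Pen" "\<And>l. onr X l \<longleftrightarrow> l \<in> Z" "W \<in> Pen" "\<And>l. onr Y l \<longleftrightarrow> l \<in> W"
    using rim_cases assms by metis
  hence "\<exists>l. onr X l \<and> onr Y l" using Pen_meet by blast
  hence "\<exists>!l. onr X l \<and> onr Y l" using onr_unique assms by metis
  from theI'[OF this] show "onr X (jr X Y)" "onr Y (jr X Y)" unfolding join_def by auto
qed

lemma jr_eq: "\<lbrakk>X \<in> \<Omega>; Y \<in> \<Omega>; X \<noteq> Y; onr X l; onr Y l\<rbrakk> \<Longrightarrow> jr X Y = l"
  using jr onr_unique by metis

lemma jr_sym: "jr X Y = jr Y X"
  unfolding join_def by meson

lemma join_fin: "join inc (Fin P) (Fin Q) = ln P Q"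
  unfolding join_def ln_def by simp

lemma parallel_iff: "parallel inc a b \<longleftrightarrow> a \<noteq> b \<and> (\<exists>X \<in> \<Omega>. onr X a \<and> onr X b)"
  unfolding parallel_Pen rimpoints_eq using on_rim by blast

definition ray_end :: "'p \<Rightarrow> 'p \<Rightarrow> 'l rimpoint" where
  "ray_end P Q = rim (pen P Q)"

lemma ray_end: assumes "P \<noteq> Q" shows "ray_end P Q \<in> \<Omega>" "onr (ray_end P Q) (ln P Q)"
  using Pen_I[OF assms] on_rim pen_self ln_inc assms unfolding ray_end_def rimpoints_eq by auto

lemma ray_end_on: assumes "X \<in> \<Omega>" "onr X l" "inc P l"
  obtains Q where "inc Q l" "Q \<noteq> P" "X = ray_end P Q"
  using assms Pen_on rim_cases unfolding ray_end_def by metis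

lemma ray_end_opp: assumes "btw A R A'" shows "ray_end R A \<noteq> ray_end R A'"
proof
  assume h: "ray_end R A = ray_end R A'"
  obtain l where l: "inc R l" "inc A l" "inc A' l" using btw_col assms by blast
  have P: "pen R A \<in> Pen" "pen R A' \<in> Pen" using Pen_I btw_distinct assms by metis+
  have "pen R A = pen R A'" using h on_rim[OF P(1)] on_rim[OF P(2)] unfolding ray_end_def by auto
  thus False using pen_opp[OF l assms] Pen_pair P(1) by metis
qed

lemma line_ends:
  obtains X Y where "X \<in> \<Omega>" "Y \<in> \<Omega>" "X \<noteq> Y" "onr X l" "onr Y l" "\<And>Z. \<lbrakk>Z \<in> \<Omega>; onr Z l\<rbrakk> \<Longrightarrow> Z = X \<or> Z = Y"
proof -
  obtain R A A' where l: "inc R l" "inc A l" "inc A' l" "btw A R A'" using Pen_ends .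
  have ne: "R \<noteq> A" "R \<noteq> A'" using l btw_distinct by blast+
  have "Z = ray_end R A \<or> Z = ray_end R A'" if "Z \<in> \<Omega>" "onr Z l" for Z
    using that Pen_two[OF _ _ l] rim_cases unfolding ray_end_def by metis
  moreover have "ln R A = l" "ln R A' = l" using ln_eq ne l by metis+
  ultimately show ?thesis using that ray_end[OF ne(1)] ray_end[OF ne(2)] ray_end_opp[OF l(4)] by metis
qed

text \<open>\<open>pr P X\<close> is \<open>X\<^sup>P\<close>.\<close>

abbreviation pr :: "'p \<Rightarrow> 'l rimpoint \<Rightarrow> 'l rimpoint" where "pr P X \<equiv> other inc X P"

lemma pr: assumes "X \<in> \<Omega>" shows "pr P X \<in> \<Omega>" "pr P X \<noteq> X" "onr (pr P X) (jp X P)"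
proof -
  obtain U V where U: "U \<in> \<Omega>" "V \<in> \<Omega>" "U \<noteq> V" "onr U (jp X P)" "onr V (jp X P)"
    "\<And>Z. \<lbrakk>Z \<in> \<Omega>; onr Z (jp X P)\<rbrakk> \<Longrightarrow> Z = U \<or> Z = V"
    by (rule line_ends[of "jp X P"]) (rule that)
  have "\<exists>!Y. Y \<in> \<Omega> \<and> Y \<noteq> X \<and> onr Y (jp X P)" using U(6)[OF assms jp(1)[OF assms]] U by metis
  from theI'[OF this] show "pr P X \<in> \<Omega>" "pr P X \<noteq> X" "onr (pr P X) (jp X P)" unfolding other_def by auto
qed

lemma onr_two: "\<lbrakk>X \<in> \<Omega>; Y \<in> \<Omega>; Z \<in> \<Omega>; onr X l; onr Y l; onr Z l; X \<noteq> Y\<rbrakk> \<Longrightarrow> Z = X \<or> Z = Y"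
  using line_ends[of l] by metis

lemma onr_third: "\<lbrakk>X \<in> \<Omega>; Y \<in> \<Omega>; Z \<in> \<Omega>; X \<noteq> Y; X \<noteq> Z; Y \<noteq> Z; onr X l; onr Y l\<rbrakk> \<Longrightarrow> \<not> onr Z l"
  using onr_two by blast

lemma pr_eq: assumes "X \<in> \<Omega>" "Y \<in> \<Omega>" "X \<noteq> Y" "onr X l" "onr Y l" "inc P l" shows "pr P X = Y"
  using onr_two[of X Y "pr P X" l] pr[OF assms(1)] jp_eq[OF assms(1,4,6)] assms by metis

lemma pr_pr: "X \<in> \<Omega> \<Longrightarrow> pr P (pr P X) = X"
  using pr_eq[of "pr P X" X "jp X P" P] pr[of X P] jp[of X P] by metis

lemma jr_pr: "X \<in> \<Omega> \<Longrightarrow> jr X (pr P X) = jp X P"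
  using jr_eq pr jp by metis

lemma pr_iff: "\<lbrakk>X \<in> \<Omega>; Y \<in> \<Omega>; X \<noteq> Y\<rbrakk> \<Longrightarrow> pr P X = Y \<longleftrightarrow> inc P (jr X Y)"
  using pr_eq jr jr_pr jp by metis

text \<open>The side of \<open>l\<close> on which a rimpoint lies: all lines of its pencil that avoid \<open>l\<close> are on the
  same side of \<open>l\<close>.\<close>

definition rs :: "'l \<Rightarrow> 'l rimpoint \<Rightarrow> 'p \<Rightarrow> bool" where
  "rs l X P \<longleftrightarrow> (\<exists>c Q. onr X c \<and> dj c l \<and> inc Q c \<and> SS l Q P)"

lemma rsI: "\<lbrakk>onr X c; dj c l; inc P c\<rbrakk> \<Longrightarrow> rs l X P"
  unfolding rs_def using SS_refl djD by metis

lemma rs_cong: "rs l X P \<Longrightarrow> SS l P Q \<Longrightarrow> rs l X Q"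
  unfolding rs_def using SS_trans by blast

lemma rs_ex: assumes "X \<in> \<Omega>" "\<not> onr X l" shows "\<exists>P. rs l X P"
proof -
  obtain E where E: "E \<in> \<Omega>" "onr E l" using line_ends by metis
  hence "X \<noteq> E" using assms by blast
  hence c: "onr X (jr X E)" "onr E (jr X E)" using jr assms E by blast+
  have "dj (jr X E) l" using onr_dj[OF E(1) c(2) E(2)] c assms by blast
  thus ?thesis using rsI[OF c(1)] ex_pt by blast
qed

lemma rs_unique: assumes "X \<in> \<Omega>" "\<not> onr X l" "rs l X P" "rs l X Q" shows "SS l P Q"
proof -
  obtain c P' where c: "onr X c" "dj c l" "inc P' c" "SS l P' P" using assms(3) rs_def by auto
  obtain d Q' where d: "onr X d" "dj d l" "inc Q' d" "SS l Q' Q" using assms(4) rs_def by auto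
  obtain Z where Z: "Z \<in> Pen" "\<And>l. onr X l \<longleftrightarrow> l \<in> Z" using rim_cases assms by metis
  have "SS l P' Q'" using Pen_between[of Z c d l P' Q'] Z c d dj_sym assms(2) by blast
  thus ?thesis using c d SS_sym SS_trans by blast
qed

lemma rs_off: "rs l X P \<Longrightarrow> \<not> inc P l"
  unfolding rs_def using SS_off by blast

text \<open>Let \<open>c\<close> be a line of the pencil that avoids \<open>k\<close>. A line
  through \<open>Q\<close> avoiding \<open>k\<close> meets \<open>c\<close> or the segment from
  \<open>P\<close> to a point of \<open>c\<close>, by the definition of parallel rays; either way
  \<open>Q\<close> and \<open>c\<close> are on one side.\<close>

lemma rs_end:
  assumes P: "inc P k" "\<not> inc Q k"
  shows "rs k (ray_end P Q) Q"
proof -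
  have PQ: "P \<noteq> Q" using P by blast
  obtain l where l: "inc P l" "inc Q l" using ln_inc PQ by blast
  have Z: "pen P Q \<in> Pen" using Pen_I PQ by blast
  have onX: "onr (ray_end P Q) c \<longleftrightarrow> c \<in> pen P Q" for c using on_rim Z unfolding ray_end_def by blast
  have X: "ray_end P Q \<in> \<Omega>" using ray_end PQ by blast
  have lZ: "l \<in> pen P Q" using pen_self[OF l PQ] .
  have kl: "k \<noteq> l" using P l by blast
  have kZ: "k \<notin> pen P Q" using Pen_dj[OF Z _ lZ kl] P(1) l(1) djD by blast
  then obtain S0 where "rs k (ray_end P Q) S0" using rs_ex[OF X] onX by blast
  then obtain c S where c: "onr (ray_end P Q) c" "dj c k" "inc S c" unfolding rs_def by blast
  have cl: "c \<noteq> l" using c l P djD by blast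
  obtain B where B: "inc B c" "asy P Q S B" using Pen_asy[OF Z _ l PQ _ cl c(3)] onX c by blast
  have pr: "parallel_rays inc S B P Q" using asy_iff B by blast
  have Sk: "\<not> inc S k" using c djD by blast
  obtain g where g: "inc Q g" "dj g k" using avoider P by metis
  have "\<not> btw Q P Q" using btw_distinct by blast
  then obtain Y where Y: "inc Y g" "inc Y c \<or> Y = S \<or> Y = P \<or> btw S Y P"
    using parallel_rays_hits[OF pr l c(3) B(1) g(1) l(2)] by blast
  have Yk: "\<not> inc Y k" using Y g djD by blast
  have "SS k S Y"
  proof (cases "inc Y c")
    case True thus ?thesis using SS_line c by blast
  next
    case False
    hence b: "btw S Y P" using Y c P(1) g djD by blast
    then obtain s where s: "inc S s" "inc Y s" "inc P s" using btw_col by blast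
    show ?thesis using SS_ray[OF P(1) Sk Yk s(3,1,2)] b btw_excl by blast
  qed
  moreover have "SS k Y Q" using SS_line Y g by blast
  ultimately show ?thesis using rs_cong[OF rsI[OF c(1,2,3)]] SS_trans by blast
qed

section \<open>Sides of a line and crossing of chords\<close>

definition SR :: "'l \<Rightarrow> 'l rimpoint \<Rightarrow> 'l rimpoint \<Rightarrow> bool" where
  "SR l X Y \<longleftrightarrow> (\<exists>P. rs l X P \<and> rs l Y P)"

lemma SR_sym: "SR l X Y \<longleftrightarrow> SR l Y X"
  unfolding SR_def by blast

lemma SR_iff:
  assumes "X \<in> \<Omega>" "\<not> onr X l" "Y \<in> \<Omega>" "\<not> onr Y l" "rs l X P" "rs l Y Q"
  shows "SR l X Y \<longleftrightarrow> SS l P Q"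
  using assms rs_cong rs_unique SS_sym SS_trans unfolding SR_def by metis

lemma SR_xor:
  assumes "X \<in> \<Omega>" "\<not> onr X l" "Y \<in> \<Omega>" "\<not> onr Y l" "Z \<in> \<Omega>" "\<not> onr Z l"
  shows "SR l X Z \<longleftrightarrow> (SR l X Y \<longleftrightarrow> SR l Y Z)"
proof -
  obtain P Q R where P: "rs l X P" "rs l Y Q" "rs l Z R" using rs_ex assms by metis
  have "SR l X Z \<longleftrightarrow> SS l P R" "SR l X Y \<longleftrightarrow> SS l P Q" "SR l Y Z \<longleftrightarrow> SS l Q R"
    using SR_iff assms P by blast+
  moreover have "\<not> inc P l" "\<not> inc Q l" "\<not> inc R l" using P rs_off by blast+
  ultimately show ?thesis using opp_trans SS_trans SS_sym by metis
qed

abbreviation crs :: "'l rimpoint \<Rightarrow> 'l rimpoint \<Rightarrow> 'l rimpoint \<Rightarrow> 'l rimpoint \<Rightarrow> bool" where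
  "crs \<equiv> rim_cross inc"

lemma crs_I: "\<lbrakk>A \<noteq> B; C \<noteq> D; jr A B \<noteq> jr C D; inc P (jr A B); inc P (jr C D)\<rbrakk> \<Longrightarrow> crs A B C D"
  unfolding rim_cross_def rim_meet_def by blast

lemma crs_sym: "crs A B C D \<Longrightarrow> crs B A C D" "crs A B C D \<Longrightarrow> crs C D A B"
  unfolding rim_cross_def rim_meet_def using jr_sym by metis+

lemma crs_distinct: assumes "crs A B C D" "A \<in> \<Omega>" "B \<in> \<Omega>" "C \<in> \<Omega>" "D \<in> \<Omega>"
  shows "distinct [A, B, C, D]"
proof -
  obtain P where P: "A \<noteq> B" "C \<noteq> D" "jr A B \<noteq> jr C D" "inc P (jr A B)" "inc P (jr C D)"
    using assms(1) unfolding rim_cross_def rim_meet_def by auto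
  hence n: "\<not> dj (jr A B) (jr C D)" using not_dj by blast
  have j: "onr A (jr A B)" "onr B (jr A B)" "onr C (jr C D)" "onr D (jr C D)" using jr P assms by auto
  have "A \<noteq> C" "A \<noteq> D" "B \<noteq> C" "B \<noteq> D" using onr_dj n j P(3) assms by metis+
  thus ?thesis using P by auto
qed

lemma crs_iff:
  assumes O: "A \<in> \<Omega>" "B \<in> \<Omega>" "C \<in> \<Omega>" "D \<in> \<Omega>" and d: "distinct [A, B, C, D]"
  shows "crs A B C D \<longleftrightarrow> \<not> SR (jr A B) C D"
proof -
  define l c where "l = jr A B" and "c = jr C D"
  have l: "onr A l" "onr B l" using jr O d l_def by auto
  have c: "onr C c" "onr D c" using jr O d c_def by auto
  have off: "\<not> onr C l" "\<not> onr D l" using onr_two[OF O(1,2,3) l] onr_two[OF O(1,2,4) l] d by auto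
  have lc: "l \<noteq> c" using off c by auto
  show ?thesis
  proof (cases "dj c l")
    case True
    obtain Q where "inc Q c" using ex_pt by blast
    hence "SR l C D" unfolding SR_def using rsI True c by blast
    moreover have "\<not> crs A B C D" using True unfolding rim_cross_def rim_meet_def l_def c_def dj_def by blast
    ultimately show ?thesis unfolding l_def by blast
  next
    case False
    then obtain P where P: "inc P c" "inc P l" using not_dj by blast
    obtain Q where Q: "inc Q c" "Q \<noteq> P" "C = ray_end P Q" using ray_end_on[OF O(3) c(1) P(1)] .
    obtain R where R: "inc R c" "R \<noteq> P" "D = ray_end P R" using ray_end_on[OF O(4) c(2) P(1)] .
    have ql: "\<not> inc Q l" "\<not> inc R l" using uniq P Q R lc by metis+
    have "rs l C Q" "rs l D R" using rs_end P Q R ql by blast+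
    hence "SR l C D \<longleftrightarrow> SS l Q R" using SR_iff O off by blast
    moreover have "\<not> SS l Q R"
    proof
      assume "SS l Q R"
      hence "\<not> btw Q P R" using btw_not_SS P by blast
      hence "C = D" using pen_move_A[OF P(1) Q(1) R(1) Q(2) R(2)] Q R unfolding ray_end_def by simp
      thus False using d by simp
    qed
    moreover have "crs A B C D" using crs_I[of A B C D P] d lc P unfolding l_def c_def by auto
    ultimately show ?thesis unfolding l_def by blast
  qed
qed

text \<open>Seen from \<open>X\<close>, the three pairings belong to the three lines
  \<open>XY\<close>, \<open>XZ\<close>, \<open>XW\<close> of one pencil: \<open>crs X Y Z W\<close>
  means that \<open>XY\<close> separates the two others. One of the lines does so by
  \<open>Pen_three\<close>, and two of them cannot both be in the middle.\<close>

lemma crs_one: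
  assumes O: "X \<in> \<Omega>" "Y \<in> \<Omega>" "Z \<in> \<Omega>" "W \<in> \<Omega>" and d: "distinct [X, Y, Z, W]"
  shows "crs X Y Z W \<or> crs X Z Y W \<or> crs X W Y Z" "\<not> (crs X Y Z W \<and> crs X Z Y W)"
    "\<not> (crs X Y Z W \<and> crs X W Y Z)" "\<not> (crs X Z Y W \<and> crs X W Y Z)"
proof -
  have ex: "\<exists>a. onr X a \<and> onr A a \<and> a = jr X A" if "A \<in> \<Omega>" "A \<noteq> X" for A using jr that O by metis
  obtain y z w where l: "onr X y" "onr Y y" "y = jr X Y" "onr X z" "onr Z z" "z = jr X Z"
    "onr X w" "onr W w" "w = jr X W" using ex O d by (metis distinct_length_2_or_more)
  have nO: "X \<noteq> Y" "X \<noteq> Z" "X \<noteq> W" "Y \<noteq> Z" "Y \<noteq> W" "Z \<noteq> W" using d by auto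
  note nO = nO nO[symmetric]
  have off: "\<not> onr Z y" "\<not> onr W y" "\<not> onr Y z" "\<not> onr W z" "\<not> onr Y w" "\<not> onr Z w"
    using onr_third[OF O(1,2,3) _ _ _ l(1,2)] onr_third[OF O(1,2,4) _ _ _ l(1,2)]
      onr_third[OF O(1,3,2) _ _ _ l(4,5)] onr_third[OF O(1,3,4) _ _ _ l(4,5)]
      onr_third[OF O(1,4,2) _ _ _ l(7,8)] onr_third[OF O(1,4,3) _ _ _ l(7,8)] nO by blast+
  have ne: "y \<noteq> z" "y \<noteq> w" "z \<noteq> w"
    using off l by auto
  have dd: "dj y z" "dj y w" "dj z w" using onr_dj O l ne by blast+
  obtain P Q R where P: "inc P y" "inc Q z" "inc R w" using ex_pt by metis
  have D: "distinct [X, Z, Y, W]" "distinct [X, W, Y, Z]" using d by auto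
  have "crs X Y Z W \<longleftrightarrow> \<not> SR y Z W" using crs_iff[OF O d] l by simp
  moreover have "SR y Z W \<longleftrightarrow> SS y Q R" using SR_iff[OF O(3) off(1) O(4) off(2)] rsI l P dd dj_sym by metis
  ultimately have 1: "crs X Y Z W \<longleftrightarrow> \<not> SS y Q R" by blast
  have "crs X Z Y W \<longleftrightarrow> \<not> SR z Y W" using crs_iff[OF O(1,3,2,4) D(1)] l by simp
  moreover have "SR z Y W \<longleftrightarrow> SS z P R" using SR_iff[OF O(2) off(3) O(4) off(4)] rsI l P dd dj_sym by metis
  ultimately have 2: "crs X Z Y W \<longleftrightarrow> \<not> SS z P R" by blast
  have "crs X W Y Z \<longleftrightarrow> \<not> SR w Y Z" using crs_iff[OF O(1,4,2,3) D(2)] l by simp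
  moreover have "SR w Y Z \<longleftrightarrow> SS w P Q" using SR_iff[OF O(2) off(5) O(3) off(6)] rsI l P dd dj_sym by metis
  ultimately have 3: "crs X W Y Z \<longleftrightarrow> \<not> SS w P Q" by blast
  obtain V where V: "V \<in> Pen" "\<And>l. onr X l \<longleftrightarrow> l \<in> V" using rim_cases O by metis
  have "\<not> SS y Q R \<or> \<not> SS z P R \<or> \<not> SS w P Q" using Pen_three[OF V(1) _ _ _ ne(1,3,2) P] V l by blast
  thus "crs X Y Z W \<or> crs X Z Y W \<or> crs X W Y Z" using 1 2 3 by blast
  have *: False if h: "\<not> SS a Q R" "\<not> SS b P R" and P: "inc P a" "inc Q b" "inc R c" and dd: "dj a b" "dj a c" "dj b c"
    for a b c P Q R
  proof -
    obtain B where B: "inc B a" "btw Q B R" using not_SS_btw P dd djD h(1) by metis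
    obtain t where t: "inc Q t" "inc B t" "inc R t" using btw_col B by blast
    have "SS b P B" using SS_line P B dd by blast
    hence "\<not> SS b B R" using h SS_trans by blast
    moreover have "\<not> inc B b" "\<not> inc R b" using dd B P djD by blast+
    ultimately obtain C where C: "inc C b" "btw B C R" using not_SS_btw by blast
    have "inc C t" using btw_on(1) C t by blast
    moreover have "t \<noteq> b" using t B dd djD by blast
    ultimately have "C = Q" using uniq C t P by metis
    thus False using C B btw_excl btw_sym by blast
  qed
  show "\<not> (crs X Y Z W \<and> crs X Z Y W)" "\<not> (crs X Y Z W \<and> crs X W Y Z)" "\<not> (crs X Z Y W \<and> crs X W Y Z)"
    using *[of y Q R z P w] *[of y R Q w P z] *[of z R P w Q y] 1 2 3 P dd dj_sym SS_sym by blast+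
qed

lemma crs_xor:
  assumes O: "A \<in> \<Omega>" "B \<in> \<Omega>" "C \<in> \<Omega>" "D \<in> \<Omega>" "E \<in> \<Omega>" and d: "distinct [A, B, C, D, E]"
  shows "crs A B C E \<longleftrightarrow> (crs A B C D \<noteq> crs A B D E)"
proof -
  have l: "onr A (jr A B)" "onr B (jr A B)" using jr O d by auto
  have "\<not> onr C (jr A B)" "\<not> onr D (jr A B)" "\<not> onr E (jr A B)"
    using onr_third[OF O(1,2,3) _ _ _ l] onr_third[OF O(1,2,4) _ _ _ l] onr_third[OF O(1,2,5) _ _ _ l] d by auto
  hence "SR (jr A B) C E \<longleftrightarrow> (SR (jr A B) C D \<longleftrightarrow> SR (jr A B) D E)" using SR_xor O by blast
  thus ?thesis using crs_iff O d by auto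
qed

end

section \<open>Separation and cyclic order\<close>

text \<open>\<open>crs A B C D\<close>: on a circle, the points \<open>A\<close> and \<open>B\<close> separate \<open>C\<close> from \<open>D\<close>.\<close>

locale separation =
  fixes S :: "'a set" and crs :: "'a \<Rightarrow> 'a \<Rightarrow> 'a \<Rightarrow> 'a \<Rightarrow> bool"
  assumes sym1: "crs A B C D \<Longrightarrow> crs B A C D"
    and sym2: "crs A B C D \<Longrightarrow> crs C D A B"
    and dist: "\<lbrakk>crs A B C D; A \<in> S; B \<in> S; C \<in> S; D \<in> S\<rbrakk> \<Longrightarrow> distinct [A, B, C, D]"
    and ex: "\<lbrakk>A \<in> S; B \<in> S; C \<in> S; D \<in> S; distinct [A, B, C, D]\<rbrakk> \<Longrightarrow> crs A B C D \<or> crs A C B D \<or> crs A D B C"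
    and un: "\<lbrakk>A \<in> S; B \<in> S; C \<in> S; D \<in> S; crs A B C D\<rbrakk> \<Longrightarrow> \<not> crs A C B D"
    and xor: "\<lbrakk>A \<in> S; B \<in> S; C \<in> S; D \<in> S; E \<in> S; distinct [A, B, C, D, E]\<rbrakk>
      \<Longrightarrow> crs A B C E \<longleftrightarrow> (crs A B C D \<noteq> crs A B D E)"
begin

lemma syms: "crs A B C D \<longleftrightarrow> crs B A C D" "crs A B C D \<longleftrightarrow> crs A B D C" "crs A B C D \<longleftrightarrow> crs C D A B"
  using sym1 sym2 by blast+

lemma un2: "\<lbrakk>A \<in> S; B \<in> S; C \<in> S; D \<in> S; crs A B C D\<rbrakk> \<Longrightarrow> \<not> crs A D B C \<and> \<not> crs A C B D"
  using un[of A B C D] un[of A B D C] syms by blast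

lemma hexagon_aux:
  assumes S: "a \<in> S" "b \<in> S" "c \<in> S" "X \<in> S" "Y \<in> S" and d: "distinct [a, b, c, X, Y]"
    and h: "crs a b X Y" "crs b c X Y" "\<not> crs a b X c"
  shows "crs Y c a X"
proof -
  have "crs a b c Y" using xor[of a b X c Y] S d h by auto
  hence 1: "crs Y c a b" using syms by blast
  have "\<not> crs Y c b X" using un2[of X Y b c] h(2) S syms by blast
  thus ?thesis using xor[of Y c a b X] S d 1 by auto
qed

text \<open>Cut the circle at \<open>Y\<close>: then \<open>c\<close> is between \<open>a\<close>
  and \<open>X\<close>, and \<open>f\<close> between \<open>d\<close> and \<open>X\<close>, while
  \<open>d\<close> and \<open>f\<close> are on the other arc of \<open>X\<close>, \<open>Y\<close>
  than \<open>c\<close>. In Pascal's theorem this makes the third pair of opposite sides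
  meet.\<close>

lemma hexagon_crossing:
  assumes S: "a \<in> S" "c \<in> S" "d \<in> S" "f \<in> S" "X \<in> S" "Y \<in> S" and d: "distinct [a, c, d, f, X, Y]"
    and h: "crs Y c a X" "crs Y f d X" "crs X Y c d" "crs X Y c f"
  shows "crs c d a f"
proof -
  have "\<not> crs Y c X d" using un2[of X Y c d] h(3) S syms by blast
  hence "crs Y c a d" using xor[of Y c a X d] S d h by auto
  hence 1: "\<not> crs c d a Y" using un2[of Y c a d] S syms by blast
  have "\<not> crs Y f X c" using un2[of X Y c f] h(4) S syms by blast
  hence "crs Y f d c" using xor[of Y f d X c] S d h by auto
  hence 2: "crs c d Y f" using syms by blast
  show ?thesis using xor[of c d a Y f] S d 1 2 by auto
qed

text \<open>The circle is cut open at \<open>L\<close>. The point \<open>M\<close> divides the rest into two arcs, and the arc of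
  \<open>N\<close> comes first.\<close>

definition plus :: "'a \<Rightarrow> 'a \<Rightarrow> 'a \<Rightarrow> 'a \<Rightarrow> bool" where
  "plus L M N X \<longleftrightarrow> X = N \<or> \<not> crs L M N X"

definition prec :: "'a \<Rightarrow> 'a \<Rightarrow> 'a \<Rightarrow> 'a \<Rightarrow> 'a \<Rightarrow> bool" where
  "prec L M N X Y \<longleftrightarrow> X \<noteq> Y \<and> (if X = M then \<not> plus L M N Y else if Y = M then plus L M N X
     else if plus L M N X then plus L M N Y \<longrightarrow> crs L Y X M
     else \<not> plus L M N Y \<and> crs L X Y M)"

context
  fixes L M N
  assumes LMN: "L \<in> S" "M \<in> S" "N \<in> S" "distinct [L, M, N]"
begin

lemma plus_crs:
  assumes "X \<in> S" "Y \<in> S" "distinct [L, M, X, Y]"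
  shows "crs L M X Y \<longleftrightarrow> plus L M N X \<noteq> plus L M N Y"
proof (cases "X = N \<or> Y = N")
  case True
  thus ?thesis using assms syms unfolding plus_def by auto
next
  case False
  hence "crs L M X Y \<longleftrightarrow> (crs L M X N \<noteq> crs L M N Y)" using xor[of L M X N Y] assms LMN by auto
  thus ?thesis using False syms unfolding plus_def by blast
qed

lemma prec_total:
  assumes "X \<in> S" "Y \<in> S" "X \<noteq> L" "Y \<noteq> L" "X \<noteq> Y"
  shows "prec L M N X Y \<or> prec L M N Y X" "\<not> (prec L M N X Y \<and> prec L M N Y X)"
proof -
  have "crs L M X Y \<or> crs L X Y M \<or> crs L Y X M" if "X \<noteq> M" "Y \<noteq> M"
    using ex[of L M X Y] assms LMN that syms by auto
  moreover have "\<not> (crs L X Y M \<and> crs L Y X M)" using un[of L X Y M] assms LMN syms by blast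
  ultimately show "prec L M N X Y \<or> prec L M N Y X" "\<not> (prec L M N X Y \<and> prec L M N Y X)"
    using plus_crs[of X Y] assms LMN unfolding prec_def by auto
qed

lemma prec_crs:
  assumes "X \<in> S" "Y \<in> S" "Z \<in> S" "X \<noteq> L" "Y \<noteq> L" "Z \<noteq> L" and h: "prec L M N X Y" "prec L M N Y Z"
  shows "crs L Y X Z"
proof -
  have ne: "X \<noteq> Y" "Y \<noteq> Z" using h prec_def by auto
  have XZ: "X \<noteq> Z" using h prec_total(2)[of X Y] assms ne by blast
  consider "X = M" | "Y = M" | "Z = M" | "X \<noteq> M" "Y \<noteq> M" "Z \<noteq> M" by blast
  thus ?thesis
  proof cases
    case 1 thus ?thesis using h ne XZ syms unfolding prec_def by (auto split: if_splits)
  next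
    case 2 thus ?thesis using h ne XZ plus_crs[of X Z] assms LMN unfolding prec_def by (auto split: if_splits)
  next
    case 3 thus ?thesis using h ne XZ syms unfolding prec_def by (auto split: if_splits)
  next
    case 4
    have x: "crs L Y X Z \<longleftrightarrow> crs L Y X M \<noteq> crs L Y M Z" using xor[of L Y X M Z] assms LMN 4 ne XZ by auto
    have u: "crs L Z Y M \<Longrightarrow> \<not> crs L Y M Z" "crs L X Y M \<Longrightarrow> \<not> crs L Y X M" "crs L M Y Z \<Longrightarrow> \<not> crs L Y M Z"
      "crs L M X Y \<Longrightarrow> \<not> crs L Y X M"
      using un2[of L Z Y M] un2[of L X Y M] un2[of L M Y Z] un2[of L M X Y] assms LMN syms by blast+
    have p: "crs L M Y Z \<longleftrightarrow> plus L M N Y \<noteq> plus L M N Z" "crs L M X Y \<longleftrightarrow> plus L M N X \<noteq> plus L M N Y"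
      using plus_crs[of Y Z] plus_crs[of X Y] assms LMN 4 ne by auto
    show ?thesis using h 4 x u p syms unfolding prec_def by (auto split: if_splits)
  qed
qed

lemma prec_trans:
  assumes "X \<in> S" "Y \<in> S" "Z \<in> S" "X \<noteq> L" "Y \<noteq> L" "Z \<noteq> L" and h: "prec L M N X Y" "prec L M N Y Z"
  shows "prec L M N X Z"
proof (rule ccontr)
  assume n: "\<not> prec L M N X Z"
  have ne: "X \<noteq> Y" "Y \<noteq> Z" using h prec_def by auto
  have XZ: "X \<noteq> Z" using h prec_total(2)[of X Y] assms ne by blast
  hence "prec L M N Z X" using prec_total(1)[of X Z] n assms by blast
  hence "crs L X Z Y" using prec_crs[of Z X Y] assms by blast
  moreover have "crs L Y X Z" using prec_crs assms by blast
  ultimately show False using un2[of L Y X Z] assms LMN syms by blast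
qed

text \<open>\<open>L\<close> is put first, which extends \<open>prec\<close> to the whole
  circle.\<close>

definition lt :: "'a \<Rightarrow> 'a \<Rightarrow> bool" where
  "lt X Y \<longleftrightarrow> (if X = L then Y \<noteq> L else Y \<noteq> L \<and> prec L M N X Y)"

lemma lt_total: "\<lbrakk>X \<in> S; Y \<in> S; X \<noteq> Y\<rbrakk> \<Longrightarrow> lt X Y \<or> lt Y X"
  using prec_total(1)[of X Y] unfolding lt_def by auto

lemma lt_asym: "\<lbrakk>X \<in> S; Y \<in> S; lt X Y\<rbrakk> \<Longrightarrow> \<not> lt Y X"
  using prec_total(2)[of X Y] unfolding lt_def prec_def by (auto split: if_splits)

lemma lt_trans: "\<lbrakk>X \<in> S; Y \<in> S; Z \<in> S; lt X Y; lt Y Z\<rbrakk> \<Longrightarrow> lt X Z"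
  using prec_trans[of X Y Z] unfolding lt_def by (auto split: if_splits)

lemma lt_crs:
  assumes S: "a \<in> S" "b \<in> S" "c \<in> S" "d \<in> S" and h: "lt a b" "lt b c" "lt c d"
  shows "crs a c b d"
proof -
  have t: "lt a c" "lt b d" "lt a d" using lt_trans h S by metis+
  have ne: "a \<noteq> b" "a \<noteq> c" "a \<noteq> d" "b \<noteq> c" "b \<noteq> d" "c \<noteq> d" using h t lt_asym S by blast+
  have L3: "crs L y x z" if "x \<in> S" "y \<in> S" "z \<in> S" "lt x y" "lt y z" "x \<noteq> L" for x y z
    using prec_crs[of x y z] that unfolding lt_def by (auto split: if_splits)
  have nL: "b \<noteq> L" "c \<noteq> L" "d \<noteq> L" using h unfolding lt_def by (auto split: if_splits)
  show ?thesis
  proof (cases "a = L")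
    case True thus ?thesis using L3[of b c d] S h nL by simp
  next
    case False
    have 1: "crs L c b d" using L3[of b c d] S h nL by blast
    have 2: "crs L b a d" using L3[of a b d] S h t False by blast
    have "\<not> crs b d L a" using un2[of L b a d] 2 S LMN syms by blast
    moreover have "crs b d L c" using 1 syms by blast
    ultimately have "crs b d a c" using xor[of b d L a c] S LMN ne nL False by auto
    thus ?thesis using syms by blast
  qed
qed

definition cyc :: "'a \<Rightarrow> 'a \<Rightarrow> 'a \<Rightarrow> bool" where
  "cyc x y z \<longleftrightarrow> (lt x y \<and> lt y z) \<or> (lt y z \<and> lt z x) \<or> (lt z x \<and> lt x y)"

lemma cyc_order: "cyclic_order_on S cyc"
  unfolding cyclic_order_on_def
proof (intro conjI ballI impI)
  fix x y z assume S: "x \<in> S" "y \<in> S" "z \<in> S"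
  show "cyc y z x" if "cyc x y z" using that unfolding cyc_def by blast
  show "\<not> cyc z y x" if "cyc x y z" using that lt_asym S unfolding cyc_def by blast
  show "cyc x y z \<or> cyc z y x" if "distinct [x, y, z]"
  proof -
    have "lt x y \<or> lt y x" "lt y z \<or> lt z y" "lt x z \<or> lt z x" using lt_total S that by auto
    moreover have "lt x y \<Longrightarrow> lt y z \<Longrightarrow> lt x z" "lt z y \<Longrightarrow> lt y x \<Longrightarrow> lt z x" using lt_trans S by blast+
    ultimately show ?thesis unfolding cyc_def using lt_asym S by blast
  qed
  fix w assume "w \<in> S"
  \<comment> \<open>With every instance on the four points supplied, the claim is
    propositional.\<close>
  note t = lt_trans[of x y z] lt_trans[of x z y] lt_trans[of y x z] lt_trans[of y z x] lt_trans[of z x y] lt_trans[of z y x]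
    lt_trans[of x y w] lt_trans[of x w y] lt_trans[of y x w] lt_trans[of y w x] lt_trans[of w x y] lt_trans[of w y x]
    lt_trans[of x z w] lt_trans[of x w z] lt_trans[of z x w] lt_trans[of z w x] lt_trans[of w x z] lt_trans[of w z x]
    lt_trans[of y z w] lt_trans[of y w z] lt_trans[of z y w] lt_trans[of z w y] lt_trans[of w y z] lt_trans[of w z y]
  note a = lt_asym[of x y] lt_asym[of x z] lt_asym[of y z] lt_asym[of x w] lt_asym[of y w] lt_asym[of z w]
  show "cyc x y w" if "cyc x y z \<and> cyc x z w"
    using that t a S \<open>w \<in> S\<close> unfolding cyc_def by argo
qed

text \<open>From right to left, rotate to an increasing quadruple. From left to right, if
  \<open>b\<close> and \<open>d\<close> were on the same arc of \<open>a\<close>, \<open>c\<close>,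
  then either order of \<open>b\<close> and \<open>d\<close> would give a second crossing
  pairing.\<close>

lemma cyc_crs:
  assumes S: "a \<in> S" "b \<in> S" "c \<in> S" "d \<in> S"
  shows "crs a c b d \<longleftrightarrow> (cyc a b c \<and> cyc c d a) \<or> (cyc a d c \<and> cyc c b a)"
proof -
  have *: "crs a c b d" if S: "a \<in> S" "b \<in> S" "c \<in> S" "d \<in> S" and h: "cyc a b c" "cyc c d a" for a b c d
  proof -
    have "(lt a b \<and> lt b c \<and> lt c d) \<or> (lt b c \<and> lt c d \<and> lt d a) \<or> (lt c d \<and> lt d a \<and> lt a b) \<or> (lt d a \<and> lt a b \<and> lt b c)"
      using h lt_asym[of a b] lt_asym[of b c] lt_asym[of c d] lt_asym[of d a] lt_asym[of a c] lt_trans[of a c d]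
        lt_trans[of a b c] lt_trans[of b c a] lt_trans[of c a b] lt_trans[of d a c] lt_trans[of c d a] S unfolding cyc_def by blast
    thus ?thesis using lt_crs[of a b c d] lt_crs[of b c d a] lt_crs[of c d a b] lt_crs[of d a b c] S syms by blast
  qed
  have r: "cyc y z x" if "cyc x y z" for x y z using that unfolding cyc_def by blast
  show ?thesis
  proof
    assume "(cyc a b c \<and> cyc c d a) \<or> (cyc a d c \<and> cyc c b a)"
    thus "crs a c b d" using *[OF S] *[OF S(1,4,3,2)] syms by blast
  next
    assume h: "crs a c b d"
    hence d: "distinct [a, c, b, d]" using dist S by blast
    have u: "\<not> crs a b c d" "\<not> crs a d c b" using un2[of a c b d] h S syms by blast+
    have t: "cyc x y z \<or> cyc z y x" if "x \<in> S" "y \<in> S" "z \<in> S" "distinct [x, y, z]" for x y z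
      using cyc_order that unfolding cyclic_order_on_def by blast
    have 1: "cyc a b c \<or> cyc c b a" "cyc a d c \<or> cyc c d a" "cyc a b d \<or> cyc d b a" "cyc c b d \<or> cyc d b c"
      using t S d by auto
    show "(cyc a b c \<and> cyc c d a) \<or> (cyc a d c \<and> cyc c b a)"
    proof (rule ccontr)
      assume n: "\<not> ?thesis"
      hence "(cyc a b c \<and> cyc a d c) \<or> (cyc c b a \<and> cyc c d a)" using 1 by blast
      thus False
      proof
        assume g: "cyc a b c \<and> cyc a d c"
        hence "cyc b c a" "cyc d c a" using r by blast+
        moreover have "cyc a b d \<or> cyc a d b" using 1(3) r by blast
        ultimately have "crs a d b c \<or> crs a b d c" using *[of a b d c] *[of a d b c] S by blast
        thus False using u syms by blast
      next
        assume g: "cyc c b a \<and> cyc c d a"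
        hence "cyc b a c" "cyc d a c" using r by blast+
        moreover have "cyc c b d \<or> cyc c d b" using 1(4) r by blast
        ultimately have "crs c d b a \<or> crs c b d a" using *[of c b d a] *[of c d b a] S by blast
        thus False using u syms by blast
      qed
    qed
  qed
qed

end

lemma ex_cyclic_order:
  assumes "L \<in> S" "M \<in> S" "N \<in> S" "distinct [L, M, N]"
  shows "\<exists>C. cyclic_order_on S C \<and> (\<forall>a\<in>S. \<forall>b\<in>S. \<forall>c\<in>S. \<forall>d\<in>S.
    crs a c b d \<longleftrightarrow> (C a b c \<and> C c d a) \<or> (C a d c \<and> C c b a))"
  using cyc_order[OF assms] cyc_crs[OF assms] by blast

end

section \<open>Maps preserving a compatible cyclic order\<close>

locale compatible = separation S crs for S :: "'a set" and crs +
  fixes C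
  assumes co: "cyclic_order_on S C"
    and comp: "\<lbrakk>a \<in> S; b \<in> S; c \<in> S; d \<in> S\<rbrakk> \<Longrightarrow> crs a c b d \<longleftrightarrow> (C a b c \<and> C c d a) \<or> (C a d c \<and> C c b a)"
begin

lemma C_rot: "\<lbrakk>x \<in> S; y \<in> S; z \<in> S; C x y z\<rbrakk> \<Longrightarrow> C y z x"
  using co unfolding cyclic_order_on_def by blast

lemma C_asym: "\<lbrakk>x \<in> S; y \<in> S; z \<in> S; C x y z\<rbrakk> \<Longrightarrow> \<not> C z y x"
  using co unfolding cyclic_order_on_def by blast

lemma C_asym2: "\<lbrakk>x \<in> S; y \<in> S; z \<in> S; C x y z\<rbrakk> \<Longrightarrow> \<not> C x z y"
  using C_asym C_rot by blast

lemma C_total: "\<lbrakk>x \<in> S; y \<in> S; z \<in> S; distinct [x, y, z]\<rbrakk> \<Longrightarrow> C x y z \<or> C x z y"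
  using co C_rot unfolding cyclic_order_on_def by blast

lemma C_trans: "\<lbrakk>x \<in> S; y \<in> S; z \<in> S; w \<in> S; C x y z; C x z w\<rbrakk> \<Longrightarrow> C x y w"
  using co unfolding cyclic_order_on_def by blast

lemma C_cut: "\<lbrakk>x \<in> S; a \<in> S; b \<in> S; c \<in> S; C x a b; C x b c\<rbrakk> \<Longrightarrow> C a b c"
  using C_trans[of b c x a] C_rot by blast

lemma C_distinct: "\<lbrakk>x \<in> S; y \<in> S; z \<in> S; C x y z\<rbrakk> \<Longrightarrow> distinct [x, y, z]"
  using C_asym[of x y z] C_asym[of y z x] C_asym[of z x y] C_rot[of x y z] C_rot[of y z x] by auto

lemma C_crs: "\<lbrakk>x \<in> S; a \<in> S; b \<in> S; c \<in> S; C x a b; C x b c\<rbrakk> \<Longrightarrow> crs x b a c"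
  using comp[of x a b c] C_rot by blast

lemma C_crs4:
  assumes "x \<in> S" "a \<in> S" "b \<in> S" "c \<in> S" "d \<in> S" "C x a b" "C x b c" "C x c d"
  shows "crs a c b d"
proof -
  have "C x b d" "C x a c" using C_trans assms by blast+
  hence "C a b c" "C a c d" using C_cut[of x a b c] C_cut[of x a c d] assms by blast+
  thus ?thesis using C_crs assms by blast
qed

text \<open>Meant for point reflections, whose chords all pass through one point. The pair
  \<open>x\<close>, \<open>p x\<close> exchanges its two arcs, and within an arc the separation of
  the pairs of \<open>y\<close> and \<open>z\<close> fixes the order of the images.\<close>

lemma involution_preserves:
  assumes p: "\<And>x. x \<in> S \<Longrightarrow> p x \<in> S" "\<And>x. x \<in> S \<Longrightarrow> p x \<noteq> x" "\<And>x. x \<in> S \<Longrightarrow> p (p x) = x"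
    and h: "\<And>x y. \<lbrakk>x \<in> S; y \<in> S; y \<noteq> x; y \<noteq> p x\<rbrakk> \<Longrightarrow> crs x (p x) y (p y)"
    and S: "x \<in> S" "y \<in> S" "z \<in> S" and c: "C x y z"
  shows "C (p x) (p y) (p z)"
proof -
  have d: "x \<noteq> y" "y \<noteq> z" "x \<noteq> z" using C_distinct[OF S c] by auto
  have split: "(C u v (p u) \<and> C u (p u) (p v)) \<or> (C u (p v) (p u) \<and> C u (p u) v)"
    if "u \<in> S" "v \<in> S" "v \<noteq> u" "v \<noteq> p u" for u v
  proof -
    have P: "p u \<in> S" "p v \<in> S" using p that by blast+
    have "C u (p u) w" if "C (p u) w u" "w \<in> S" for w
      using C_rot[of "p u" w u] C_rot[of w u "p u"] that \<open>u \<in> S\<close> P by blast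
    thus ?thesis using comp[of u v "p u" "p v"] h[OF that] P that by blast
  qed
  have two: "C (p u) u (p v)" if "u \<in> S" "v \<in> S" "C u (p u) v" for u v
  proof -
    have "v \<noteq> u" "v \<noteq> p u" using C_distinct[of u "p u" v] p that by auto
    hence "C u (p v) (p u)" using split[OF that(1,2)] C_asym2[of u "p u" v] that p by blast
    thus ?thesis using C_rot[of u "p v" "p u"] C_rot[of "p v" "p u" u] p that by blast
  qed
  have r: "C y z x" "C z x y" using C_rot S c by blast+
  consider "y = p x" | "z = p y" | "x = p z" | "y \<noteq> p x" "z \<noteq> p y" "x \<noteq> p z" by blast
  thus ?thesis
  proof cases
    case 1
    have "p y = x" using 1 p(3)[OF S(1)] by simp
    moreover have "C (p x) x (p z)" using two[OF S(1,3)] c 1 by simp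
    ultimately show ?thesis by simp
  next
    case 2
    have "p z = y" using 2 p(3)[OF S(2)] by simp
    moreover have "C (p y) y (p x)" using two[OF S(2,1)] r(1) 2 by simp
    ultimately have "C (p y) (p z) (p x)" by simp
    thus ?thesis using C_rot[of "p y" "p z" "p x"] C_rot[of "p z" "p x" "p y"] p S by blast
  next
    case 3
    have "p x = z" using 3 p(3)[OF S(3)] by simp
    moreover have "C (p z) z (p y)" using two[OF S(3,2)] r(2) 3 by simp
    ultimately have "C (p z) (p x) (p y)" by simp
    thus ?thesis using C_rot[of "p z" "p x" "p y"] C_rot[of "p x" "p y" "p z"] p S by blast
  next
    case 4
    have ne: "z \<noteq> p x" using 4(3) p(3)[OF S(1)] by auto
    have P: "p x \<in> S" "p y \<in> S" "p z \<in> S" using p S by blast+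
    have R: "C u v w \<Longrightarrow> C v w u" if "u \<in> S" "v \<in> S" "w \<in> S" for u v w using C_rot that by blast
    have pp: "p y \<noteq> p z" "p x \<noteq> p y" "p x \<noteq> p z" using d p(3)[OF S(1)] p(3)[OF S(2)] p(3)[OF S(3)] by auto
    have xy: "(C x y (p x) \<and> C x (p x) (p y)) \<or> (C x (p y) (p x) \<and> C x (p x) y)"
      using split[of x y] S 4 d by blast
    have xz: "(C x z (p x) \<and> C x (p x) (p z)) \<or> (C x (p z) (p x) \<and> C x (p x) z)"
      using split[of x z] S ne d by blast
    have yz: "crs y (p y) z (p z)" using h[of y z] S 4 d by blast
    have xp: "x \<noteq> p y" "x \<noteq> p z" using 4 p(3)[OF S(2)] by auto
    have tt: "C x (p y) (p z) \<or> C x (p z) (p y)" using C_total[OF S(1) P(2,3)] xp pp by auto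
    consider "C x y (p x)" "C x (p x) (p y)" "C x z (p x)" "C x (p x) (p z)"
      | "C x y (p x)" "C x (p x) (p y)" "C x (p z) (p x)" "C x (p x) z"
      | "C x (p y) (p x)" "C x (p x) y" "C x z (p x)" "C x (p x) (p z)"
      | "C x (p y) (p x)" "C x (p x) y" "C x (p z) (p x)" "C x (p x) z" using xy xz by blast
    thus ?thesis
    proof cases
      case 1
      have "\<not> C x (p z) (p y)"
      proof
        assume g: "C x (p z) (p y)"
        have "C x z (p z)" using C_trans[of x z "p x" "p z"] 1 S P by blast
        hence "crs y (p z) z (p y)" using C_crs4[of x y z "p z" "p y"] c g S P by blast
        thus False using un2[of y "p y" z "p z"] yz S P syms by blast
      qed
      hence "C x (p y) (p z)" using tt by blast
      thus ?thesis using C_cut[of x "p x" "p y" "p z"] 1 S P by blast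
    next
      case 2
      have "C (p z) (p x) (p y)" using C_cut[of x "p z" "p x" "p y"] 2 S P by blast
      thus ?thesis using R P by blast
    next
      case 3
      have "C x z y" using C_trans[of x z "p x" y] 3 S P by blast
      thus ?thesis using C_asym2 c S by blast
    next
      case 4
      have "\<not> C x (p z) (p y)"
      proof
        assume g: "C x (p z) (p y)"
        have "C x (p y) y" using C_trans[of x "p y" "p x" y] 4 S P by blast
        hence "crs (p z) y (p y) z" using C_crs4[of x "p z" "p y" y z] c g S P by blast
        thus False using un2[of y "p y" z "p z"] yz S P syms by blast
      qed
      hence "C x (p y) (p z)" using tt by blast
      hence "C (p y) (p z) (p x)" using C_cut[of x "p y" "p z" "p x"] 4 S P by blast
      thus ?thesis using R P by blast
    qed
  qed
qed

lemma crs_sides: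
  assumes "L \<in> S" "M \<in> S" "x \<in> S" "y \<in> S"
  shows "crs L M x y \<longleftrightarrow> (C L x M \<and> C L M y) \<or> (C L y M \<and> C L M x)"
  using comp[of L x M y] C_rot assms by blast

text \<open>The order is preserved and \<open>L\<close>, \<open>M\<close> are fixed, so each of the
  two arcs is mapped into itself.\<close>

lemma axial_side:
  assumes L: "L \<in> S" "M \<in> S" and a: "\<And>x. x \<in> S \<Longrightarrow> \<alpha> x \<in> S"
    and pres: "\<And>x y z. \<lbrakk>x \<in> S; y \<in> S; z \<in> S; C x y z\<rbrakk> \<Longrightarrow> C (\<alpha> x) (\<alpha> y) (\<alpha> z)"
    and fx: "\<alpha> L = L" "\<alpha> M = M" and x: "x \<in> S"
  shows "\<not> crs L M x (\<alpha> x)"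
proof
  assume "crs L M x (\<alpha> x)"
  hence "(C L x M \<and> C L M (\<alpha> x)) \<or> (C L (\<alpha> x) M \<and> C L M x)" using crs_sides L x a by blast
  moreover have "C L x M \<Longrightarrow> C L (\<alpha> x) M" "C L M x \<Longrightarrow> C L M (\<alpha> x)"
    using pres[of L x M] pres[of L M x] fx L x by auto
  ultimately show False using C_asym2[of L "\<alpha> x" M] C_asym2[of L M "\<alpha> x"] a L x by blast
qed

text \<open>Cut at \<open>L\<close>, the map moves each point off the axis up or down. By
  \<open>same\<close>, points of one arc move the same way, and for points of different arcs the two
  chords cross exactly when they move in different ways. One crossing pair is given, so the arcs
  move in different ways and all such pairs cross.\<close>

lemma axial_crossing:
  assumes L: "L \<in> S" "M \<in> S" "L \<noteq> M" and a: "\<And>x. x \<in> S \<Longrightarrow> \<alpha> x \<in> S"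
    and inj: "\<And>x y. \<lbrakk>x \<in> S; y \<in> S; \<alpha> x = \<alpha> y\<rbrakk> \<Longrightarrow> x = y"
    and pres: "\<And>x y z. \<lbrakk>x \<in> S; y \<in> S; z \<in> S; C x y z\<rbrakk> \<Longrightarrow> C (\<alpha> x) (\<alpha> y) (\<alpha> z)"
    and fx: "\<alpha> L = L" "\<alpha> M = M" and nfix: "\<And>x. \<lbrakk>x \<in> S; x \<noteq> L; x \<noteq> M\<rbrakk> \<Longrightarrow> \<alpha> x \<noteq> x"
    and same: "\<And>x y. \<lbrakk>x \<in> S; y \<in> S; x \<noteq> L; x \<noteq> M; y \<noteq> L; y \<noteq> M; \<not> crs L M x y\<rbrakk> \<Longrightarrow> \<not> crs x (\<alpha> y) y (\<alpha> x)"
    and ex0: "x0 \<in> S" "y0 \<in> S" "crs x0 (\<alpha> y0) y0 (\<alpha> x0)"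
    and S: "x \<in> S" "y \<in> S" and h: "crs L M x y"
  shows "crs x (\<alpha> y) y (\<alpha> x)"
proof -
  note opp = crs_sides[OF L(1,2)]
  have img: "C L x M \<Longrightarrow> C L (\<alpha> x) M" "C L M x \<Longrightarrow> C L M (\<alpha> x)" if "x \<in> S" for x
    using pres[of L x M] pres[of L M x] fx L that by auto
  define up where "up x \<longleftrightarrow> C L x (\<alpha> x)" for x
  have nup: "C L (\<alpha> x) x" if "x \<in> S" "x \<noteq> L" "x \<noteq> M" "\<not> up x" for x
    using C_total[of L x "\<alpha> x"] nfix[OF that(1-3)] inj[of x L] fx a L that unfolding up_def by auto
  have same_up: "up x \<Longrightarrow> up y" if S: "x \<in> S" "y \<in> S" "x \<noteq> L" "x \<noteq> M" "y \<noteq> L" "y \<noteq> M" and n: "\<not> crs L M x y" for x y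
  proof (rule ccontr)
    assume u: "up x" "\<not> up y"
    have 1: "C L x (\<alpha> x)" "C L (\<alpha> y) y" using u nup S up_def by auto
    have "x \<noteq> y" using u by auto
    hence "C L x y \<or> C L y x" using C_total[of L x y] S L by auto
    thus False
    proof
      assume g: "C L x y"
      hence "C L (\<alpha> x) (\<alpha> y)" using pres[of L x y] fx L S by auto
      hence "crs x (\<alpha> y) (\<alpha> x) y" using C_crs4[of L x "\<alpha> x" "\<alpha> y" y] 1 S a L by blast
      thus False using same[OF S n] syms by blast
    next
      assume g: "C L y x"
      hence "crs (\<alpha> y) x y (\<alpha> x)" using C_crs4[of L "\<alpha> y" y x "\<alpha> x"] 1 S a L by blast
      thus False using same[OF S n] syms by blast
    qed
  qed
  have opp_up: "crs x (\<alpha> y) y (\<alpha> x) \<longleftrightarrow> up x \<noteq> up y" if S: "x \<in> S" "y \<in> S" and h: "C L x M" "C L M y" for x y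
  proof -
    have S': "\<alpha> x \<in> S" "\<alpha> y \<in> S" using S a by blast+
    have ne: "x \<noteq> L" "x \<noteq> M" "y \<noteq> L" "y \<noteq> M"
      using C_distinct[of L x M] C_distinct[of L M y] S L h by auto
    have h': "C L (\<alpha> x) M" "C L M (\<alpha> y)" using img S h by blast+
    have lt: "C L x y" "C L (\<alpha> x) y" "C L x (\<alpha> y)" "C L (\<alpha> x) (\<alpha> y)"
      using C_trans[of L _ M] S S' L h h' by blast+
    consider "up x" "up y" | "up x" "\<not> up y" | "\<not> up x" "up y" | "\<not> up x" "\<not> up y" by blast
    thus ?thesis
    proof cases
      case 1
      hence "crs x y (\<alpha> x) (\<alpha> y)" using C_crs4[of L x "\<alpha> x" y "\<alpha> y"] lt S S' L up_def by blast
      thus ?thesis using un2[of x y "\<alpha> x" "\<alpha> y"] 1 S S' by blast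
    next
      case 2
      hence "crs x (\<alpha> y) (\<alpha> x) y" using C_crs4[of L x "\<alpha> x" "\<alpha> y" y] lt nup[of y] ne S S' L up_def by blast
      thus ?thesis using 2 syms by blast
    next
      case 3
      hence "crs (\<alpha> x) y x (\<alpha> y)" using C_crs4[of L "\<alpha> x" x y "\<alpha> y"] lt nup[of x] ne S S' L up_def by blast
      thus ?thesis using 3 syms by blast
    next
      case 4
      hence "crs (\<alpha> x) (\<alpha> y) x y" using C_crs4[of L "\<alpha> x" x "\<alpha> y" y] lt nup ne S S' L by blast
      hence "crs x y (\<alpha> x) (\<alpha> y)" using syms by blast
      thus ?thesis using un2[of x y "\<alpha> x" "\<alpha> y"] 4 S S' by blast
    qed
  qed
  have opp_up2: "crs x (\<alpha> y) y (\<alpha> x) \<longleftrightarrow> up x \<noteq> up y" if S: "x \<in> S" "y \<in> S" and h: "crs L M x y" for x y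
  proof -
    have "crs x (\<alpha> y) y (\<alpha> x) \<longleftrightarrow> crs y (\<alpha> x) x (\<alpha> y)" using sym2 by blast
    moreover have "(C L x M \<and> C L M y) \<or> (C L y M \<and> C L M x)" using h opp[OF S] by blast
    ultimately show ?thesis using opp_up[OF S] opp_up[OF S(2,1)] by auto
  qed
  have "distinct [x0, \<alpha> y0, y0, \<alpha> x0]" using dist[OF ex0(3)] ex0 a by blast
  hence n0: "x0 \<noteq> L" "x0 \<noteq> M" "y0 \<noteq> L" "y0 \<noteq> M" using fx by auto
  hence o0: "crs L M x0 y0" using same ex0 by blast
  hence u0: "up x0 \<noteq> up y0" using opp_up2 ex0 by blast
  have "distinct [L, M, x, y]" using dist[OF h] L S by blast
  hence ne: "x \<noteq> L" "x \<noteq> M" "y \<noteq> L" "y \<noteq> M" by auto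
  have *: "up u \<longleftrightarrow> up v" if "u \<in> S" "v \<in> S" "u \<noteq> L" "u \<noteq> M" "v \<noteq> L" "v \<noteq> M" "\<not> crs L M u v" for u v
    using same_up[of u v] same_up[of v u] that syms by blast
  have ns: "\<not> (C L u M \<and> C L M u)" if "u \<in> S" for u using C_asym2 L that by blast
  have "(\<not> crs L M x x0 \<and> \<not> crs L M y y0) \<or> (\<not> crs L M x y0 \<and> \<not> crs L M y x0)"
    using o0 h opp[OF S] opp[OF ex0(1,2)] opp[OF S(1) ex0(1)] opp[OF S(2) ex0(2)] opp[OF S(1) ex0(2)] opp[OF S(2) ex0(1)]
      ns[OF S(1)] ns[OF S(2)] ns[OF ex0(1)] ns[OF ex0(2)] by (smt (verit))
  hence "up x \<noteq> up y" using * u0 S ex0 ne n0 by metis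
  thus ?thesis using opp_up2 S h by blast
qed

end

section \<open>Point reflections and feet\<close>

declare on.simps(2) [simp del]

context menger_ends
begin

sublocale sep: separation "rimpoints inc" "rim_cross inc"
proof
  show "crs A B C D \<Longrightarrow> crs B A C D" "crs A B C D \<Longrightarrow> crs C D A B" for A B C D using crs_sym by blast+
  show "\<lbrakk>crs A B C D; A \<in> \<Omega>; B \<in> \<Omega>; C \<in> \<Omega>; D \<in> \<Omega>\<rbrakk> \<Longrightarrow> distinct [A, B, C, D]" for A B C D
    using crs_distinct by blast
  show "\<lbrakk>A \<in> \<Omega>; B \<in> \<Omega>; C \<in> \<Omega>; D \<in> \<Omega>; distinct [A, B, C, D]\<rbrakk> \<Longrightarrow> crs A B C D \<or> crs A C B D \<or> crs A D B C" for A B C D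
    using crs_one(1) by blast
  show "\<not> crs A C B D" if "A \<in> \<Omega>" "B \<in> \<Omega>" "C \<in> \<Omega>" "D \<in> \<Omega>" "crs A B C D" for A B C D
    using crs_one(2)[OF that(1-4)] crs_distinct[OF that(5,1-4)] that(5) by blast
  show "\<lbrakk>A \<in> \<Omega>; B \<in> \<Omega>; C \<in> \<Omega>; D \<in> \<Omega>; E \<in> \<Omega>; distinct [A, B, C, D, E]\<rbrakk>
      \<Longrightarrow> crs A B C E \<longleftrightarrow> (crs A B C D \<noteq> crs A B D E)" for A B C D E using crs_xor by blast
qed

lemma ex_rim_off: "\<exists>x \<in> \<Omega>. \<not> onr x l"
proof -
  obtain P where P: "inc P l" using ex_pt by blast
  obtain k where k: "inc P k" "k \<noteq> l" using ex_other_line P by blast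
  obtain x where x: "x \<in> \<Omega>" "onr x k" using line_ends by metis
  have "\<not> onr x l" using onr_dj[OF x(1,2) _ k(2)] k P djD by blast
  thus ?thesis using x by blast
qed

lemma pr_off: assumes "x \<in> \<Omega>" "\<not> onr x l" "inc P l" shows "\<not> onr (pr P x) l"
  using pr[OF assms(1)] jp[OF assms(1), of P] onr_dj[of "pr P x" "jp x P" l] djD assms by metis

lemma pr_inj: assumes "x \<in> \<Omega>" "\<not> onr x l" "inc P l" "inc Q l" "pr P x = pr Q x" shows "P = Q"
proof (rule ccontr)
  assume "P \<noteq> Q"
  have "jp x P = jp x Q" using jr_pr[OF assms(1)] assms(5) by metis
  hence "inc P (jp x P)" "inc Q (jp x P)" using jp[OF assms(1)] by metis+
  hence "jp x P = l" using uniq \<open>P \<noteq> Q\<close> assms by metis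
  thus False using jp[OF assms(1), of P] assms by metis
qed

lemma pr_on: "\<lbrakk>x \<in> \<Omega>; onr x l; inc P l\<rbrakk> \<Longrightarrow> onr (pr P x) l"
  using jp_eq pr by metis

lemma pr_ends: assumes "x \<in> \<Omega>" "onr x l" "inc P l" "inc Q l" shows "pr P x = pr Q x"
proof -
  have "onr (pr P x) l" "onr (pr Q x) l" using pr_on assms by blast+
  thus ?thesis using onr_two[of x "pr P x" "pr Q x" l] pr[OF assms(1)] assms by metis
qed

lemma SR_refl: "\<lbrakk>x \<in> \<Omega>; \<not> onr x l\<rbrakk> \<Longrightarrow> SR l x x"
  using rs_ex unfolding SR_def by blast

lemma ends_line: "\<lbrakk>X \<in> \<Omega>; Y \<in> \<Omega>; X \<noteq> Y; onr X l; onr Y l; x \<in> \<Omega>; \<not> onr x l; y \<in> \<Omega>; \<not> onr y l; x \<noteq> y\<rbrakk>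
  \<Longrightarrow> crs X Y x y \<longleftrightarrow> \<not> SR l x y"
  using crs_iff[of X Y x y] jr_eq[of X Y l] by auto

text \<open>The source of the centres used later: the chord \<open>xy\<close> crosses
  \<open>l\<close>, and the reflection in the crossing point takes \<open>x\<close> to
  \<open>y\<close>.\<close>

lemma SR_meet:
  assumes "x \<in> \<Omega>" "\<not> onr x l" "y \<in> \<Omega>" "\<not> onr y l"
  shows "\<not> SR l x y \<longleftrightarrow> (\<exists>V. inc V l \<and> pr V x = y)"
proof -
  obtain X Y where E: "X \<in> \<Omega>" "Y \<in> \<Omega>" "X \<noteq> Y" "onr X l" "onr Y l" using line_ends by metis
  have j: "jr X Y = l" using jr_eq E by blast
  show ?thesis
  proof (cases "x = y")
    case True
    thus ?thesis using SR_refl pr(2) assms by metis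
  next
    case False
    have "crs X Y x y \<longleftrightarrow> (\<exists>V. inc V l \<and> inc V (jr x y))"
      unfolding rim_cross_def rim_meet_def j using E(3) False jr(1)[OF assms(1,3) False] assms(2) by metis
    thus ?thesis using ends_line[OF E assms False] pr_iff[OF assms(1,3) False] by blast
  qed
qed

lemma SR_pr: "\<lbrakk>x \<in> \<Omega>; \<not> onr x l; inc V l\<rbrakk> \<Longrightarrow> \<not> SR l x (pr V x)"
  using SR_meet pr_off pr(1) by blast

lemma crs_pr:
  assumes "X \<in> \<Omega>" "Y \<in> \<Omega>" "Y \<noteq> X" "Y \<noteq> pr P X"
  shows "crs X (pr P X) Y (pr P Y)"
proof -
  have "jp X P \<noteq> jp Y P"
    using onr_two[of X "pr P X" Y "jp X P"] pr[OF assms(1), of P] jp[OF assms(1), of P] jp(1)[OF assms(2), of P] assms by metis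
  thus ?thesis
    using crs_I[of X "pr P X" Y "pr P Y" P] jr_pr jp(2) pr(2) assms by metis
qed

text \<open>Gives the direction of a translation: with the circle cut at the other end
  \<open>Y\<close>, the step from \<open>pr P b\<close> to \<open>pr Q b\<close> goes towards the
  end of the ray \<open>PQ\<close>.\<close>

lemma translation_crs:
  assumes l: "inc P l" "inc Q l" "P \<noteq> Q" and b: "b \<in> \<Omega>" "\<not> onr b l"
    and Y: "Y \<in> \<Omega>" "onr Y l" "Y \<noteq> ray_end P Q"
  shows "crs Y (pr Q b) (pr P b) (ray_end P Q)"
proof -
  define X where "X = ray_end P Q"
  have "ln P Q = l" using ln_eq l by blast
  hence X: "X \<in> \<Omega>" "onr X l" using ray_end[OF l(3)] X_def by auto
  have XY: "X \<noteq> Y" using Y X_def by blast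
  have S: "pr P b \<in> \<Omega>" "pr Q b \<in> \<Omega>" using pr b by blast+
  have off: "\<not> onr (pr P b) l" "\<not> onr (pr Q b) l" using pr_off b l by blast+
  have ne: "pr P b \<noteq> pr Q b" "b \<noteq> pr P b" "b \<noteq> pr Q b" using pr_inj[OF b l(1,2)] l(3) pr(2)[OF b(1)] by metis+
  have neX: "X \<noteq> b" "Y \<noteq> b" "X \<noteq> pr P b" "Y \<noteq> pr P b" "X \<noteq> pr Q b" "Y \<noteq> pr Q b"
    using X Y off b by metis+
  have d: "distinct [pr P b, b, pr Q b, X, Y]" using ne neX XY by simp
  have 1: "crs b (pr P b) X Y" "crs b (pr Q b) X Y"
    using ends_line[OF X(1) Y(1) XY X(2) Y(2) b S(1) off(1) ne(2)] SR_pr[OF b l(1)]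
      ends_line[OF X(1) Y(1) XY X(2) Y(2) b S(2) off(2) ne(3)] SR_pr[OF b l(2)] crs_sym by blast+
  define k where "k = jp b P"
  have k: "onr b k" "inc P k" "jr b (pr P b) = k" "onr (pr P b) k" using jp[OF b(1)] jr_pr[OF b(1)] pr(3)[OF b(1)] k_def by metis+
  have "k \<noteq> l" using k b by metis
  hence Qk: "\<not> inc Q k" using k l uniq by metis
  have 2: "rs k X Q" using rs_end[OF k(2) Qk] X_def by simp
  have q: "onr (pr Q b) (jp b Q)" "inc Q (jp b Q)" "onr b (jp b Q)" using jp[OF b(1)] pr(3)[OF b(1)] by blast+
  hence "dj (jp b Q) k" using onr_dj[OF b(1)] k Qk by metis
  hence "rs k (pr Q b) Q" using rsI q by blast
  hence "SR k X (pr Q b)" using 2 SR_def by blast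
  moreover have "distinct [b, pr P b, X, pr Q b]" using ne neX by simp
  ultimately have "\<not> crs b (pr P b) X (pr Q b)" using crs_iff[OF b(1) S(1) X(1) S(2)] k(3) by blast
  hence "\<not> crs (pr P b) b X (pr Q b)" using crs_sym by blast
  thus ?thesis
    using sep.hexagon_aux[OF S(1) b(1) S(2) X(1) Y(1) d] 1 crs_sym unfolding X_def[symmetric] by blast
qed

text \<open>The two sides are the images of \<open>x\<close> under a translation and its inverse,
  which move \<open>x\<close> towards different ends of \<open>l\<close>.\<close>

lemma translation_not_involutive:
  assumes l: "inc R l" "inc S l" "R \<noteq> S" and x: "x \<in> \<Omega>" "\<not> onr x l"
  shows "pr R (pr S x) \<noteq> pr S (pr R x)"
proof
  assume e: "pr R (pr S x) = pr S (pr R x)"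
  define c where "c = pr R (pr S x)"
  have j: "ln R S = l" "ln S R = l" using ln_eq l by metis+
  have X: "ray_end S R \<in> \<Omega>" "onr (ray_end S R) l" "ray_end R S \<in> \<Omega>" "onr (ray_end R S) l"
    using ray_end l(3) j by metis+
  obtain T where T: "btw S R T" using extend l by metis
  have ne: "ray_end S R \<noteq> ray_end R S"
  proof -
    have Tl: "inc T l" using btw_on(2) T l by blast
    have Tn: "T \<noteq> S" "T \<noteq> R" using T btw_distinct by blast+
    have Sd: "\<not> btw R S T" using T btw_excl btw_sym by blast
    have "pen S R = pen S T" using pen_move_A[OF l(2) _ l(1)] Tl Tn l(3) Sd btw_sym by metis
    moreover have "pen S T = pen R T"
    proof -
      have b: "\<not> btw S T R" using T btw_excl by blast
      have "asy S T A B \<longleftrightarrow> asy R T A B" for A B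
        using asy_move_R[OF _ l(2) Tl l(1)] asy_move_R[OF _ l(1) Tl l(2)] b Tn btw_sym by metis
      moreover have "ln S T = l" "ln R T = l" using ln_eq l Tl Tn by metis+
      ultimately show ?thesis unfolding pen_def by auto
    qed
    ultimately have "ray_end S R = ray_end R T" unfolding ray_end_def by simp
    thus ?thesis using ray_end_opp[of T R S] T btw_sym by metis
  qed
  have S: "pr S x \<in> \<Omega>" "\<not> onr (pr S x) l" "pr R x \<in> \<Omega>" "\<not> onr (pr R x) l" using pr_off pr x l by blast+
  have "crs (ray_end R S) c x (ray_end S R)"
    using translation_crs[OF l(2,1) l(3)[symmetric] S(1,2) X(3,4) ne[symmetric]] pr_pr[OF x(1)] c_def by simp
  moreover have "crs (ray_end S R) c x (ray_end R S)"
    using translation_crs[OF l S(3,4) X(1,2) ne] pr_pr[OF x(1)] c_def e by simp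
  moreover have "c \<in> \<Omega>" using c_def pr S by simp
  ultimately show False using sep.un2[of "ray_end R S" c x "ray_end S R"] X x sep.syms by blast
qed

end

locale menger_full = menger_ends inc for inc :: "'p \<Rightarrow> 'l \<Rightarrow> bool" +
  assumes A7: "axiom_A7 inc" and A10: "axiom_A10 inc" and A11: "axiom_A11 inc"
begin

text \<open>Pascal's theorem for the hexagon obtained from \<open>x\<close> by alternating the point reflections in
  \<open>P\<close>, \<open>Q\<close>, \<open>R\<close>: the product of any three of them with collinear centres is an involution.\<close>

lemma pr_rev:
  assumes l: "inc P l" "inc Q l" "inc R l" and x: "x \<in> \<Omega>"
  shows "pr R (pr Q (pr P x)) = pr P (pr Q (pr R x))"
proof (cases "onr x l \<or> P = Q \<or> Q = R \<or> P = R")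
  case True
  have *: ?thesis if "onr x l"
  proof -
    have "pr Q x = pr P x" "pr R x = pr P x" using pr_ends x that l by blast+
    thus ?thesis using pr_ends[of "pr P x" l] pr_on[OF x that] pr_pr[OF x] pr(1)[OF x] l by metis
  qed
  show ?thesis using True * pr_pr pr(1) x by metis
next
  case False
  define B C D E F where B: "B = pr P x" and C: "C = pr Q B" and D: "D = pr R C" and E: "E = pr P D" and F: "F = pr Q E"
  have xl: "\<not> onr x l" and ne: "P \<noteq> Q" "Q \<noteq> R" "P \<noteq> R" using False by auto
  have S: "B \<in> \<Omega>" "C \<in> \<Omega>" "D \<in> \<Omega>" "E \<in> \<Omega>" "F \<in> \<Omega>" unfolding B C D E F using pr x by simp_all
  have off: "\<not> onr B l" "\<not> onr C l" "\<not> onr D l" "\<not> onr E l" "\<not> onr F l"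
    using B C D E F pr_off x xl l S by metis+
  have inv: "pr P B = x" "pr Q C = B" "pr R D = C" "pr P E = D" "pr Q F = E" using B C D E F pr_pr x S by metis+
  have n: "\<not> SR l x B" "\<not> SR l B C" "\<not> SR l C D" "\<not> SR l D E" "\<not> SR l E F"
    using SR_pr B C D E F x xl l S off by metis+
  note xo = SR_xor[of _ l]
  have s: "SR l x C" "SR l B D" "SR l C E" "SR l D F"
    using xo[OF x xl S(1) off(1) S(2) off(2)] xo[OF S(1) off(1) S(2) off(2) S(3) off(3)]
     xo[OF S(2) off(2) S(3) off(3) S(4) off(4)] xo[OF S(3) off(3) S(4) off(4) S(5) off(5)] n by blast+
  have n2: "\<not> SR l x D" "\<not> SR l x F" "\<not> SR l C F" "\<not> SR l B E"
    using xo[OF x xl S(2) off(2) S(3) off(3)] xo[OF x xl S(3) off(3) S(5) off(5)]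
      xo[OF S(2) off(2) S(3) off(3) S(5) off(5)] xo[OF S(1) off(1) S(3) off(3) S(4) off(4)] n s by blast+
  have rf: "SR l x x" "SR l B B" "SR l C C" "SR l D D" using SR_refl x xl S off by blast+
  define X where "X = ray_end P Q"
  have "ln P Q = l" using ln_eq ne l by blast
  hence X: "X \<in> \<Omega>" "onr X l" using ray_end[OF ne(1)] X_def by auto
  obtain Y where Y: "Y \<in> \<Omega>" "onr Y l" "Y \<noteq> X" using line_ends by metis
  have 1: "crs Y C x X" using translation_crs[OF l(1,2) ne(1) S(1) off(1) Y(1,2)] Y(3) inv C X_def by simp
  have 2: "crs Y F D X" using translation_crs[OF l(1,2) ne(1) S(4) off(4) Y(1,2)] Y(3) inv F X_def by simp
  have CD: "C \<noteq> D" "C \<noteq> F" "x \<noteq> D" "x \<noteq> F" "B \<noteq> E" using n n2 rf by metis+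
  have 3: "crs X Y C D" "crs X Y C F"
    using ends_line[OF X(1) Y(1) Y(3)[symmetric] X(2) Y(2) S(2) off(2)] S off CD n n2 by blast+
  have xC: "x \<noteq> C" using inv C pr_inj[OF S(1) off(1) l(1,2)] ne by metis
  have DF: "D \<noteq> F" using inv F pr_inj[OF S(4) off(4) l(1,2)] ne by metis
  have BD: "B \<noteq> D" using inv D pr_inj[OF S(2) off(2) l(2,3)] ne by metis
  have CE: "C \<noteq> E" using inv E pr_inj[OF S(3) off(3) l(1,3)] ne by metis
  have "X \<noteq> x" "X \<noteq> C" "X \<noteq> D" "X \<noteq> F" "Y \<noteq> x" "Y \<noteq> C" "Y \<noteq> D" "Y \<noteq> F" using X Y xl off by metis+
  hence d: "distinct [x, C, D, F, X, Y]" using xC CD DF Y by simp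
  \<comment> \<open>(A7) applies only if \<open>CD\<close> and \<open>Fx\<close> meet. Their common
    point \<open>Z\<close> then lies on \<open>l\<close> and takes \<open>C\<close> to
    \<open>D\<close>, which forces \<open>Z = R\<close>.\<close>
  have "crs C D x F" using sep.hexagon_crossing[OF x S(2,3,5) X(1) Y(1) d 1 2 3] .
  hence "crs C D F x" using sep.syms by blast
  then obtain Z where Z: "rim_meet inc C D F x Z" unfolding rim_cross_def by blast
  have "jp x P \<noteq> jp D P"
    using onr_two[OF x S(1,3), of "jp x P"] jp[OF x] jp[OF S(3)] pr(3)[OF x] B CD BD pr(2)[OF x] by metis
  hence mP: "rim_meet inc x B D E P"
    unfolding rim_meet_def using jr_pr[OF x, of P] jr_pr[OF S(3), of P] B E jp(2)[OF x] jp(2)[OF S(3)] pr(2) x S by metis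
  have "jp B Q \<noteq> jp E Q"
    using onr_two[OF S(1,2,4), of "jp B Q"] jp[OF S(1)] jp[OF S(4)] pr(3)[OF S(1)] C CD CE pr(2)[OF S(1)] by metis
  hence mQ: "rim_meet inc B C E F Q"
    unfolding rim_meet_def using jr_pr[OF S(1), of Q] jr_pr[OF S(4), of Q] C F jp(2)[OF S(1)] jp(2)[OF S(4)] pr(2) S by metis
  have "collinear3 inc P Q Z" using A7 mP mQ Z x S unfolding axiom_A7_def by blast
  then obtain g where "inc P g" "inc Q g" "inc Z g" unfolding collinear3_def by blast
  hence Zl: "inc Z l" using uniq ne l by metis
  have "pr Z C = D" using Z pr_iff[OF S(2,3) CD(1)] unfolding rim_meet_def by blast
  hence "Z = R" using pr_inj[OF S(2) off(2) Zl l(3)] D by simp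
  hence "pr R F = x" using Z pr_iff[OF S(5) x] unfolding rim_meet_def by blast
  hence "pr R x = F" using pr_pr[OF S(5)] by metis
  thus ?thesis using inv B C D by simp
qed

text \<open>\<open>S\<close> is chosen to give the right value at one \<open>b\<close> off
  \<open>l\<close>. By \<open>pr_rev\<close>, a product of four points of \<open>l\<close> commutes
  with every translation along \<open>l\<close> and is reversed by moving it past one point of
  \<open>l\<close>. So, fixing \<open>b\<close>, it fixes all \<open>pr U (pr T b)\<close> and
  \<open>pr T b\<close>, and these are all the rimpoints off \<open>l\<close>.\<close>

lemma pr_three:
  assumes l: "inc P l" "inc Q l" "inc R l"
  shows "\<exists>S. inc S l \<and> (\<forall>x\<in>\<Omega>. pr R (pr Q (pr P x)) = pr S x)"
proof -
  obtain b where b: "b \<in> \<Omega>" "\<not> onr b l" using ex_rim_off by blast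
  have c: "pr P y \<in> \<Omega>" if "y \<in> \<Omega>" for P y using pr(1) that by blast
  have off: "\<not> onr (pr P b) l" "\<not> onr (pr Q (pr P b)) l" "\<not> onr (pr R (pr Q (pr P b))) l"
    using pr_off b l c by metis+
  have c3: "pr P b \<in> \<Omega>" "pr Q (pr P b) \<in> \<Omega>" "pr R (pr Q (pr P b)) \<in> \<Omega>" using c b by blast+
  have "\<not> SR l b (pr P b)" "\<not> SR l (pr P b) (pr Q (pr P b))" "\<not> SR l (pr Q (pr P b)) (pr R (pr Q (pr P b)))"
    using SR_pr[OF b l(1)] SR_pr[OF c3(1) off(1) l(2)] SR_pr[OF c3(2) off(2) l(3)] .
  hence "\<not> SR l b (pr R (pr Q (pr P b)))"
    using SR_xor[OF b c3(1) off(1) c3(2) off(2)] SR_xor[OF b c3(2) off(2) c3(3) off(3)] by blast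
  then obtain S where S: "inc S l" "pr S b = pr R (pr Q (pr P b))" using SR_meet[OF b _ off(3)] b c by metis
  note T3 = pr_rev[of _ l]
  have bS: "pr S (pr R (pr Q (pr P b))) = b" using S pr_pr b by metis
  hence bS': "pr P (pr Q (pr R (pr S b))) = b" using pr_pr b c by metis
  have "pr S (pr R (pr Q (pr P x))) = x" if x: "x \<in> \<Omega>" "\<not> onr x l" for x
  proof (cases "SR l b x")
    case True
    obtain T where T: "inc T l" using l by blast
    have o: "\<not> onr (pr T b) l" using pr_off b T by blast
    have "\<not> SR l (pr T b) x" using SR_xor[OF b c o x] SR_pr[OF b T] True b by blast
    then obtain U where U: "inc U l" "pr U (pr T b) = x" using SR_meet[OF _ o x] c b by blast
    have "pr S (pr R (pr Q (pr P (pr U (pr T b))))) = pr S (pr R (pr Q (pr T (pr U (pr P b)))))"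
      using T3[OF T U(1) l(1) b(1)] by simp
    also have "\<dots> = pr S (pr R (pr U (pr T (pr Q (pr P b)))))" using T3[OF U(1) T l(2)] c b by simp
    also have "\<dots> = pr S (pr T (pr U (pr R (pr Q (pr P b)))))" using T3[OF T U(1) l(3)] c b by simp
    also have "\<dots> = pr U (pr T (pr S (pr R (pr Q (pr P b)))))" using T3[OF U(1) T S(1)] c b by simp
    finally show ?thesis using bS U by simp
  next
    case False
    then obtain T where T: "inc T l" "pr T b = x" using SR_meet b x by blast
    have "pr S (pr R (pr Q (pr P (pr T b)))) = pr S (pr R (pr T (pr P (pr Q b))))"
      using T3[OF T(1) l(1,2) b(1)] by simp
    also have "\<dots> = pr T (pr R (pr S (pr P (pr Q b))))" using T3[OF T(1) l(3) S(1)] c b by simp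
    also have "\<dots> = pr T (pr P (pr S (pr R (pr Q b))))" using T3[OF l(1) S(1) l(3)] c b by simp
    also have "\<dots> = pr T (pr P (pr Q (pr R (pr S b))))" using T3[OF l(2,3) S(1)] b by simp
    finally show ?thesis using bS' T by simp
  qed
  hence 1: "pr R (pr Q (pr P x)) = pr S x" if "x \<in> \<Omega>" "\<not> onr x l" for x using that pr_pr c by metis
  have 2: "pr R (pr Q (pr P x)) = pr S x" if x: "x \<in> \<Omega>" "onr x l" for x
  proof -
    have "pr Q (pr P x) = x" using pr_ends[OF x l(1,2)] pr_pr[OF x(1)] by simp
    thus ?thesis using pr_ends[OF x l(3) S(1)] by simp
  qed
  show ?thesis using 1 2 S by blast
qed

lemma pr_ext: assumes "\<And>x. x \<in> \<Omega> \<Longrightarrow> pr V x = pr V' x" shows "V = V'"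
proof (rule ccontr)
  assume n: "V \<noteq> V'"
  obtain x where x: "x \<in> \<Omega>" "\<not> onr x (ln V V')" using ex_rim_off by blast
  thus False using pr_inj[OF x ln_inc[OF n]] assms n by blast
qed

text \<open>The action of a point \<open>W\<close> on the rimpoints extends to a collineation, taking \<open>P\<close> to \<open>cj W P\<close>
  and \<open>m\<close> to \<open>cl W m\<close>.\<close>

definition cj :: "'p \<Rightarrow> 'p \<Rightarrow> 'p" where
  "cj W P = (SOME V. \<forall>x\<in>\<Omega>. pr W (pr P (pr W x)) = pr V x)"

lemma cj: assumes "x \<in> \<Omega>" shows "pr (cj W P) x = pr W (pr P (pr W x))" "pr (cj W P) (pr W x) = pr W (pr P x)"
proof -
  obtain l where l: "inc W l" "inc P l" using ln_inc ex_pt2 by metis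
  have "\<exists>V. \<forall>x\<in>\<Omega>. pr W (pr P (pr W x)) = pr V x" using pr_three[OF l l(1)] by blast
  hence *: "\<forall>x\<in>\<Omega>. pr W (pr P (pr W x)) = pr (cj W P) x" unfolding cj_def by (rule someI_ex)
  thus "pr (cj W P) x = pr W (pr P (pr W x))" using assms by simp
  show "pr (cj W P) (pr W x) = pr W (pr P x)" using * assms pr_pr pr(1) by metis
qed

lemma cj_inc: assumes "inc W l" "inc P l" shows "inc (cj W P) l"
proof -
  obtain S where "inc S l" "\<forall>x\<in>\<Omega>. pr W (pr P (pr W x)) = pr S x" using pr_three[OF assms assms(1)] by blast
  moreover have "cj W P = S" using pr_ext calculation cj(1) by simp
  ultimately show ?thesis by simp
qed

lemma cj_cj: "cj W (cj W P) = P"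
  by (rule pr_ext) (simp add: cj pr pr_pr)

lemma cj_self: "cj W W = W"
  by (rule pr_ext) (simp add: cj pr pr_pr)

lemma line_eqI: assumes "\<And>x. x \<in> \<Omega> \<Longrightarrow> onr x k \<Longrightarrow> onr x m" shows "k = m"
proof -
  obtain X Y where "X \<in> \<Omega>" "Y \<in> \<Omega>" "X \<noteq> Y" "onr X k" "onr Y k" by (rule line_ends[of k]) (rule that)
  thus ?thesis using onr_unique assms by blast
qed

definition cl :: "'p \<Rightarrow> 'l \<Rightarrow> 'l" where
  "cl W m = (THE k. \<forall>x\<in>\<Omega>. onr (pr W x) k \<longleftrightarrow> onr x m)"

lemma cl: assumes "x \<in> \<Omega>" shows "onr (pr W x) (cl W m) \<longleftrightarrow> onr x m"
proof -
  obtain X Y where E: "X \<in> \<Omega>" "Y \<in> \<Omega>" "X \<noteq> Y" "onr X m" "onr Y m" using line_ends by metis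
  have ne: "pr W X \<noteq> pr W Y" using pr_pr E by metis
  have E': "pr W X \<in> \<Omega>" "pr W Y \<in> \<Omega>" using pr E by blast+
  define k where "k = jr (pr W X) (pr W Y)"
  have k: "onr (pr W X) k" "onr (pr W Y) k" using jr[OF E' ne] k_def by auto
  have "onr (pr W x) k \<longleftrightarrow> onr x m" if "x \<in> \<Omega>" for x
    using onr_two[OF E' _ k _ ne] onr_two[OF E(1,2) _ E(4,5) _ E(3)] that pr_pr pr(1) k E by metis
  hence "\<exists>k. \<forall>x\<in>\<Omega>. onr (pr W x) k \<longleftrightarrow> onr x m" by blast
  moreover have "k = k'" if "\<forall>x\<in>\<Omega>. onr (pr W x) k \<longleftrightarrow> onr x m" "\<forall>x\<in>\<Omega>. onr (pr W x) k' \<longleftrightarrow> onr x m" for k k'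
    by (rule line_eqI) (metis that pr_pr pr(1))
  ultimately have "\<exists>!k. \<forall>x\<in>\<Omega>. onr (pr W x) k \<longleftrightarrow> onr x m" by blast
  from theI'[OF this] show ?thesis using assms unfolding cl_def by blast
qed

lemma cl_inj: "cl W k = cl W m \<Longrightarrow> k = m"
  using line_eqI cl by metis

lemma cl_self: assumes "inc W l" shows "cl W l = l"
proof (rule line_eqI[symmetric])
  fix x assume x: "x \<in> \<Omega>" "onr x l"
  have "onr (pr W x) l" using pr_on x assms by blast
  thus "onr x (cl W l)" using cl[of "pr W x" W l] pr_pr pr(1) x by metis
qed

lemma cl_inc: assumes "inc P m" shows "inc (cj W P) (cl W m)"
proof -
  obtain X where X: "X \<in> \<Omega>" "onr X m" using line_ends by metis
  have Y: "pr P X \<in> \<Omega>" "pr P X \<noteq> X" "onr (pr P X) m" using pr X pr_on assms by blast+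
  have 1: "onr (pr W X) (cl W m)" "onr (pr W (pr P X)) (cl W m)" using cl X Y by blast+
  have ne: "pr W X \<noteq> pr W (pr P X)" using pr_pr X Y by metis
  have "jr (pr W X) (pr W (pr P X)) = cl W m" using jr_eq[OF _ _ ne 1] pr X Y by blast
  moreover have "pr (cj W P) (pr W X) = pr W (pr P X)" using cj X by blast
  ultimately show ?thesis using pr_iff[OF _ _ ne] pr X Y by metis
qed

lemma cl_jr: assumes "a \<in> \<Omega>" "b \<in> \<Omega>" "a \<noteq> b" shows "jr (pr W a) (pr W b) = cl W (jr a b)"
proof -
  have "pr W a \<noteq> pr W b" using pr_pr assms by metis
  thus ?thesis using jr_eq[of "pr W a" "pr W b"] cl jr[OF assms] pr assms by blast
qed

lemma cl_jp: assumes "a \<in> \<Omega>" shows "jp (pr W a) (cj W P) = cl W (jp a P)"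
  using jp_eq[of "pr W a"] cl cl_inc jp[OF assms] pr assms by blast

lemma cl_parallel: "parallel inc a b \<Longrightarrow> parallel inc (cl W a) (cl W b)"
  unfolding parallel_iff using cl_inj cl pr(1) by metis

section \<open>Feet, reflections and midpoints\<close>

abbreviation CP :: "'l \<Rightarrow> 'l \<Rightarrow> 'l \<Rightarrow> bool" where "CP \<equiv> common_parallels_meet_on inc"

lemma cl_CP: "CP l m k \<Longrightarrow> CP (cl W l) (cl W m) (cl W k)"
  unfolding common_parallels_meet_on_def
proof (elim exE conjE)
  fix c d Z assume h: "c \<noteq> d" "parallel inc c l" "parallel inc c m" "parallel inc d l" "parallel inc d m"
    "inc Z c" "inc Z d" "inc Z k"
  show "\<exists>c d Z. c \<noteq> d \<and> parallel inc c (cl W l) \<and> parallel inc c (cl W m) \<and> parallel inc d (cl W l) \<and>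
    parallel inc d (cl W m) \<and> inc Z c \<and> inc Z d \<and> inc Z (cl W k)"
    using cl_parallel[OF h(2)] cl_parallel[OF h(3)] cl_parallel[OF h(4)] cl_parallel[OF h(5)]
      cl_inc[OF h(6)] cl_inc[OF h(7)] cl_inc[OF h(8)] cl_inj h(1) by blast
qed

definition foot :: "'l \<Rightarrow> 'l rimpoint \<Rightarrow> 'p \<Rightarrow> bool" where
  "foot l x R \<longleftrightarrow> inc R l \<and>
    (\<forall>S. inc S l \<and> S \<noteq> R \<longrightarrow> CP l (jr (pr R (pr S x)) (pr S (pr R x))) (jp x R))"

definition ft :: "'l \<Rightarrow> 'l rimpoint \<Rightarrow> 'p" where
  "ft l x = (THE R. foot l x R)"

lemma ft: assumes "x \<in> \<Omega>" "\<not> onr x l" shows "foot l x (ft l x)" "foot l x R \<Longrightarrow> R = ft l x"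
proof -
  have *: "\<exists>!R. foot l x R" using A11 assms unfolding axiom_A11_def foot_def by blast
  show "foot l x (ft l x)" using theI'[OF *] unfolding ft_def .
  thus "foot l x R \<Longrightarrow> R = ft l x" using * by blast
qed

lemma ft_inc: "x \<in> \<Omega> \<Longrightarrow> \<not> onr x l \<Longrightarrow> inc (ft l x) l"
  using ft foot_def by blast

text \<open>A point \<open>W\<close> of \<open>l\<close> acts as a collineation that fixes
  \<open>l\<close> and permutes the points \<open>S\<close> in (A11). So the image of the foot has
  the defining property for \<open>pr W x\<close>, and feet are unique.\<close>

lemma ft_cj: assumes x: "x \<in> \<Omega>" "\<not> onr x l" and W: "inc W l" shows "ft l (pr W x) = cj W (ft l x)"
proof -
  define R where "R = ft l x"
  have R: "foot l x R" using ft(1)[OF x] R_def by simp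
  hence Rl: "inc R l" using foot_def by blast
  have "CP l (jr (pr (cj W R) (pr S' (pr W x))) (pr S' (pr (cj W R) (pr W x)))) (jp (pr W x) (cj W R))"
    if S': "inc S' l" "S' \<noteq> cj W R" for S'
  proof -
    define S where "S = cj W S'"
    have S: "inc S l" "S \<noteq> R" "S' = cj W S" using S_def cj_inc W S' cj_cj by metis+
    have in1: "pr S x \<in> \<Omega>" "pr R x \<in> \<Omega>" using pr x by blast+
    have e: "pr (cj W R) (pr S' (pr W x)) = pr W (pr R (pr S x))" "pr S' (pr (cj W R) (pr W x)) = pr W (pr S (pr R x))"
      using cj(2) in1 x S by simp_all
    have ne: "pr R (pr S x) \<noteq> pr S (pr R x)" using translation_not_involutive[OF Rl S(1) S(2)[symmetric] x] .
    have "CP l (jr (pr R (pr S x)) (pr S (pr R x))) (jp x R)" using R S unfolding foot_def by blast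
    hence "CP (cl W l) (cl W (jr (pr R (pr S x)) (pr S (pr R x)))) (cl W (jp x R))" by (rule cl_CP)
    thus ?thesis unfolding e cl_self[OF W] using cl_jr[OF _ _ ne] cl_jp[OF x(1)] pr(1) in1 by metis
  qed
  hence "foot l (pr W x) (cj W R)" unfolding foot_def using cj_inc W Rl by blast
  thus ?thesis using ft(2)[of "pr W x" l] pr_off[OF x W] pr(1)[OF x(1)] R_def by simp
qed

text \<open>Coincides with \<open>reflection\<close> by \<open>reflection_eq\<close>, but is free of
  axial maps.\<close>

definition sg :: "'l \<Rightarrow> 'l rimpoint \<Rightarrow> 'l rimpoint" where
  "sg l x = (if onr x l then x else pr (ft l x) x)"

lemma sg_in: "x \<in> \<Omega> \<Longrightarrow> sg l x \<in> \<Omega>"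
  unfolding sg_def using pr by simp

lemma sg_off: "x \<in> \<Omega> \<Longrightarrow> \<not> onr x l \<Longrightarrow> \<not> onr (sg l x) l"
  using pr_off ft_inc unfolding sg_def by simp

lemma sg_pr: assumes x: "x \<in> \<Omega>" and W: "inc W l" shows "sg l (pr W x) = pr W (sg l x)"
proof (cases "onr x l")
  case True
  thus ?thesis using pr_on[OF x True W] unfolding sg_def by simp
next
  case False
  have "\<not> onr (pr W x) l" using pr_off x False W by blast
  thus ?thesis using False ft_cj[OF x False W] cj(2)[OF x] unfolding sg_def by simp
qed

lemma sg_sg: assumes x: "x \<in> \<Omega>" shows "sg l (sg l x) = x"
proof (cases "onr x l")
  case True thus ?thesis unfolding sg_def by simp
next
  case False
  have W: "inc (ft l x) l" using ft_inc x False by blast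
  have e: "sg l x = pr (ft l x) x" using False unfolding sg_def by simp
  have "sg l (sg l x) = pr (ft l x) (sg l x)" using sg_pr[OF x W] unfolding e .
  thus ?thesis using e pr_pr[OF x] by simp
qed

text \<open>Common parallels through \<open>Z\<close> join ends of \<open>g\<close> to ends of
  \<open>h\<close>, so a condition on lines becomes one on the action of \<open>Z\<close>. The
  hypothesis \<open>no\<close> keeps the end on \<open>g\<close> different from the end on
  \<open>h\<close>.\<close>

lemma CP_ends:
  assumes cp: "CP g h k" and no: "\<And>x. x \<in> \<Omega> \<Longrightarrow> \<not> (onr x g \<and> onr x h)"
  obtains G1 G2 H1 H2 Z where "G1 \<in> \<Omega>" "G2 \<in> \<Omega>" "G1 \<noteq> G2" "onr G1 g" "onr G2 g"
    "H1 \<in> \<Omega>" "H2 \<in> \<Omega>" "H1 \<noteq> H2" "onr H1 h" "onr H2 h" "inc Z k" "pr Z G1 = H1" "pr Z G2 = H2"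
proof -
  obtain c d Z where c: "c \<noteq> d" "parallel inc c g" "parallel inc c h" "parallel inc d g" "parallel inc d h"
    "inc Z c" "inc Z d" "inc Z k" using cp unfolding common_parallels_meet_on_def by blast
  obtain G1 where G1: "G1 \<in> \<Omega>" "onr G1 c" "onr G1 g" using c(2) parallel_iff by blast
  obtain H1 where H1: "H1 \<in> \<Omega>" "onr H1 c" "onr H1 h" using c(3) parallel_iff by blast
  obtain G2 where G2: "G2 \<in> \<Omega>" "onr G2 d" "onr G2 g" using c(4) parallel_iff by blast
  obtain H2 where H2: "H2 \<in> \<Omega>" "onr H2 d" "onr H2 h" using c(5) parallel_iff by blast
  have nd: "\<not> dj c d" using c not_dj by blast
  have ne: "G1 \<noteq> G2" "H1 \<noteq> H2" using onr_dj nd G1 G2 H1 H2 c(1) by metis+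
  have "G1 \<noteq> H1" "G2 \<noteq> H2" using no G1 G2 H1 H2 by blast+
  hence "pr Z G1 = H1" "pr Z G2 = H2" using pr_eq G1 G2 H1 H2 c by metis+
  thus ?thesis using that G1 G2 H1 H2 ne c by blast
qed

lemma CP_I:
  assumes no: "\<And>x. x \<in> \<Omega> \<Longrightarrow> \<not> (onr x g \<and> onr x h)"
    and G: "G1 \<in> \<Omega>" "G2 \<in> \<Omega>" "G1 \<noteq> G2" "onr G1 g" "onr G2 g"
    and H: "onr H1 h" "onr H2 h" "inc Z k" "pr Z G1 = H1" "pr Z G2 = H2"
  shows "CP g h k"
proof -
  have i: "H1 \<in> \<Omega>" "H2 \<in> \<Omega>" using H pr G by metis+
  have c: "onr G1 (jp G1 Z)" "onr H1 (jp G1 Z)" "inc Z (jp G1 Z)" using jp[OF G(1)] pr(3)[OF G(1)] H by metis+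
  have d: "onr G2 (jp G2 Z)" "onr H2 (jp G2 Z)" "inc Z (jp G2 Z)" using jp[OF G(2)] pr(3)[OF G(2)] H by metis+
  have n: "\<not> onr H1 g" "\<not> onr H2 g" "\<not> onr G1 h" "\<not> onr G2 h" using no G H i by blast+
  have ne: "jp G1 Z \<noteq> g" "jp G1 Z \<noteq> h" "jp G2 Z \<noteq> g" "jp G2 Z \<noteq> h" using c d n by metis+
  have "jp G1 Z \<noteq> jp G2 Z"
    using onr_two[OF G(1,2) i(1), of "jp G1 Z"] c d G(3) n G by metis
  moreover have "parallel inc (jp G1 Z) g" "parallel inc (jp G1 Z) h" "parallel inc (jp G2 Z) g" "parallel inc (jp G2 Z) h"
    unfolding parallel_iff using ne c d G H i by blast+
  ultimately show ?thesis unfolding common_parallels_meet_on_def using c d H by blast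
qed

text \<open>The point \<open>Z\<close> of (A10) takes the two ends of \<open>g\<close> to those of
  \<open>h\<close>. As \<open>P\<close> exchanges the ends of \<open>g\<close> and \<open>Q\<close>
  those of \<open>h\<close>, the points \<open>cj Z P\<close> and \<open>Q\<close> agree at one
  rimpoint off \<open>l\<close>, hence are equal.\<close>

lemma midpoint:
  assumes l: "inc P l" "inc Q l" "P \<noteq> Q"
  shows "\<exists>V. inc V l \<and> cj V P = Q"
proof -
  obtain g h where gh: "inc P g" "inc Q h" "CP g h (ln P Q)"
    using A10 l unfolding axiom_A10_def join_fin by blast
  have ll: "ln P Q = l" using ln_eq l by blast
  obtain c d Z where c: "c \<noteq> d" "parallel inc c g" "parallel inc c h" "parallel inc d g" "parallel inc d h"
    "inc Z c" "inc Z d" "inc Z l" using gh unfolding common_parallels_meet_on_def ll by blast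
  have pd: "dj a b" if "parallel inc a b" for a b using that parallel_iff onr_dj by blast
  have gl: "g \<noteq> l" "h \<noteq> l" using pd c djD by blast+
  hence ghn: "g \<noteq> h" using uniq gh l by metis
  \<comment> \<open>If \<open>g\<close> and \<open>h\<close> had a common end,
    \<open>Pen_transversal\<close> with transversal \<open>l\<close> would put \<open>c\<close> and
    \<open>d\<close> through it, but they meet in \<open>Z\<close>.\<close>
  have no: "\<not> (onr x g \<and> onr x h)" if x: "x \<in> \<Omega>" for x
  proof
    assume xg: "onr x g \<and> onr x h"
    obtain W where W: "W \<in> Pen" "\<And>l. onr x l \<longleftrightarrow> l \<in> W" using rim_cases x by metis
    have *: "onr x e" if e: "parallel inc e g" "parallel inc e h" "inc Z e" for e
    proof -
      have "l \<noteq> e" using pd[OF e(1)] gh l djD by blast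
      hence "meets inc l g" "meets inc l h" "meets inc l e" unfolding meets_def using gl gh l c e by blast+
      thus ?thesis using Pen_transversal[OF W(1) _ _ ghn e(1,2)] W(2) xg by blast
    qed
    have "onr x c" "onr x d" using * c by blast+
    thus False using onr_dj[OF x] c djD by blast
  qed
  obtain G1 G2 H1 H2 Z where G: "G1 \<in> \<Omega>" "G2 \<in> \<Omega>" "G1 \<noteq> G2" "onr G1 g" "onr G2 g"
    "H1 \<in> \<Omega>" "H2 \<in> \<Omega>" "H1 \<noteq> H2" "onr H1 h" "onr H2 h" "inc Z l" "pr Z G1 = H1" "pr Z G2 = H2"
    using CP_ends[OF gh(3) no] unfolding ll by metis
  have "pr P G1 = G2" "pr Q H1 = H2" using pr_eq G gh by metis+
  moreover have "pr Z H1 = G1" using G pr_pr by metis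
  ultimately have "pr (cj Z P) H1 = pr Q H1" using cj(1)[OF G(6)] G by simp
  moreover have "\<not> onr H1 l" using onr_dj[OF G(6,9) _ gl(2)] gh l djD by blast
  ultimately have "cj Z P = Q" using pr_inj[OF G(6) _ cj_inc[OF G(11) l(1)] l(2)] by blast
  thus ?thesis using G by blast
qed

section \<open>Line reflections and perpendiculars\<close>


lemma sg_SR: "x \<in> \<Omega> \<Longrightarrow> \<not> onr x l \<Longrightarrow> \<not> SR l x (sg l x)"
  using SR_pr ft_inc unfolding sg_def by simp

section \<open>Translations are axial maps\<close>

lemma ex_compatible: "\<exists>C. compatible \<Omega> crs C"
proof -
  fix l :: 'l
  obtain X Y where E: "X \<in> \<Omega>" "Y \<in> \<Omega>" "X \<noteq> Y" "onr X l" "onr Y l" by (rule line_ends[of l]) (rule that)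
  obtain N where N: "N \<in> \<Omega>" "\<not> onr N l" using ex_rim_off by blast
  have "distinct [X, Y, N]" using E N by auto
  then obtain C where "cyclic_order_on \<Omega> C" "\<forall>a\<in>\<Omega>. \<forall>b\<in>\<Omega>. \<forall>c\<in>\<Omega>. \<forall>d\<in>\<Omega>.
    crs a c b d \<longleftrightarrow> (C a b c \<and> C c d a) \<or> (C a d c \<and> C c b a)"
    using sep.ex_cyclic_order[OF E(1,2) N(1)] by blast
  hence "compatible \<Omega> crs C" by unfold_locales blast+
  thus ?thesis by blast
qed

lemma compatible_iff: "compatible \<Omega> crs C \<longleftrightarrow> cyclic_order_on \<Omega> C \<and> compatible_order inc C"
proof
  assume "compatible \<Omega> crs C"
  then interpret compatible \<Omega> crs C .
  show "cyclic_order_on \<Omega> C \<and> compatible_order inc C" unfolding compatible_order_def using co comp by blast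
next
  assume "cyclic_order_on \<Omega> C \<and> compatible_order inc C"
  thus "compatible \<Omega> crs C" unfolding compatible_order_def by unfold_locales blast+
qed

lemma pr_preserves:
  assumes "compatible \<Omega> crs C" "x \<in> \<Omega>" "y \<in> \<Omega>" "z \<in> \<Omega>" "C x y z"
  shows "C (pr P x) (pr P y) (pr P z)"
proof -
  interpret compatible \<Omega> crs C by fact
  show ?thesis
    by (rule involution_preserves[where p = "pr P", OF _ _ _ _ assms(2-5)]) (use pr pr_pr crs_pr in blast)+
qed

text \<open>Extended by the identity, as \<open>permutes\<close> demands.\<close>

definition tr :: "'p \<Rightarrow> 'p \<Rightarrow> 'l rimpoint \<Rightarrow> 'l rimpoint" where
  "tr P Q x = (if x \<in> \<Omega> then pr Q (pr P x) else x)"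

lemma tr: "x \<in> \<Omega> \<Longrightarrow> tr P Q x = pr Q (pr P x)" "x \<in> \<Omega> \<Longrightarrow> tr P Q x \<in> \<Omega>"
  unfolding tr_def using pr by simp_all

lemma tr_permutes: "tr P Q permutes \<Omega>"
proof (rule bij_imp_permutes)
  show "bij_betw (tr P Q) \<Omega> \<Omega>"
    by (rule bij_betwI[where g = "tr Q P"]) (auto simp: tr pr_pr pr)
  show "\<And>x. x \<notin> \<Omega> \<Longrightarrow> tr P Q x = x" unfolding tr_def by simp
qed

lemma tr_ne:
  assumes "inc P l" "inc Q l" "P \<noteq> Q" "x \<in> \<Omega>" "\<not> onr x l" shows "tr P Q x \<noteq> x"
proof
  assume "tr P Q x = x"
  hence "pr Q (pr P x) = x" using tr assms by simp
  moreover have "pr Q (pr Q (pr P x)) = pr P x" by (rule pr_pr) (rule pr(1)[OF assms(4)])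
  ultimately have "pr P x = pr Q x" by simp
  thus False using pr_inj[OF assms(4,5,1,2)] assms(3) by blast
qed

text \<open>Pascal's theorem for the hexagon \<open>x B C y E F\<close>. If opposite sides through
  \<open>P\<close> or \<open>Q\<close> coincide, the intersection point is \<open>Q\<close> or
  \<open>P\<close>, respectively.\<close>

lemma tr_axial:
  assumes l: "inc P l" "inc Q l" "P \<noteq> Q" and x: "x \<in> \<Omega>" and y: "y \<in> \<Omega>"
    and m: "rim_meet inc x (tr P Q y) y (tr P Q x) Z"
  shows "inc Z l"
proof -
  define B C E F where B: "B = pr P x" and C: "C = pr Q B" and E: "E = pr P y" and F: "F = pr Q E"
  have e: "tr P Q x = C" "tr P Q y = F" using tr B C E F x y by simp_all
  have S: "B \<in> \<Omega>" "C \<in> \<Omega>" "E \<in> \<Omega>" "F \<in> \<Omega>" unfolding B C E F using pr x y by simp_all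
  have inv: "pr P B = x" "pr Q C = B" "pr P E = y" "pr Q F = E" using B C E F pr_pr x y S by metis+
  have m': "x \<noteq> F" "y \<noteq> C" "jr x F \<noteq> jr y C" "inc Z (jr x F)" "inc Z (jr y C)"
    using m unfolding rim_meet_def e by auto
  have one: "inc Z l" if V: "inc V l" "inc V (jr x F)" "inc V (jr y C)" for V
  proof -
    have "V = Z" using uniq m' V by metis
    thus ?thesis using V by simp
  qed
  have xy: "x \<noteq> y" using m'(3) B C E F by auto
  consider "y = B" | "jp x P \<noteq> jp y P" "jp B Q = jp E Q" | "jp x P \<noteq> jp y P" "jp B Q \<noteq> jp E Q" | "jp x P = jp y P" "y \<noteq> B" by blast
  thus ?thesis
  proof cases
    case 1
    have "E = x" using 1 E inv by simp
    hence "pr Q x = F" using F by simp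
    hence "inc Q (jr x F)" using pr_iff[OF x S(4) m'(1)] by simp
    moreover have "pr Q y = C" using 1 C by simp
    hence "inc Q (jr y C)" using pr_iff[OF y S(2) m'(2)] by blast
    ultimately show ?thesis using one l by blast
  next
    case 2
    have BE: "B \<noteq> E" using inv xy by metis
    have "onr E (jp B Q)" "onr B (jp B Q)" "onr C (jp B Q)"
      using jp(1)[OF S(1)] jp(1)[OF S(3), of Q] pr(3)[OF S(1), of Q] 2(2) C by metis+
    hence "E = C" using onr_two[of B C E "jp B Q"] S BE C pr(2)[OF S(1), of Q] by metis
    hence "pr P y = C" "pr P x = F" using B E F inv by simp_all
    hence "inc P (jr y C)" "inc P (jr x F)" using pr_iff[OF y S(2) m'(2)] pr_iff[OF x S(4) m'(1)] by blast+
    thus ?thesis using one l by blast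
  next
    case 3
    have mP: "rim_meet inc x B y E P"
      unfolding rim_meet_def using 3(1) jr_pr[OF x, of P] jr_pr[OF y, of P] B E jp(2)[OF x] jp(2)[OF y] pr(2) x y by metis
    have mQ: "rim_meet inc B C E F Q"
      unfolding rim_meet_def using 3(2) jr_pr[OF S(1), of Q] jr_pr[OF S(3), of Q] C F jp(2)[OF S(1)] jp(2)[OF S(3)] pr(2) S by metis
    have mZ: "rim_meet inc C y F x Z" unfolding rim_meet_def using m' jr_sym by metis
    have "collinear3 inc P Q Z" using A7 mP mQ mZ x y S unfolding axiom_A7_def by blast
    then obtain g where "inc P g" "inc Q g" "inc Z g" unfolding collinear3_def by blast
    thus ?thesis using uniq l by metis
  next
    case 4
    have "onr y (jp x P)" using jp(1)[OF y, of P] 4(1) by simp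
    hence "y = x \<or> y = B"
      using onr_two[of x B y "jp x P"] x y S jp(1)[OF x] pr(2,3)[OF x, of P] B by metis
    thus ?thesis using 4 xy by blast
  qed
qed

lemma tr_axial_map:
  assumes l: "inc P l" "inc Q l" "P \<noteq> Q"
  shows "order_preserving_axial_map inc (tr P Q) l"
proof -
  obtain C where C: "compatible \<Omega> crs C" using ex_compatible by blast
  obtain x where x: "x \<in> \<Omega>" "\<not> onr x l" using ex_rim_off by blast
  have ne: "tr P Q x \<noteq> x" using tr_ne[OF l x] .
  have "C x y z \<longleftrightarrow> C (tr P Q x) (tr P Q y) (tr P Q z)" if S: "x \<in> \<Omega>" "y \<in> \<Omega>" "z \<in> \<Omega>" for x y z
  proof
    assume "C x y z"
    hence "C (pr P x) (pr P y) (pr P z)" using pr_preserves[OF C S] by blast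
    thus "C (tr P Q x) (tr P Q y) (tr P Q z)" using pr_preserves[OF C] tr S pr(1) by simp
  next
    assume "C (tr P Q x) (tr P Q y) (tr P Q z)"
    hence "C (pr Q (pr Q (pr P x))) (pr Q (pr Q (pr P y))) (pr Q (pr Q (pr P z)))"
      using pr_preserves[OF C] tr S by simp
    hence "C (pr P x) (pr P y) (pr P z)" using pr_pr pr(1) S by simp
    hence "C (pr P (pr P x)) (pr P (pr P y)) (pr P (pr P z))" using pr_preserves[OF C] pr(1) S by simp
    thus "C x y z" using pr_pr S by simp
  qed
  hence op: "order_preserving inc (tr P Q)"
    unfolding order_preserving_def using C compatible_iff by blast
  have fx: "tr P Q y = y \<longleftrightarrow> onr y l" if y: "y \<in> \<Omega>" for y
  proof
    show "onr y l" if "tr P Q y = y" using tr_ne[OF l y] that by blast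
    assume "onr y l"
    hence "pr Q y = pr P y" using pr_ends l y by blast
    thus "tr P Q y = y" using tr[OF y] pr_pr[OF y] pr_ends[of "pr P y" l] pr_on[OF y \<open>onr y l\<close>] pr(1)[OF y] l by metis
  qed
  \<comment> \<open>With this \<open>y\<close> both chords pass through \<open>Q\<close>, so the
    intersection required of an axial map exists.\<close>
  define y where "y = pr P x"
  have y: "y \<in> \<Omega>" "\<not> onr y l" using pr pr_off x l y_def by blast+
  have ty: "tr P Q y = pr Q x" "tr P Q x = pr Q y" using tr x y y_def pr_pr by simp_all
  have "jp x Q \<noteq> jp y Q"
  proof
    assume h: "jp x Q = jp y Q"
    have "onr y (jp x Q)" using jp(1)[OF y(1), of Q] h by simp
    hence "y = x \<or> y = pr Q x" using onr_two[of x "pr Q x" y "jp x Q"] x y jp(1)[OF x(1)] pr[OF x(1), of Q] by metis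
    thus False using pr(2)[OF x(1)] pr_inj[OF x l(1,2)] l y_def by metis
  qed
  hence "rim_meet inc x (tr P Q y) y (tr P Q x) Q"
    unfolding rim_meet_def ty using jr_pr[OF x(1), of Q] jr_pr[OF y(1), of Q] jp(2)[OF x(1)] jp(2)[OF y(1)]
      pr(2)[OF x(1)] pr(2)[OF y(1)] by metis
  thus ?thesis unfolding order_preserving_axial_map_def
    using tr_permutes op fx tr_axial[OF l] x y ne by (metis id_apply)
qed

text \<open>The chords joining \<open>A\<close> to \<open>\<alpha> Y\<close> and \<open>Y\<close> to
  \<open>\<alpha> A\<close> cross on \<open>l\<close>, and since
  \<open>pr Z1 Y = \<alpha> A\<close>, they cross in \<open>Z1\<close>. So
  \<open>pr Z1 A = \<alpha> Y\<close>. In the same way, \<open>inv \<alpha> A\<close> in place of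
  \<open>A\<close> leads to the crossing point \<open>Z2\<close>.\<close>

lemma axial_translation:
  assumes ax: "order_preserving_axial_map inc \<alpha> l" and A: "A \<in> \<Omega>" "\<not> onr A l"
  obtains Z1 Z2 where "inc Z1 l" "inc Z2 l" "Z1 \<noteq> Z2" "\<alpha> A = pr Z1 (pr Z2 A)" "inv \<alpha> A = pr Z2 (pr Z1 A)"
proof -
  have pm: "\<alpha> permutes \<Omega>" and op: "order_preserving inc \<alpha>"
    and on_l: "\<And>X Y Z. \<lbrakk>X \<in> \<Omega>; Y \<in> \<Omega>; rim_meet inc X (\<alpha> Y) Y (\<alpha> X) Z\<rbrakk> \<Longrightarrow> inc Z l"
    and fx: "\<And>X. X \<in> \<Omega> \<Longrightarrow> \<alpha> X = X \<longleftrightarrow> onr X l"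
    and some: "\<exists>X\<in>\<Omega>. \<exists>Y\<in>\<Omega>. \<exists>Z. rim_meet inc X (\<alpha> Y) Y (\<alpha> X) Z"
    using ax unfolding order_preserving_axial_map_def by blast+
  have aO: "\<alpha> X \<in> \<Omega>" if "X \<in> \<Omega>" for X using permutes_in_image[OF pm] that by blast
  have inj: "X = Y" if "\<alpha> X = \<alpha> Y" for X Y using permutes_inj[OF pm] that by (simp add: inj_eq)
  obtain C where C: "compatible \<Omega> crs C" "\<And>X Y Z. \<lbrakk>X \<in> \<Omega>; Y \<in> \<Omega>; Z \<in> \<Omega>\<rbrakk> \<Longrightarrow> C X Y Z \<longleftrightarrow> C (\<alpha> X) (\<alpha> Y) (\<alpha> Z)"
    using op compatible_iff unfolding order_preserving_def by blast
  interpret compatible \<Omega> crs C by fact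
  obtain L M where E: "L \<in> \<Omega>" "M \<in> \<Omega>" "L \<noteq> M" "onr L l" "onr M l" by (rule line_ends[of l]) (rule that)
  have fLM: "\<alpha> L = L" "\<alpha> M = M" using fx E by blast+
  have offi: "\<not> onr x l" if "x \<in> \<Omega>" "x \<noteq> L" "x \<noteq> M" for x using onr_two[of L M x l] E that by blast
  have off\<alpha>: "\<not> onr (\<alpha> x) l" if "x \<in> \<Omega>" "\<not> onr x l" for x using fx[OF aO[OF that(1)]] fx[OF that(1)] inj that by blast
  have side: "SR l x (\<alpha> x)" if x: "x \<in> \<Omega>" "\<not> onr x l" for x
  proof -
    have "\<not> crs L M x (\<alpha> x)" using axial_side[of L M \<alpha>] E aO C(2) fLM x by blast
    moreover have "x \<noteq> \<alpha> x" using fx x by metis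
    ultimately show ?thesis using ends_line[OF E x aO[OF x(1)] off\<alpha>[OF x]] by blast
  qed
  \<comment> \<open>One crossing is part of the definition of an axial map;
    \<open>axial_crossing\<close> spreads it to every pair of rimpoints on opposite sides of
    \<open>l\<close>.\<close>
  have crossing: "crs x (\<alpha> y) y (\<alpha> x)" if S: "x \<in> \<Omega>" "\<not> onr x l" "y \<in> \<Omega>" "\<not> onr y l" and n: "\<not> SR l x y" for x y
  proof -
    have "x \<noteq> y" using n SR_refl S by blast
    hence c: "crs L M x y" using ends_line[OF E S] n by blast
    obtain x0 y0 where x0: "x0 \<in> \<Omega>" "y0 \<in> \<Omega>" "crs x0 (\<alpha> y0) y0 (\<alpha> x0)" using some unfolding rim_cross_def by blast
    have same: "\<not> crs u (\<alpha> v) v (\<alpha> u)"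
      if u: "u \<in> \<Omega>" "v \<in> \<Omega>" "u \<noteq> L" "u \<noteq> M" "v \<noteq> L" "v \<noteq> M" "\<not> crs L M u v" for u v
    proof
      assume k: "crs u (\<alpha> v) v (\<alpha> u)"
      then obtain Z where Z: "rim_meet inc u (\<alpha> v) v (\<alpha> u) Z" unfolding rim_cross_def by blast
      have o: "\<not> onr u l" "\<not> onr v l" using offi u by blast+
      have d: "u \<noteq> v" "u \<noteq> \<alpha> v" using crs_distinct[OF k u(1) aO u(2) aO] u by auto
      have "pr Z u = \<alpha> v" using Z pr_iff[OF u(1) aO[OF u(2)] d(2)] unfolding rim_meet_def by blast
      hence "\<not> SR l u (\<alpha> v)" using SR_pr[OF u(1) o(1) on_l[OF u(1,2) Z]] by simp
      hence "\<not> SR l u v" using SR_xor[OF u(1) o(1) u(2) o(2) aO[OF u(2)] off\<alpha>[OF u(2) o(2)]] side[OF u(2) o(2)] by blast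
      thus False using ends_line[OF E u(1) o(1) u(2) o(2) d(1)] u by blast
    qed
    have pres: "C (\<alpha> x) (\<alpha> y) (\<alpha> z)" if "x \<in> \<Omega>" "y \<in> \<Omega>" "z \<in> \<Omega>" "C x y z" for x y z using C(2) that by blast
    have nf: "\<alpha> x \<noteq> x" if "x \<in> \<Omega>" "x \<noteq> L" "x \<noteq> M" for x using fx[OF that(1)] offi that by blast
    show ?thesis using axial_crossing[OF E(1-3) aO inj pres fLM nf same x0 S(1,3) c] by blast
  qed
  obtain Z1 where Z1: "inc Z1 l" using ex_pt by blast
  define Y where "Y = pr Z1 (\<alpha> A)"
  have aA: "\<alpha> A \<in> \<Omega>" "\<not> onr (\<alpha> A) l" using aO off\<alpha> A by blast+
  have Y: "Y \<in> \<Omega>" "\<not> onr Y l" using pr pr_off aA Z1 Y_def by blast+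
  have nAY: "\<not> SR l A Y" using SR_xor[OF A aA Y] side[OF A] SR_pr[OF aA Z1] Y_def by simp
  then obtain Z2 where Z2: "inc Z2 l" "pr Z2 A = Y" using SR_meet[OF A Y] by blast
  have YA: "pr Z1 Y = \<alpha> A" using Y_def pr_pr aA by simp
  have aY: "\<alpha> Y \<in> \<Omega>" using aO Y by blast
  obtain Z where Z: "rim_meet inc A (\<alpha> Y) Y (\<alpha> A) Z" using crossing[OF A Y nAY] unfolding rim_cross_def by blast
  have Zl: "inc Z l" using on_l[OF A(1) Y(1) Z] .
  have "pr Z Y = \<alpha> A" using Z pr_iff[OF Y(1) aA(1)] unfolding rim_meet_def by blast
  hence "Z = Z1" using pr_inj[OF Y Zl Z1] YA by simp
  hence AY: "pr Z1 A = \<alpha> Y" using Z pr_iff[OF A(1) aY] unfolding rim_meet_def by blast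
  define B where "B = inv \<alpha> A"
  have B: "\<alpha> B = A" "B \<in> \<Omega>" using permutes_inverses(1)[OF pm] permutes_in_image[OF permutes_inv[OF pm]] A B_def by auto
  have Bl: "\<not> onr B l" using fx[OF B(2)] B A by metis
  have nBY: "\<not> SR l B Y" using SR_xor[OF B(2) Bl A Y] side[OF B(2) Bl] nAY B by simp
  obtain Z' where Z': "rim_meet inc B (\<alpha> Y) Y (\<alpha> B) Z'" using crossing[OF B(2) Bl Y nBY] unfolding rim_cross_def by blast
  have Z'l: "inc Z' l" using on_l[OF B(2) Y(1) Z'] .
  have "pr Z' Y = A" using Z' pr_iff[OF Y(1) A(1)] B unfolding rim_meet_def by metis
  hence "pr Z' A = Y" using pr_pr Y by metis
  hence "Z' = Z2" using pr_inj[OF A Z'l Z2(1)] Z2 by simp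
  hence "pr Z2 B = \<alpha> Y" using Z' pr_iff[OF B(2) aY] unfolding rim_meet_def by blast
  hence "B = pr Z2 (pr Z1 A)" using pr_pr[OF B(2)] AY by metis
  moreover have aA2: "\<alpha> A = pr Z1 (pr Z2 A)" using YA Z2 by simp
  moreover have "Z1 \<noteq> Z2" using aA2 pr_pr[OF A(1)] fx[OF A(1)] A by metis
  ultimately show ?thesis using that Z1 Z2 B_def by blast
qed

section \<open>The reflection computed from an axial map\<close>

lemma ends_set:
  assumes "L1 \<in> \<Omega>" "L2 \<in> \<Omega>" "L1 \<noteq> L2" "onr L1 l" "onr L2 l"
  shows "{X \<in> \<Omega>. onr X l} = {L1, L2}"
  using onr_two[of L1 L2 _ l] assms by blast

text \<open>Of the two ways to join the ends of \<open>l\<close> to those of \<open>m\<close>, only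
  one gives crossing chords, so the labelling does not matter.\<close>

lemma bowtie_eq:
  assumes L: "L1 \<in> \<Omega>" "L2 \<in> \<Omega>" "L1 \<noteq> L2" "onr L1 l" "onr L2 l"
    and M: "M1 \<in> \<Omega>" "M2 \<in> \<Omega>" "M1 \<noteq> M2" "onr M1 m" "onr M2 m"
    and r: "rim_meet inc L1 M2 L2 M1 Z"
  shows "bowtie inc l m = Z"
proof -
  note l = ends_set[OF L] and m = ends_set[OF M]
  show ?thesis unfolding bowtie_def
  proof (rule the_equality)
    show "\<exists>L1 L2 M1 M2. {X \<in> \<Omega>. onr X l} = {L1, L2} \<and> L1 \<noteq> L2 \<and> {X \<in> \<Omega>. onr X m} = {M1, M2} \<and> M1 \<noteq> M2 \<and>
      rim_meet inc L1 M2 L2 M1 Z" using l m L M r by blast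
    fix Z' assume "\<exists>L1 L2 M1 M2. {X \<in> \<Omega>. onr X l} = {L1, L2} \<and> L1 \<noteq> L2 \<and> {X \<in> \<Omega>. onr X m} = {M1, M2} \<and> M1 \<noteq> M2 \<and>
      rim_meet inc L1 M2 L2 M1 Z'"
    then obtain A B C D where "{X \<in> \<Omega>. onr X l} = {A, B}" "{X \<in> \<Omega>. onr X m} = {C, D}"
      and h3: "rim_meet inc A D B C Z'" by (elim exE conjE) (rule that; assumption)
    hence h: "{L1, L2} = {A, B}" "{M1, M2} = {C, D}" using l m by (metis (no_types))+
    have "(A = L1 \<and> B = L2) \<or> (A = L2 \<and> B = L1)" "(C = M1 \<and> D = M2) \<or> (C = M2 \<and> D = M1)"
      using h(1,2) by (metis doubleton_eq_iff)+
    moreover have "\<not> crs L1 M1 L2 M2"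
      using sep.un2[of L1 M2 L2 M1] r L M sep.syms unfolding rim_cross_def by blast
    hence "\<not> rim_meet inc L1 M1 L2 M2 Z'" "\<not> rim_meet inc L2 M2 L1 M1 Z'"
      using sep.syms unfolding rim_cross_def by blast+
    ultimately have "rim_meet inc L1 M2 L2 M1 Z' \<or> rim_meet inc L2 M1 L1 M2 Z'" using h3 by blast
    thus "Z' = Z" using r uniq unfolding rim_meet_def by metis
  qed
qed

text \<open>With \<open>S\<close> the product of \<open>Z2\<close>, \<open>Z1\<close> and the foot
  \<open>R\<close>, the images of \<open>A\<close> are \<open>pr R (pr S A)\<close> and
  \<open>pr S (pr R A)\<close>, whose join is a line of (A11). The common parallels meet in the
  bowtie point, which is thus on the line from \<open>A\<close> to \<open>R\<close>, so it takes
  \<open>A\<close> to the same rimpoint as \<open>R\<close> does.\<close>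

lemma axial_bowtie:
  assumes ax: "order_preserving_axial_map inc \<alpha> l" and A: "A \<in> \<Omega>" "\<not> onr A l"
  shows "pr (bowtie inc l (jr (\<alpha> A) (inv \<alpha> A))) A = sg l A"
proof -
  obtain Z1 Z2 where Z: "inc Z1 l" "inc Z2 l" "Z1 \<noteq> Z2" "\<alpha> A = pr Z1 (pr Z2 A)" "inv \<alpha> A = pr Z2 (pr Z1 A)"
    using axial_translation[OF ax A] .
  define R where "R = ft l A"
  have Rl: "inc R l" and R: "foot l A R" using ft_inc ft(1) A R_def by blast+
  obtain S where S: "inc S l" "\<And>x. x \<in> \<Omega> \<Longrightarrow> pr R (pr Z1 (pr Z2 x)) = pr S x" using pr_three[OF Z(2,1) Rl] by blast
  have in1: "pr R A \<in> \<Omega>" "pr Z1 (pr Z2 A) \<in> \<Omega>" "pr Z2 (pr Z1 A) \<in> \<Omega>" using pr A by simp_all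
  have 1: "pr R (pr S A) = \<alpha> A" using S(2)[OF A(1)] pr_pr in1 Z(4) by metis
  have "pr S (pr R A) = pr Z2 (pr Z1 (pr R (pr R A)))" using S(2)[OF in1(1)] pr_rev[OF Z(2,1) Rl in1(1)] by simp
  hence 2: "pr S (pr R A) = inv \<alpha> A" using pr_pr A Z(5) by simp
  have ne: "\<alpha> A \<noteq> inv \<alpha> A" using translation_not_involutive[OF Z(1,2,3) A] Z(4,5) by simp
  hence "S \<noteq> R" using 1 2 by metis
  define m where "m = jr (\<alpha> A) (inv \<alpha> A)"
  have cp: "CP l m (jp A R)" using R S(1) \<open>S \<noteq> R\<close> 1 2 unfolding foot_def m_def by metis
  have in2: "\<alpha> A \<in> \<Omega>" "inv \<alpha> A \<in> \<Omega>" using in1 Z by simp_all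
  have onm: "onr (\<alpha> A) m" "onr (inv \<alpha> A) m" using jr[OF in2 ne] m_def by simp_all
  have off: "\<not> onr (\<alpha> A) l" "\<not> onr (inv \<alpha> A) l" unfolding Z(4,5) using pr_off pr A Z(1,2) by simp_all
  have no: "\<not> (onr x l \<and> onr x m)" if "x \<in> \<Omega>" for x using onr_two[OF in2 that onm _ ne] off by blast
  obtain G1 G2 H1 H2 W where G: "G1 \<in> \<Omega>" "G2 \<in> \<Omega>" "G1 \<noteq> G2" "onr G1 l" "onr G2 l"
    "H1 \<in> \<Omega>" "H2 \<in> \<Omega>" "H1 \<noteq> H2" "onr H1 m" "onr H2 m" "inc W (jp A R)" "pr W G1 = H1" "pr W G2 = H2"
    using CP_ends[OF cp no] by metis
  have "jp G1 W \<noteq> jp G2 W"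
  proof
    assume h: "jp G1 W = jp G2 W"
    have "onr H1 (jp G1 W)" "onr G1 (jp G1 W)" "onr G2 (jp G1 W)" using pr(3)[OF G(1), of W] G(12) jp(1)[OF G(1)] jp(1)[OF G(2), of W] h by metis+
    hence "H1 = G1 \<or> H1 = G2" using onr_two[OF G(1,2,6)] G(3) by blast
    thus False using no G by blast
  qed
  hence "rim_meet inc G1 H1 G2 H2 W"
    unfolding rim_meet_def using jr_pr[OF G(1), of W] jr_pr[OF G(2), of W] G(12,13) jp(2)[OF G(1)] jp(2)[OF G(2)] pr(2)[OF G(1)] pr(2)[OF G(2)] by metis
  hence "bowtie inc l m = W" using bowtie_eq[OF G(1-5) G(7,6) G(8)[symmetric] G(10,9)] by blast
  moreover have "pr W A = pr R A"
    using pr_eq[OF A(1) pr(1)[OF A(1)] pr(2)[OF A(1), symmetric] jp(1)[OF A(1)] pr(3)[OF A(1)] G(11)] .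
  ultimately show ?thesis using A R_def unfolding sg_def m_def by simp
qed

lemma reflection_eq: assumes "A \<in> \<Omega>" shows "reflection inc l A = sg l A"
proof (cases "onr A l")
  case True thus ?thesis unfolding reflection_def sg_def by simp
next
  case False
  obtain P where P: "inc P l" using ex_pt by blast
  obtain Q where Q: "inc Q l" "Q \<noteq> P" using ex_pt2 by blast
  have ax: "order_preserving_axial_map inc (tr P Q) l" using tr_axial_map P Q by blast
  have "(THE B. \<exists>\<alpha>. order_preserving_axial_map inc \<alpha> l \<and> B = pr (bowtie inc l (jr (\<alpha> A) (inv \<alpha> A))) A) = sg l A"
    using axial_bowtie[OF ax assms False] axial_bowtie[OF _ assms False] ax by (intro the_equality) metis+
  thus ?thesis using False unfolding reflection_def by simp
qed

section \<open>Perpendicular lines\<close>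

lemma perpendicularI:
  assumes M: "M1 \<in> \<Omega>" "M2 \<in> \<Omega>" "M1 \<noteq> M2" "onr M1 m" "onr M2 m" and n: "\<not> onr M1 n" "sg n M1 = M2"
  shows "perpendicular inc n m"
proof -
  have "sg n M2 = M1" using sg_sg[OF M(1)] n by metis
  moreover have "pr (ft n M1) M1 = M2" using n unfolding sg_def by simp
  hence "inc (ft n M1) m" using pr_iff[OF M(1-3)] jr_eq[OF M] by simp
  moreover have "n \<noteq> m" using M n by blast
  ultimately have "meets inc n m" unfolding meets_def using ft_inc[OF M(1) n(1)] by blast
  thus ?thesis unfolding perpendicular_def
    using ends_set[OF M] M(3) reflection_eq M n \<open>sg n M2 = M1\<close> by metis
qed

text \<open>Put \<open>y = pr Z1 L1\<close>. For \<open>M\<close> or else for \<open>pr Z M\<close>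
  in its place, some \<open>S\<close> on \<open>l\<close> takes \<open>pr Z M\<close> to
  \<open>y\<close>. (A11) at the foot \<open>Z\<close> yields \<open>W\<close> on \<open>n\<close>
  taking the ends of \<open>l\<close> to \<open>y\<close> and \<open>y' = pr Z (pr S M)\<close>, and
  \<open>W = Z1\<close>. But \<open>y'\<close> is also \<open>sg l (pr Z y)\<close>, because
  \<open>sg l\<close> commutes with \<open>Z\<close> and \<open>S\<close> and takes \<open>M\<close>
  to \<open>pr Z M\<close>.\<close>

lemma perp_key:
  assumes l: "inc Z l" and M: "M \<in> \<Omega>" "\<not> onr M l" "ft l M = Z" and n: "n = jp M Z"
    and L: "L1 \<in> \<Omega>" "onr L1 l" and Z1: "inc Z1 n"
  shows "sg l (pr Z (pr Z1 L1)) = pr Z1 (pr Z L1)"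
proof -
  define L2 where "L2 = pr Z L1"
  have L2: "L2 \<in> \<Omega>" "onr L2 l" "L1 \<noteq> L2" using pr[OF L(1)] pr_on[OF L l] L2_def by metis+
  have Zn: "inc Z n" and Mn: "onr M n" using jp[OF M(1)] n by blast+
  have nl: "n \<noteq> l" using Mn M by blast
  have Ln: "\<not> onr L1 n" "\<not> onr L2 n" using onr_dj[OF L(1) _ L(2) nl] onr_dj[OF L2(1) _ L2(2) nl] Zn l djD by blast+
  have L12: "\<not> SR n L1 L2" using SR_pr[OF L(1) Ln(1) Zn] L2_def by simp
  show ?thesis
  proof (cases "Z1 = Z")
    case True
    have "pr Z (pr Z1 L1) = L1" using True pr_pr L by simp
    thus ?thesis using True pr_pr[OF L(1)] L unfolding sg_def by simp
  next
    case False
    have Z1l: "\<not> inc Z1 l" using False uniq Zn Z1 l nl by metis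
    define y where "y = pr Z1 L1"
    have y: "y \<in> \<Omega>" "y \<noteq> L1" using pr[OF L(1)] y_def by blast+
    have yl: "\<not> onr y l"
    proof
      assume "onr y l"
      hence "jr L1 y = l" using jr_eq[OF L(1) y(1)] y L by metis
      thus False using pr_iff[OF L(1) y(1)] y y_def Z1l by metis
    qed
    have key: "sg l (pr Z y) = pr Z1 L2" if M: "M \<in> \<Omega>" "\<not> onr M l" "ft l M = Z" and n': "n = jp M Z" and s: "SR l M y" for M
    proof -
      have M': "pr Z M \<in> \<Omega>" "\<not> onr (pr Z M) l" using pr pr_off M l by blast+
      have Mn: "onr M n" using jp[OF M(1)] n' by blast
      have "\<not> SR l (pr Z M) y" using SR_xor[OF M(1,2) M' y(1) yl] SR_pr[OF M(1,2) l] s by blast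
      then obtain S where S: "inc S l" "pr S (pr Z M) = y" using SR_meet[OF M' y(1) yl] by blast
      have yM: "y \<noteq> M"
      proof
        assume "y = M"
        hence "pr Z1 M = L1" using y_def pr_pr L by metis
        moreover have "onr (pr Z1 M) n" using pr_on[OF M(1) Mn Z1] .
        ultimately show False using Ln by simp
      qed
      hence SZ: "S \<noteq> Z" using S pr_pr M by metis
      define y' where "y' = pr Z (pr S M)"
      have y': "y' \<in> \<Omega>" "\<not> onr y' l" using pr pr_off M l S y'_def by simp_all
      have ne: "y' \<noteq> y" using translation_not_involutive[OF l S(1) SZ[symmetric] M(1,2)] S y'_def by simp
      have "foot l M Z" using ft(1)[OF M(1,2)] M(3) by simp
      hence cp: "CP l (jr y' y) n" using S SZ y'_def n' unfolding foot_def by metis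
      define m where "m = jr y' y"
      have m: "onr y' m" "onr y m" using jr[OF y'(1) y(1) ne] m_def by simp_all
      have no: "\<not> (onr x l \<and> onr x m)" if "x \<in> \<Omega>" for x using onr_two[OF y'(1) y(1) that m _ ne] y' yl by blast
      obtain G1 G2 H1 H2 W where G: "G1 \<in> \<Omega>" "G2 \<in> \<Omega>" "G1 \<noteq> G2" "onr G1 l" "onr G2 l"
        "H1 \<in> \<Omega>" "H2 \<in> \<Omega>" "H1 \<noteq> H2" "onr H1 m" "onr H2 m" "inc W n" "pr W G1 = H1" "pr W G2 = H2"
        using CP_ends[OF cp[folded m_def] no] by metis
      have "G1 = L1 \<or> G1 = L2" "G2 = L1 \<or> G2 = L2" using onr_two[OF L(1) L2(1) _ L(2) L2(2) _ L2(3)] G by blast+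
      moreover have "H1 = y' \<or> H1 = y" "H2 = y' \<or> H2 = y" using onr_two[OF y'(1) y(1) _ m _ ne] G by blast+
      ultimately have "(pr W L1 = y \<and> pr W L2 = y') \<or> (pr W L2 = y \<and> pr W L1 = y')" using G by metis
      \<comment> \<open>Since \<open>W\<close> and \<open>Z1\<close> are on \<open>n\<close>, the
        rimpoint \<open>y\<close> would be opposite to both ends of \<open>l\<close> with respect to
        \<open>n\<close>, but these are opposite to each other.\<close>
      moreover have "pr W L2 \<noteq> y"
      proof
        assume h: "pr W L2 = y"
        have yn: "\<not> onr y n" using pr_off[OF L(1) Ln(1) Z1] y_def by simp
        have "\<not> SR n L2 y" using SR_pr[OF L2(1) Ln(2) G(11)] h by simp
        moreover have "\<not> SR n L1 y" using SR_pr[OF L(1) Ln(1) Z1] y_def by simp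
        ultimately show False using SR_xor[OF L(1) Ln(1) y(1) yn L2(1) Ln(2)] L12 SR_sym by blast
      qed
      ultimately have h: "pr W L1 = y" "pr W L2 = y'" by blast+
      have "W = Z1" using pr_inj[OF L(1) Ln(1) G(11) Z1] h y_def by simp
      have "sg l (pr Z y) = pr Z (pr S (pr Z (sg l M)))"
        unfolding S(2)[symmetric] using sg_pr l S(1) M(1) M'(1) pr(1) by simp
      also have "sg l M = pr Z M" using M unfolding sg_def by simp
      finally have "sg l (pr Z y) = y'" using pr_pr M y'_def by simp
      thus ?thesis using h \<open>W = Z1\<close> by simp
    qed
    have "sg l (pr Z y) = pr Z1 L2"
    proof (cases "SR l M y")
      case True thus ?thesis using key M n by blast
    next
      case False
      have M': "pr Z M \<in> \<Omega>" "\<not> onr (pr Z M) l" using pr pr_off M l by blast+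
      have "ft l (pr Z M) = Z" using ft_cj[OF M(1,2) l] M(3) cj_self by simp
      moreover have "jp (pr Z M) Z = n" using jp_eq[OF M'(1), of n Z] pr(3)[OF M(1)] n Zn by metis
      moreover have "SR l (pr Z M) y" using SR_xor[OF M(1,2) M' y(1) yl] SR_pr[OF M(1,2) l] False by blast
      ultimately show ?thesis using key[OF M'] by simp
    qed
    thus ?thesis using y_def L2_def by simp
  qed
qed

text \<open>By \<open>perp_key\<close> the line of (A11) for \<open>L1\<close> and \<open>S\<close>
  on \<open>n\<close> joins \<open>w\<close> to \<open>sg l w\<close>. A point \<open>V\<close> of
  \<open>l\<close> that takes \<open>M\<close> to one of these takes \<open>sg l M\<close> to the
  other, so \<open>n\<close> and that line have common parallels meeting on \<open>l\<close>. Hence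
  \<open>Z\<close> is the foot on \<open>n\<close> too: perpendicularity is symmetric.\<close>

lemma perp_foot:
  assumes l: "inc Z l" and M: "M \<in> \<Omega>" "\<not> onr M l" "ft l M = Z" and n: "n = jp M Z"
    and L: "L1 \<in> \<Omega>" "onr L1 l"
  shows "\<not> onr L1 n" "sg n L1 = pr Z L1"
proof -
  define L2 where "L2 = pr Z L1"
  have L2: "L2 \<in> \<Omega>" "onr L2 l" "L1 \<noteq> L2" using pr[OF L(1)] pr_on[OF L l] L2_def by metis+
  have Zn: "inc Z n" and Mn: "onr M n" using jp[OF M(1)] n by blast+
  have nl: "n \<noteq> l" using Mn M by blast
  show L1n: "\<not> onr L1 n" using onr_dj[OF L(1) _ L(2) nl] Zn l djD by blast
  have L2n: "\<not> onr L2 n" using onr_dj[OF L2(1) _ L2(2) nl] Zn l djD by blast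
  have sM: "sg l M = pr Z M" using M unfolding sg_def by simp
  have "CP n (jr (pr Z (pr S L1)) (pr S (pr Z L1))) (jp L1 Z)" if S: "inc S n" "S \<noteq> Z" for S
  proof -
    define w where "w = pr S L2"
    have Sl: "\<not> inc S l" using S uniq Zn l nl by metis
    have w: "w \<in> \<Omega>" "w \<noteq> L2" using pr[OF L2(1)] w_def by blast+
    have wl: "\<not> onr w l"
    proof
      assume "onr w l"
      hence "jr L2 w = l" using jr_eq[OF L2(1) w(1)] w L2 by metis
      thus False using pr_iff[OF L2(1) w(1)] w w_def Sl by metis
    qed
    have "sg l (pr Z (pr S L1)) = w" using perp_key[OF l M n L S(1)] L2_def w_def by simp
    hence e: "pr Z (pr S L1) = sg l w" using sg_sg[of "pr Z (pr S L1)" l] pr(1) L by simp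
    have sw: "sg l w \<in> \<Omega>" "sg l w \<noteq> w" using sg_in sg_SR SR_refl w wl by metis+
    have off: "\<not> onr w n" "\<not> onr (sg l w) n"
      unfolding w_def e[symmetric, unfolded w_def] using pr_off[OF L2(1) L2n S(1)] pr_off[OF _ _ Zn] pr_off[OF L(1) L1n S(1)] pr(1)[OF L(1)] by blast+
    define m where "m = jr (sg l w) w"
    have m: "onr (sg l w) m" "onr w m" using jr[OF sw(1) w(1) sw(2)] m_def by simp_all
    have no: "\<not> (onr x n \<and> onr x m)" if "x \<in> \<Omega>" for x using onr_two[OF sw(1) w(1) that m _ sw(2)] off by blast
    have M': "sg l M \<in> \<Omega>" "M \<noteq> sg l M" "onr (sg l M) n" using sM pr[OF M(1)] n by metis+
    have "CP n m l"
    proof (cases "SR l M w")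
      case False
      then obtain V where V: "inc V l" "pr V M = w" using SR_meet[OF M(1,2) w(1) wl] by blast
      have "pr V (sg l M) = sg l w" using sg_pr[OF M(1) V(1)] V by simp
      thus ?thesis using CP_I[OF no M(1) M'(1,2) Mn M'(3) m(2,1) V] by blast
    next
      case True
      have swl: "\<not> onr (sg l w) l" using sg_off w wl by blast
      have "\<not> SR l M (sg l w)" using SR_xor[OF M(1,2) w(1) wl sw(1) swl] True sg_SR[OF w(1) wl] by blast
      then obtain V where V: "inc V l" "pr V M = sg l w" using SR_meet[OF M(1,2) sw(1) swl] by blast
      have "pr V (sg l M) = w" using sg_pr[OF M(1) V(1)] V sg_sg[OF w(1)] by simp
      thus ?thesis using CP_I[OF no M(1) M'(1,2) Mn M'(3) m V] by blast
    qed
    moreover have "jp L1 Z = l" using jp_eq[OF L l] .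
    ultimately show ?thesis using e w_def L2_def m_def by simp
  qed
  hence "foot n L1 Z" unfolding foot_def using Zn by blast
  hence "ft n L1 = Z" using ft(2)[OF L(1) L1n] by simp
  thus "sg n L1 = pr Z L1" using L1n unfolding sg_def by simp
qed

text \<open>A rimpoint \<open>x\<close> off \<open>n\<close> is opposite to one end \<open>L\<close>
  of \<open>l\<close>, so \<open>x = pr Z1 L\<close> with \<open>Z1\<close> on \<open>n\<close>.
  Then \<open>sg n x\<close> is known from \<open>perp_foot\<close> and \<open>sg_pr\<close>, and
  \<open>perp_key\<close> gives it the stated form.\<close>

lemma perp_sg:
  assumes l: "inc Z l" and M: "M \<in> \<Omega>" "\<not> onr M l" "ft l M = Z" and n: "n = jp M Z"
    and x: "x \<in> \<Omega>" "\<not> onr x n"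
  shows "sg n x = sg l (pr Z x)"
proof -
  obtain L1 where L1: "L1 \<in> \<Omega>" "onr L1 l" using line_ends by metis
  define L2 where "L2 = pr Z L1"
  have L2: "L2 \<in> \<Omega>" "onr L2 l" using pr[OF L1(1)] pr_on[OF L1 l] L2_def by metis+
  have Zn: "inc Z n" using jp[OF M(1)] n by blast
  have *: ?thesis if h: "L \<in> \<Omega>" "onr L l" "\<not> SR n L x" for L
  proof -
    note f = perp_foot[OF l M n h(1,2)]
    obtain Z1 where Z1: "inc Z1 n" "pr Z1 L = x" using SR_meet[OF h(1) f(1) x] h by blast
    have "sg n x = pr Z1 (pr Z L)" using sg_pr[OF h(1) Z1(1)] Z1 f by simp
    thus ?thesis using perp_key[OF l M n h(1,2) Z1(1)] Z1 by simp
  qed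
  have o: "\<not> onr L1 n" "\<not> onr L2 n" using perp_foot(1)[OF l M n] L1 L2 by blast+
  have "\<not> SR n L1 L2" using SR_pr[OF L1(1) o(1) Zn] L2_def by simp
  hence "\<not> SR n L1 x \<or> \<not> SR n L2 x" using SR_xor[OF L1(1) o(1) x L2(1) o(2)] SR_sym by blast
  thus ?thesis using * L1 L2 by blast
qed

end

theorem theorem5p2:
  fixes inc :: "'p \<Rightarrow> 'l \<Rightarrow> bool"
    and A B C D E F :: "'l rimpoint"
    and P Q :: 'p
  assumes "axiom_A1 inc" and "axiom_A2 inc" and "axiom_A3 inc" and "axiom_A4 inc"
    and "axiom_A5 inc" and "axiom_A6 inc" and "axiom_A7 inc"
    and "axiom_A10 inc" and "axiom_A11 inc"
    and "{A, B, C, D, E, F} \<subseteq> rimpoints inc" and "distinct [A, B, C, D, E, F]"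
    and "rim_meet inc A B D E P" and "rim_meet inc B C E F Q"
  shows "(\<exists>R. rim_meet inc C D F A R \<and> inc R (join inc (Fin P) (Fin Q))) \<or>
         (\<exists>n. perpendicular inc n (rim_join inc C D) \<and> perpendicular inc n (rim_join inc F A) \<and>
              perpendicular inc n (join inc (Fin P) (Fin Q)))"
proof -
  interpret menger_full inc by unfold_locales fact+
  have S: "A \<in> \<Omega>" "B \<in> \<Omega>" "C \<in> \<Omega>" "D \<in> \<Omega>" "E \<in> \<Omega>" "F \<in> \<Omega>" using assms(10) by auto
  have ne: "A \<noteq> B" "A \<noteq> C" "B \<noteq> C" "C \<noteq> D" "D \<noteq> E" "E \<noteq> F" "A \<noteq> F" "D \<noteq> F" "C \<noteq> F" "A \<noteq> D"
    using assms(11) by simp_all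
  have p: "pr P A = B" "pr P D = E" "pr Q B = C" "pr Q E = F"
    using assms(12,13) pr_iff S ne unfolding rim_meet_def by metis+
  have PQ: "P \<noteq> Q" using p pr_pr S ne by metis
  define l where "l = ln P Q"
  have l: "inc P l" "inc Q l" using ln_inc PQ l_def by simp_all
  have inv: "pr P B = A" "pr P E = D" "pr Q C = B" "pr Q F = E" using p pr_pr S by metis+
  have on2: "onr x l \<Longrightarrow> pr Q (pr P x) = x" if "x \<in> \<Omega>" for x
    using that pr_ends[OF _ _ l] pr_pr by simp
  have off: "\<not> onr A l" "\<not> onr D l" using on2[OF S(1)] on2[OF S(4)] p ne by metis+
  have offB: "\<not> onr B l" "\<not> onr E l" using pr_off off S l p by metis+
  have offC: "\<not> onr C l" "\<not> onr F l" using pr_off offB S l p by metis+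
  have CA: "A = pr P (pr Q C)" "F = pr Q (pr P D)" using p inv by simp_all
  show ?thesis
  proof (cases "SR l C D")
    case False
    then obtain R where R: "inc R l" "pr R C = D" using SR_meet[OF S(3) offC(1) S(4) off(2)] by blast
    have "pr R A = pr Q (pr P (pr R C))" using pr_rev[OF l(2,1) R(1) S(3)] CA by simp
    hence RA: "pr R A = F" using R CA by simp
    have "inc R (jr C D)" "inc R (jr F A)" using R pr_iff[OF S(3,4) ne(4)] RA pr_iff[OF S(1,6) ne(7)] jr_sym by metis+
    moreover have "jr C D \<noteq> jr F A"
      using onr_two[OF S(3,4,1), of "jr C D"] jr[OF S(3,4) ne(4)] jr[OF S(6,1) ne(7)[symmetric]] ne by metis
    ultimately have "rim_meet inc C D F A R" unfolding rim_meet_def using ne by blast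
    thus ?thesis using R join_fin l_def by metis
  next
    case True
    define f where "f = ft l C"
    have fl: "inc f l" using ft_inc[OF S(3) offC(1)] f_def by simp
    have sC: "sg l C = pr f C" using offC f_def unfolding sg_def by simp
    have sCi: "sg l C \<in> \<Omega>" "\<not> onr (sg l C) l" using sg_in sg_off S offC by blast+
    have "\<not> SR l (sg l C) D" using SR_xor[OF S(3) offC(1) sCi S(4) off(2)] sg_SR[OF S(3) offC(1)] True by blast
    then obtain Z where Z: "inc Z l" "pr Z (sg l C) = D" using SR_meet[OF sCi S(4) off(2)] by blast
    have rC: "sg l (pr Z C) = D" using sg_pr[OF S(3) Z(1)] Z by simp
    have "f \<noteq> Z" using Z sC pr_pr[OF S(3)] ne by metis
    \<comment> \<open>\<open>V\<close> carries the foot \<open>f\<close> of \<open>C\<close> to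
      \<open>Z\<close>, so \<open>Z\<close> is the foot of \<open>M = pr V C\<close>, and the line
      \<open>MZ\<close> is perpendicular to \<open>l\<close>.\<close>
    then obtain V where V: "inc V l" "cj V f = Z" using midpoint[OF fl Z(1)] by blast
    define M where "M = pr V C"
    have M: "M \<in> \<Omega>" "\<not> onr M l" "ft l M = Z"
      using pr pr_off S offC V ft_cj[OF S(3) offC(1) V(1)] f_def M_def by simp_all
    define n where "n = jp M Z"
    have sg_n: "sg n x = sg l (pr Z x)" if "x \<in> \<Omega>" "\<not> onr x n" for x using perp_sg[OF Z(1) M n_def that] .
    \<comment> \<open>The map fixes the ends of \<open>n\<close>; as it takes \<open>C\<close> to
      \<open>D\<close> and \<open>A\<close> to \<open>F\<close>, neither \<open>C\<close> nor
      \<open>A\<close> is an end of \<open>n\<close>.\<close>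
    have fixn: "sg l (pr Z x) = x" if x: "x \<in> \<Omega>" "onr x n" for x
    proof -
      have sM: "sg l M = pr Z M" using M unfolding sg_def by simp
      have "x = M \<or> x = pr Z M"
        using onr_two[OF M(1) pr(1)[OF M(1)] x(1) _ _ x(2) pr(2)[OF M(1), symmetric]] jp(1)[OF M(1)] pr(3)[OF M(1)] n_def by blast
      thus ?thesis using sg_pr[OF M(1) Z(1)] sM pr_pr[OF M(1)] by auto
    qed
    have Cn: "\<not> onr C n" using fixn[OF S(3)] rC ne by metis
    have zP: "pr Z A = pr Q (pr P (pr Z C))" using pr_rev[OF l(2,1) Z(1) S(3)] CA by simp
    have zC: "pr Z C \<in> \<Omega>" "pr P (pr Z C) \<in> \<Omega>" using pr S by simp_all
    have rA: "sg l (pr Z A) = F"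
      unfolding zP using sg_pr[OF zC(2) l(2)] sg_pr[OF zC(1) l(1)] rC CA by simp
    have An: "\<not> onr A n" using fixn[OF S(1)] rA ne by metis
    have "perpendicular inc n (jr C D)"
      using perpendicularI[OF S(3,4) ne(4) jr[OF S(3,4) ne(4)] Cn] sg_n[OF S(3) Cn] rC by simp
    moreover have "perpendicular inc n (jr A F)"
      using perpendicularI[OF S(1,6) ne(7) jr[OF S(1,6) ne(7)] An] sg_n[OF S(1) An] rA by simp
    moreover have "perpendicular inc n l"
    proof -
      obtain L where L: "L \<in> \<Omega>" "onr L l" using line_ends by metis
      note pf = perp_foot[OF Z(1) M n_def L]
      show ?thesis using perpendicularI[OF L(1) pr(1)[OF L(1)] pr(2)[OF L(1), symmetric] L(2) pr_on[OF L Z(1)] pf] .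
    qed
    ultimately show ?thesis using join_fin l_def jr_sym by metis
  qed
qed

end
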